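(* Let $W$, $S(W)$, the singular points $a_j$, the cell $W_{\Lambda^*}$, $g$ and $h$ be as in the context. Let $w$ be such that on each interval $[A_0,A_1]=[a_j,a_{j+1}]\subset\overline{W_{\Lambda^*}}$ one has $w\in C^0([A_0,A_1];S_\alpha(W))$ and $$w=w_2+\sqrt{\alpha-A_0}\,w_0+\sqrt{\alpha-A_1}\,w_1$$ with $w_0,w_1,w_2\in C^\infty([A_0,A_1];S(W))$ (depending on the interval), and set $v(t,\cdot)=w(g(t),\cdot)g'(t)$. Given an even positive integer $N$, define the numerical inverse Bloch transform as follows. 1. If $\overline{W_{\Lambda^*}}=[a_0,a_1]$, let $t_j=a_0+j(a_1-a_0)/N$ for $j=1,\dots,N$ and $$(\mathcal{J}^{-1}_{\Omega,N}w)(x)=\frac{a_1-a_0}{N}\sum_{j=1}^Nw(g(t_j),x)g'(t_j).$$ 2. If $\overline{W_{\Lambda^*}}=[a_0,a_2]$, let $t_j=a_0+j(a_1-a_0)/N$ and $t_{j+N}=a_1+j(a_2-a_1)/N$ for $j=1,\dots,N$ and $$(\mathcal{J}^{-1}_{\Omega,N}w)(x)=\frac{a_1-a_0}{N}\sum_{j=1}^Nw(g(t_j),x)g'(t_j)+\frac{a_2-a_1}{N}\sum_{j=N+1}^{2N}w(g(t_j),x)g'(t_j).$$ If $h(t)=O(t^{m+1})$ as $t\to0^+$ for some positive integer $m$, then there is a constant $C$ independent of $N$ and $w$ such that, for large enough $N$, $$\|\mathcal{J}^{-1}_{\Omega,N}w-\mathcal{J}^{-1}_\Omega w\|_{S(W)}\le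 C\,N^{-2m-1/2}\max_{[A_0,A_1]}\|v\|_{C^{2m+1}([A_0,A_1];S(W))}.$$ If $h(t)=o(t^{n+1})$ as $t\to0^+$ for every positive integer $n$, then for every positive integer $n$ there is a constant $C$ independent of $N$ and $w$ such that, for large enough $N$, $$\|\mathcal{J}^{-1}_{\Omega,N}w-\mathcal{J}^{-1}_\Omega w\|_{S(W)}\le C\,N^{-2n-1/2}\max_{[A_0,A_1]}\|v\|_{C^{2n+1}([A_0,A_1];S(W))}.$$ The maxima are over the intervals $[A_0,A_1]=[a_0,a_1]$ (case 1) or $[A_0,A_1]\in\{[a_0,a_1],[a_1,a_2]\}$ (case 2).
   Context: Domain. $\Lambda>0$, $\Lambda^*=2\pi/\Lambda$, $k>0$; $\zeta:\mathbb{R}\to\mathbb{R}$ is Lipschitz and $\Lambda$-periodic, $H>\sup\zeta$, $\Omega_H^\Lambda=\{(x_1,x_2):-\Lambda/2<x_1\le\Lambda/2,\ \zeta(x_1)<x_2<H\}$, and $W=\Omega_H^\Lambda$. $S(W)$ is one of the Sobolev spaces $H^n(\Omega_H^\Lambda)$ or $\widetilde H^n(\Omega_H^\Lambda)$, $n=0,1,2$, where $\widetilde H^n$ is the subspace of functions with zero trace on the bottom boundary $\{x_2=\zeta(x_1)\}$ (for $n=0$ only $L^2$ is meant). For real $\alpha$, $S_\alpha(W)$ is the subspace of $\alpha$-quasi-periodic functions, i.e. those whose extension by $\phi(x_1+\Lambda,x_2)=e^{\mathrm{i}\alpha\Lambda}\phi(x_1,x_2)$ is locally of the same Sobolev class.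 Singular points. Let $\underline{k}=\min\{|\Lambda^*n-k|:n\in\mathbb{Z}\}\in[0,\Lambda^*/2]$ and $W_{\Lambda^*}=(-\underline{k},\Lambda^*-\underline{k}]$. If $\underline{k}\in\{0,\Lambda^*/2\}$, put $a_0=-\underline{k}$, $a_1=\Lambda^*-\underline{k}$, so $\overline{W_{\Lambda^*}}=[a_0,a_1]$ (case 1). Otherwise put $a_0=-\underline{k}$, $a_1=\underline{k}$, $a_2=\Lambda^*-\underline{k}$, so $\overline{W_{\Lambda^*}}=[a_0,a_2]$ (case 2). Function spaces. $C^n([A_0,A_1];S(W))$ is the space of functions $f(t,x)$ such that $t\mapsto f(t,\cdot)\in S(W)$ is $n$ times continuously differentiable with derivatives bounded in $S(W)$, with norm $\max_{0\le j\le n}\sup_t\|\partial_t^jf(t,\cdot)\|_{S(W)}$; $C^\infty$ requires this for all $n$. Writing $S_\alpha(W)$ in place of $S(W)$ means that in addition $f(\alpha,\cdot)\in S_\alpha(W)$ for all $\alpha$. Change of variables. On each interval $[a_j,a_{j+1}]$, $g\in C^\infty[a_j,a_{j+1}]$ is monotonic with $g(a_j)=a_j$, $g(a_{j+1})=a_{j+1}$, $g'>0$ in $(a_j,a_{j+1})$, and there are $\delta>0$, constants $C_j>0$ and $h\in C^\infty[0,\delta)$ such that $g(t)-a_j=C_jh^2(t-a_j)$ for $t\in[a_j,a_j+\delta)$ and $a_{j+1}-g(t)=C_jh^2(a_{j+1}-t)$ for $t\in(a_{j+1}-\delta,a_{j+1}]$. For $\alpha<A_1$, $\sqrt{\alpha-A_1}=\mathrm{i}\sqrt{A_1-\alpha}$.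 Inverse Bloch transform (on the cell $\Omega_H^\Lambda$, with the normalization constant dropped): $(\mathcal{J}_\Omega^{-1}w)(x)=\int_{W_{\Lambda^*}}w(\alpha,x)\,d\alpha=\int_{W_{\Lambda^*}}v(t,x)\,dt$. *)

theory Defs
  imports "HOL-Analysis.Analysis" "HOL-Library.Landau_Symbols"
begin

type_synonym plane = "real \<times> real"
type_synonym field = "plane \<Rightarrow> complex"

section \<open>Smooth functions on the plane and Sobolev spaces\<close>

text \<open>
  Elements of Lebesgue and Sobolev spaces are represented by functions; functions that agree
  almost everywhere are identified only through the (semi-)norms.
\<close>

primrec partials :: "plane list \<Rightarrow> field \<Rightarrow> field" where
  "partials [] \<phi> = \<phi>"
| "partials (b # bs) \<phi> = (\<lambda>x. frechet_derivative (partials bs \<phi>) (at x) b)"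

definition smooth :: "field \<Rightarrow> bool" where
  "smooth \<phi> \<longleftrightarrow> (\<forall>bs \<in> lists Basis. \<forall>x. partials bs \<phi> differentiable (at x))"

definition multi_partial :: "nat \<times> nat \<Rightarrow> field \<Rightarrow> field" where
  "multi_partial \<beta> = partials (replicate (fst \<beta>) (1, 0) @ replicate (snd \<beta>) (0, 1))"

definition test_function :: "plane set \<Rightarrow> field \<Rightarrow> bool" where
  "test_function \<Omega> \<phi> \<longleftrightarrow>
     smooth \<phi> \<and> (\<exists>K. compact K \<and> K \<subseteq> interior \<Omega> \<and> (\<forall>x. x \<notin> K \<longrightarrow> \<phi> x = 0))"

definition L2 :: "'a measure \<Rightarrow> ('a \<Rightarrow> complex) set" where
  "L2 M = {u. u \<in> borel_measurable M \<and> integrable M (\<lambda>x. (cmod (u x))\<^sup>2)}"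

definition has_weak_partial :: "plane set \<Rightarrow> nat \<times> nat \<Rightarrow> field \<Rightarrow> field \<Rightarrow> bool" where
  "has_weak_partial \<Omega> \<beta> u d \<longleftrightarrow> d \<in> L2 (lebesgue_on \<Omega>) \<and>
     (\<forall>\<phi>. test_function \<Omega> \<phi> \<longrightarrow>
        (LINT x|lebesgue_on \<Omega>. u x * multi_partial \<beta> \<phi> x) =
        (- 1) ^ (fst \<beta> + snd \<beta>) * (LINT x|lebesgue_on \<Omega>. d x * \<phi> x))"

definition weak_partial :: "plane set \<Rightarrow> nat \<times> nat \<Rightarrow> field \<Rightarrow> field" where
  "weak_partial \<Omega> \<beta> u = (SOME d. has_weak_partial \<Omega> \<beta> u d)"

definition sobolev :: "nat \<Rightarrow> plane set \<Rightarrow> field set" where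
  "sobolev n \<Omega> = {u \<in> L2 (lebesgue_on \<Omega>).
     \<forall>\<beta> \<in> {(p, q). p + q \<le> n}. \<exists>d. has_weak_partial \<Omega> \<beta> u d}"

definition sobolev_norm :: "nat \<Rightarrow> plane set \<Rightarrow> field \<Rightarrow> real" where
  "sobolev_norm n \<Omega> u =
     sqrt (\<Sum>\<beta> \<in> {(p, q). p + q \<le> n}. LINT x|lebesgue_on \<Omega>. (cmod (weak_partial \<Omega> \<beta> u x))\<^sup>2)"

section \<open>The periodicity cell, traces and quasi-periodic functions\<close>

definition layer :: "(real \<Rightarrow> real) \<Rightarrow> real \<Rightarrow> real set \<Rightarrow> plane set" where
  "layer \<zeta> H I = {(x1, x2). x1 \<in> I \<and> \<zeta> x1 < x2 \<and> x2 < H}"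

definition cell :: "real \<Rightarrow> (real \<Rightarrow> real) \<Rightarrow> real \<Rightarrow> plane set" where
  "cell \<Lambda> \<zeta> H = layer \<zeta> H {- \<Lambda> / 2 <.. \<Lambda> / 2}"

text \<open>
  The trace on the bottom boundary is the continuous extension to \<open>H\<^sup>1\<close> of the restriction map
  on functions that are smooth up to the boundary. The boundary is parametrised by \<open>x\<^sub>1\<close>; since
  \<open>\<zeta>\<close> is Lipschitz, convergence in \<open>L\<^sup>2\<close> with respect to \<open>dx\<^sub>1\<close> and with respect to arc length
  agree.
\<close>

definition has_bottom_trace ::
  "(real \<Rightarrow> real) \<Rightarrow> real \<Rightarrow> real set \<Rightarrow> field \<Rightarrow> (real \<Rightarrow> complex) \<Rightarrow> bool" where
  "has_bottom_trace \<zeta> H I u \<tau> \<longleftrightarrow> u \<in> sobolev 1 (layer \<zeta> H I) \<and> \<tau> \<in> L2 (lebesgue_on I) \<and>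
     (\<exists>\<psi> :: nat \<Rightarrow> field.
        (\<forall>j. smooth (\<psi> j) \<and> \<psi> j \<in> sobolev 1 (layer \<zeta> H I)) \<and>
        (\<lambda>j. sobolev_norm 1 (layer \<zeta> H I) (\<lambda>x. \<psi> j x - u x)) \<longlonglongrightarrow> 0 \<and>
        (\<lambda>j. LINT s|lebesgue_on I. (cmod (\<psi> j (s, \<zeta> s) - \<tau> s))\<^sup>2) \<longlonglongrightarrow> 0)"

text \<open>
  The flag \<open>zt\<close> selects the subspace of functions with zero trace on the bottom boundary. It has
  no effect for \<open>n = 0\<close>.
\<close>

definition layer_space ::
  "(real \<Rightarrow> real) \<Rightarrow> real \<Rightarrow> nat \<Rightarrow> bool \<Rightarrow> real set \<Rightarrow> field set" where
  "layer_space \<zeta> H n zt I = {u \<in> sobolev n (layer \<zeta> H I).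
     zt \<and> n \<ge> 1 \<longrightarrow> has_bottom_trace \<zeta> H I u (\<lambda>_. 0)}"

definition S_space :: "real \<Rightarrow> (real \<Rightarrow> real) \<Rightarrow> real \<Rightarrow> nat \<Rightarrow> bool \<Rightarrow> field set" where
  "S_space \<Lambda> \<zeta> H n zt = layer_space \<zeta> H n zt {- \<Lambda> / 2 <.. \<Lambda> / 2}"

definition S_norm :: "real \<Rightarrow> (real \<Rightarrow> real) \<Rightarrow> real \<Rightarrow> nat \<Rightarrow> field \<Rightarrow> real" where
  "S_norm \<Lambda> \<zeta> H n = sobolev_norm n (cell \<Lambda> \<zeta> H)"

text \<open>The integer \<open>j\<close> below is the one with \<open>x\<^sub>1 - j\<Lambda> \<in> (- \<Lambda>/2, \<Lambda>/2]\<close>.\<close>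

definition quasi_periodic_extension :: "real \<Rightarrow> real \<Rightarrow> field \<Rightarrow> field" where
  "quasi_periodic_extension \<Lambda> \<alpha> u = (\<lambda>(x1, x2).
     let j = \<lceil>x1 / \<Lambda> - 1 / 2\<rceil> in cis (\<alpha> * \<Lambda> * of_int j) * u (x1 - of_int j * \<Lambda>, x2))"

definition S_qp :: "real \<Rightarrow> (real \<Rightarrow> real) \<Rightarrow> real \<Rightarrow> nat \<Rightarrow> bool \<Rightarrow> real \<Rightarrow> field set" where
  "S_qp \<Lambda> \<zeta> H n zt \<alpha> = {u \<in> S_space \<Lambda> \<zeta> H n zt.
     \<forall>R > 0. quasi_periodic_extension \<Lambda> \<alpha> u \<in> layer_space \<zeta> H n zt {- R <..< R}}"

section \<open>Differentiable functions of a parameter with values in a seminormed function space\<close>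

text \<open>
  \<open>V\<close> is the space and \<open>N\<close> its seminorm; at the end points of an interval \<open>I\<close> all limits are
  one-sided. In \<open>derivative_chain V N I n f F\<close> the functions \<open>F 0, \<dots>, F n\<close> are the derivatives
  of \<open>f\<close> of order \<open>0, \<dots>, n\<close>. They are unique up to functions of seminorm zero.
\<close>

definition derivative_chain :: "field set \<Rightarrow> (field \<Rightarrow> real) \<Rightarrow> real set \<Rightarrow> nat \<Rightarrow>
    (real \<Rightarrow> field) \<Rightarrow> (nat \<Rightarrow> real \<Rightarrow> field) \<Rightarrow> bool" where
  "derivative_chain V N I n f F \<longleftrightarrow>
     (\<forall>t \<in> I. F 0 t = f t) \<and>
     (\<forall>j \<le> n. \<forall>t \<in> I. F j t \<in> V \<and>
        ((\<lambda>s. N (\<lambda>x. F j s x - F j t x)) \<longlongrightarrow> 0) (at t within I)) \<and>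
     (\<forall>j \<le> n. bdd_above ((\<lambda>t. N (F j t)) ` I)) \<and>
     (\<forall>j < n. \<forall>t \<in> I.
        ((\<lambda>s. N (\<lambda>x. (F j s x - F j t x) / of_real (s - t) - F (Suc j) t x)) \<longlongrightarrow> 0) (at t within I))"

definition Cn :: "field set \<Rightarrow> (field \<Rightarrow> real) \<Rightarrow> real set \<Rightarrow> nat \<Rightarrow> (real \<Rightarrow> field) set" where
  "Cn V N I n = {f. \<exists>F. derivative_chain V N I n f F}"

definition Cinf :: "field set \<Rightarrow> (field \<Rightarrow> real) \<Rightarrow> real set \<Rightarrow> (real \<Rightarrow> field) set" where
  "Cinf V N I = (\<Inter>n. Cn V N I n)"

definition Cn_norm ::
  "field set \<Rightarrow> (field \<Rightarrow> real) \<Rightarrow> real set \<Rightarrow> nat \<Rightarrow> (real \<Rightarrow> field) \<Rightarrow> real" where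
  "Cn_norm V N I n f =
     (let F = (SOME F. derivative_chain V N I n f F) in MAX j\<in>{..n}. SUP t\<in>I. N (F j t))"

definition real_smooth_on :: "real set \<Rightarrow> (real \<Rightarrow> real) \<Rightarrow> bool" where
  "real_smooth_on I f \<longleftrightarrow> (\<exists>D :: nat \<Rightarrow> real \<Rightarrow> real. (\<forall>t \<in> I. D 0 t = f t) \<and>
     (\<forall>j. \<forall>t \<in> I. (D j has_real_derivative D (Suc j) t) (at t within I)))"

section \<open>Singular points and the change of variables\<close>

definition dual_period :: "real \<Rightarrow> real" where
  "dual_period \<Lambda> = 2 * pi / \<Lambda>"

text \<open>The infimum is a minimum, because \<open>\<Lambda>\<^sup>*\<int> - k\<close> is a closed discrete set.\<close>

definition k_under :: "real \<Rightarrow> real \<Rightarrow> real" where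
  "k_under \<Lambda> k = (INF n::int. \<bar>dual_period \<Lambda> * of_int n - k\<bar>)"

definition bloch_cell :: "real \<Rightarrow> real \<Rightarrow> real set" where
  "bloch_cell \<Lambda> k = {- k_under \<Lambda> k <.. dual_period \<Lambda> - k_under \<Lambda> k}"

definition pieces :: "real \<Rightarrow> real \<Rightarrow> nat" where
  "pieces \<Lambda> k = (if k_under \<Lambda> k \<in> {0, dual_period \<Lambda> / 2} then 1 else 2)"

definition sing_pt :: "real \<Rightarrow> real \<Rightarrow> nat \<Rightarrow> real" where
  "sing_pt \<Lambda> k j =
     (if j = 0 then - k_under \<Lambda> k
      else if j < pieces \<Lambda> k then k_under \<Lambda> k
      else dual_period \<Lambda> - k_under \<Lambda> k)"

definition piece :: "real \<Rightarrow> real \<Rightarrow> nat \<Rightarrow> real set" where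
  "piece \<Lambda> k i = {sing_pt \<Lambda> k i .. sing_pt \<Lambda> k (Suc i)}"

text \<open>
  Since \<open>g\<close> is only relevant on the closed intervals between singular points, the two
  representations in terms of \<open>h\<close> are imposed within these intervals.
\<close>

definition change_of_variables ::
  "real \<Rightarrow> real \<Rightarrow> (real \<Rightarrow> real) \<Rightarrow> (real \<Rightarrow> real) \<Rightarrow> bool" where
  "change_of_variables \<Lambda> k g h \<longleftrightarrow>
     (\<forall>i < pieces \<Lambda> k.
        real_smooth_on (piece \<Lambda> k i) g \<and> mono_on (piece \<Lambda> k i) g \<and>
        g (sing_pt \<Lambda> k i) = sing_pt \<Lambda> k i \<and>
        g (sing_pt \<Lambda> k (Suc i)) = sing_pt \<Lambda> k (Suc i) \<and>
        (\<forall>t \<in> {sing_pt \<Lambda> k i <..< sing_pt \<Lambda> k (Suc i)}. deriv g t > 0)) \<and>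
     (\<exists>\<delta> > 0. real_smooth_on {0 ..< \<delta>} h \<and>
        (\<forall>i < pieces \<Lambda> k. \<exists>C > 0.
           (\<forall>t \<in> {sing_pt \<Lambda> k i ..< sing_pt \<Lambda> k i + \<delta>} \<inter> piece \<Lambda> k i.
              g t - sing_pt \<Lambda> k i = C * (h (t - sing_pt \<Lambda> k i))\<^sup>2) \<and>
           (\<forall>t \<in> {sing_pt \<Lambda> k (Suc i) - \<delta> <.. sing_pt \<Lambda> k (Suc i)} \<inter> piece \<Lambda> k i.
              sing_pt \<Lambda> k (Suc i) - g t = C * (h (sing_pt \<Lambda> k (Suc i) - t))\<^sup>2)))"

text \<open>
  Admissible \<open>w\<close>. The principal branch gives \<open>csqrt (- r) = \<i> * sqrt r\<close> for \<open>r \<ge> 0\<close>, the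
  convention required for \<open>\<alpha> < A\<^sub>1\<close>. Equality of the two sides is equality in the function space,
  that is, almost everywhere in the cell.
\<close>

definition singular_families ::
  "real \<Rightarrow> real \<Rightarrow> (real \<Rightarrow> real) \<Rightarrow> real \<Rightarrow> nat \<Rightarrow> bool \<Rightarrow> (real \<Rightarrow> field) set" where
  "singular_families \<Lambda> k \<zeta> H n zt = {w. \<forall>i < pieces \<Lambda> k.
     w \<in> Cn (S_space \<Lambda> \<zeta> H n zt) (S_norm \<Lambda> \<zeta> H n) (piece \<Lambda> k i) 0 \<and>
     (\<forall>\<alpha> \<in> piece \<Lambda> k i. w \<alpha> \<in> S_qp \<Lambda> \<zeta> H n zt \<alpha>) \<and>
     (\<exists>w0 w1 w2. {w0, w1, w2} \<subseteq> Cinf (S_space \<Lambda> \<zeta> H n zt) (S_norm \<Lambda> \<zeta> H n) (piece \<Lambda> k i) \<and>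
        (\<forall>\<alpha> \<in> piece \<Lambda> k i. AE x in lebesgue_on (cell \<Lambda> \<zeta> H).
           w \<alpha> x = w2 \<alpha> x + csqrt (of_real (\<alpha> - sing_pt \<Lambda> k i)) * w0 \<alpha> x
                          + csqrt (of_real (\<alpha> - sing_pt \<Lambda> k (Suc i))) * w1 \<alpha> x))}"

text \<open>The function \<open>v(t) = w(g(t)) g'(t)\<close> on an interval, with one-sided \<open>g'\<close> at its end points.\<close>

definition transformed ::
  "(real \<Rightarrow> real) \<Rightarrow> real set \<Rightarrow> (real \<Rightarrow> field) \<Rightarrow> real \<Rightarrow> field" where
  "transformed g I w t = (\<lambda>x. w (g t) x * of_real (vector_derivative g (at t within I)))"

section \<open>The inverse Bloch transform and its quadrature\<close>

text \<open>
  The values \<open>w(\<alpha>, x)\<close> are determined by \<open>w(\<alpha>, \<cdot>) \<in> S(W)\<close> only for almost every \<open>x\<close>, separately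
  for each \<open>\<alpha>\<close>. The integral in \<open>\<alpha>\<close> at fixed \<open>x\<close> is therefore taken for a version of \<open>w\<close> that is
  jointly measurable in \<open>(\<alpha>, x)\<close>; by Fubini's theorem the result does not depend on the version,
  up to null sets in \<open>x\<close>.
\<close>

definition joint_version :: "real set \<Rightarrow> plane set \<Rightarrow> (real \<Rightarrow> field) \<Rightarrow> (real \<Rightarrow> field) \<Rightarrow> bool" where
  "joint_version A \<Omega> w w' \<longleftrightarrow> (\<lambda>(\<alpha>, x). w' \<alpha> x) \<in> borel_measurable borel \<and>
     (\<forall>\<alpha> \<in> A. AE x in lebesgue_on \<Omega>. w' \<alpha> x = w \<alpha> x)"

definition inverse_bloch ::
  "real \<Rightarrow> real \<Rightarrow> (real \<Rightarrow> real) \<Rightarrow> real \<Rightarrow> (real \<Rightarrow> field) \<Rightarrow> field" where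
  "inverse_bloch \<Lambda> k \<zeta> H w =
     (let w' = (SOME w'. joint_version (bloch_cell \<Lambda> k) (cell \<Lambda> \<zeta> H) w w')
      in (\<lambda>x. LINT \<alpha>:bloch_cell \<Lambda> k|lborel. w' \<alpha> x))"

definition node :: "real \<Rightarrow> real \<Rightarrow> nat \<Rightarrow> nat \<Rightarrow> nat \<Rightarrow> real" where
  "node \<Lambda> k N i j =
     sing_pt \<Lambda> k i + real j * (sing_pt \<Lambda> k (Suc i) - sing_pt \<Lambda> k i) / real N"

definition inverse_bloch_num ::
  "real \<Rightarrow> real \<Rightarrow> (real \<Rightarrow> real) \<Rightarrow> nat \<Rightarrow> (real \<Rightarrow> field) \<Rightarrow> field" where
  "inverse_bloch_num \<Lambda> k g N w = (\<lambda>x. \<Sum>i < pieces \<Lambda> k.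
     of_real ((sing_pt \<Lambda> k (Suc i) - sing_pt \<Lambda> k i) / real N) *
     (\<Sum>j = 1..N. transformed g (piece \<Lambda> k i) w (node \<Lambda> k N i j) x))"

end

theory Submission
  imports Defs
begin

text \<open>
  Why the quadrature converges fast.  On an interval \<open>[a, b]\<close> between singular points the
  transformed integrand \<open>v(t) = w(g(t)) g'(t)\<close> is smooth up to the ends: near \<open>a\<close> the function
  \<open>sqrt (g t - a)\<close> is a multiple of \<open>\<bar>h(t - a)\<bar>\<close>, and \<open>h\<close> has constant sign because \<open>g\<close> is strictly
  increasing (lemma \<open>root_h_smooth\<close>); the other end is treated in the same way.  Moreover
  \<open>g - a\<close> is a multiple of \<open>h\<^sup>2\<close>, hence \<open>O((t - a) ^ (2 * m + 2))\<close>, so \<open>g'\<close> and with it \<open>v\<close> vanish to order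
  \<open>2 * m + 1\<close> at both ends (lemma \<open>g'_vanishing_order\<close>).  A function of class \<open>C\<^sup>p\<close> whose derivatives
  below order \<open>p\<close> vanish at both ends is a periodic function for the trapezoidal rule, and the error
  is then \<open>O(N\<^sup>-\<^sup>p)\<close> times the supremum of the \<open>p\<close>-th derivative
  (lemma \<open>trapezoid_error\<close>).  With \<open>p = 2 * m + 1\<close> this is better than the required rate by a factor
  \<open>N powr (-1/2)\<close>.  The second assertion of the theorem is an instance of the first.

  Transfer to functions with values in the Sobolev space.  Values are functions on the cell and the
  exact transform is an integral at fixed \<open>x\<close>, so all estimates are made for scalar functions and
  then transferred by duality.  The Sobolev seminorm comes from a semi-inner product
  \<open>sob_ip\<close>; this uses that weak derivatives are unique up to null sets
  (lemmas \<open>fundamental_lemma\<close> and \<open>weak_partial_unique\<close>).  By Fubini's theorem the pointwise integral \<open>U\<close> of a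
  continuous family \<open>w\<close> lies in the Sobolev space, and the inner product of \<open>U\<close> with \<open>e\<close> is the integral of
  the inner products of \<open>w(\<alpha>)\<close> with \<open>e\<close> (lemma \<open>sobolev_integral\<close>).  If \<open>E\<close> is the quadrature error, then the
  square of its norm is the scalar quadrature error for the function \<open>t \<mapsto> \<langle>v(t), E\<rangle>\<close>, whose
  derivatives are bounded by those of \<open>v\<close> times the norm of \<open>E\<close>; one factor cancels
  (lemmas \<open>piece_quadrature\<close> and \<open>error_by_pieces\<close>).  Finally \<open>U\<close> is the limit of the quadrature sums, and functions
  with zero trace form a closed subspace (lemma \<open>S_space_limit\<close>), so \<open>U\<close> has zero trace if all \<open>w(\<alpha>)\<close> have.
\<close>

section \<open>The trapezoidal rule for periodic data\<close>

lemma chain_subset: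
  assumes "(f has_vector_derivative f') (at t within {a..b})" "{c..d} \<subseteq> {a..b}"
  shows "(f has_vector_derivative f') (at t within {c..d::real})"
  using assms has_vector_derivative_within_subset by blast

text \<open>
  Taylor's formula for the antiderivative of \<open>D 0\<close>, expanded at the left end of a cell of width \<open>d\<close>.
\<close>

lemma taylor_cell:
  fixes D :: "nat \<Rightarrow> real \<Rightarrow> 'a::banach"
  assumes D: "\<And>m t. m < p \<Longrightarrow> t \<in> {c..c+d} \<Longrightarrow> (D m has_vector_derivative D (Suc m) t) (at t within {c..c+d})"
    and p: "p > 0" and d: "d \<ge> 0"
    and M: "\<And>t. t \<in> {c..c+d} \<Longrightarrow> norm (D p t) \<le> M"
  shows "norm (integral {c..c+d} (D 0) - (\<Sum>l<p. (d ^ Suc l / fact (Suc l)) *\<^sub>R D l c)) \<le> M * d ^ Suc p"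
proof -
  define F where "F j = (case j of 0 \<Rightarrow> (\<lambda>t. integral {c..t} (D 0)) | Suc l \<Rightarrow> D l)" for j
  have cont: "continuous_on {c..c+d} (D 0)"
    using D[of 0] p by (meson continuous_on_eq_continuous_within has_vector_derivative_continuous)
  have F: "(F m has_vector_derivative F (Suc m) t) (at t within {c..c+d})"
    if "m < Suc p" "c \<le> t" "t \<le> c+d" for m t
  proof (cases m)
    case 0
    have "((\<lambda>u. integral {c..u} (D 0)) has_vector_derivative D 0 t) (at t within {c..c+d})"
      by (rule integral_has_vector_derivative[OF cont]) (use that in auto)
    then show ?thesis using 0 by (simp add: F_def)
  next
    case (Suc l)
    then show ?thesis using D[of l t] that by (simp add: F_def)
  qed
  note ti = Taylor_has_integral[of "Suc p" F "F 0" c "c+d", OF _ refl F]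
  have ti: "((\<lambda>x. ((c+d - x) ^ p / fact p) *\<^sub>R D p x) has_integral
      F 0 (c+d) - (\<Sum>i<Suc p. ((c + d - c) ^ i / fact i) *\<^sub>R F i c)) {c..c+d}"
    using ti d by (simp add: F_def)
  have sum: "(\<Sum>i<Suc p. ((c + d - c) ^ i / fact i) *\<^sub>R F i c) = (\<Sum>l<p. (d ^ Suc l / fact (Suc l)) *\<^sub>R D l c)"
    by (subst sum.lessThan_Suc_shift) (simp add: F_def)
  have M0: "M \<ge> 0" using M[of c] d order_trans[OF norm_ge_zero[of "D p c"]] by auto
  have "norm (F 0 (c+d) - (\<Sum>i<Suc p. ((c + d - c) ^ i / fact i) *\<^sub>R F i c)) \<le> d ^ p * M * measure lborel (cbox c (c+d))"
  proof (rule has_integral_bound[OF _ ti[folded cbox_interval]])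
    show "0 \<le> d ^ p * M" using d M0 by simp
    fix x assume x: "x \<in> cbox c (c+d)"
    have "(c + d - x) ^ p / fact p \<le> (c + d - x) ^ p"
      using x by (simp add: divide_le_eq mult_left_le fact_ge_1 mult_le_cancel_left1)
    also have "\<dots> \<le> d ^ p" using x by (intro power_mono) auto
    finally have "(c + d - x) ^ p / fact p \<le> d ^ p" .
    then show "norm (((c+d - x) ^ p / fact p) *\<^sub>R D p x) \<le> d ^ p * M"
      using x M[of x] d mult_mono[of "(c + d - x) ^ p / fact p" "d ^ p" "norm (D p x)" M] by auto
  qed
  then show ?thesis unfolding sum using d by (simp add: F_def algebra_simps)
qed

text \<open>
  The bound is stated for left endpoint sums; for data with equal values at the two ends these are
  the trapezoidal sums. The constant has to be uniform in the interval, the number of nodes and the function.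
\<close>

definition trapezoid_bound :: "nat \<Rightarrow> real \<Rightarrow> bool" where
  "trapezoid_bound p C \<longleftrightarrow> C \<ge> 0 \<and> (\<forall>a b N M. \<forall>D :: nat \<Rightarrow> real \<Rightarrow> complex. a \<le> b \<longrightarrow> N > 0 \<longrightarrow>
     (\<forall>m<p. \<forall>t\<in>{a..b}. (D m has_vector_derivative D (Suc m) t) (at t within {a..b})) \<longrightarrow>
     (\<forall>j. Suc j < p \<longrightarrow> D j a = D j b) \<longrightarrow> (\<forall>t\<in>{a..b}. norm (D p t) \<le> M) \<longrightarrow>
     norm (((b - a) / real N) *\<^sub>R (\<Sum>j<N. D 0 (a + real j * ((b - a) / real N))) - integral {a..b} (D 0))
       \<le> C * ((b - a) / real N) ^ p * (b - a) * M)"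

text \<open>
  Induction on the order. Adding Taylor's formula over all cells expresses the error for \<open>D 0\<close> through powers \<open>d ^ l\<close> times the
  trapezoidal sums of the higher derivatives \<open>D l\<close>. By induction such a sum
  is close to the integral of \<open>D l\<close>, and this integral is zero by periodicity of \<open>D (l - 1)\<close>.
\<close>

lemma trapezoid_error:
  assumes "p > 0"
  shows "\<exists>C. trapezoid_bound p C"
  using assms
proof (induction p rule: less_induct)
  case (less p)
  let ?P = "\<lambda>p C. \<forall>a b N M. \<forall>D :: nat \<Rightarrow> real \<Rightarrow> complex. a \<le> b \<longrightarrow> N > 0 \<longrightarrow>
     (\<forall>m<p. \<forall>t\<in>{a..b}. (D m has_vector_derivative D (Suc m) t) (at t within {a..b})) \<longrightarrow>
     (\<forall>j. Suc j < p \<longrightarrow> D j a = D j b) \<longrightarrow> (\<forall>t\<in>{a..b}. norm (D p t) \<le> M) \<longrightarrow>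
     norm (((b - a) / real N) *\<^sub>R (\<Sum>j<N. D 0 (a + real j * ((b - a) / real N))) - integral {a..b} (D 0))
       \<le> C * ((b - a) / real N) ^ p * (b - a) * M"
  have "\<forall>q\<in>{1..<p}. \<exists>C. C \<ge> 0 \<and> ?P q C"
    using less.IH[unfolded trapezoid_bound_def] by auto
  from bchoice[OF this] obtain c where cc: "\<forall>q\<in>{1..<p}. c q \<ge> 0 \<and> ?P q (c q)" ..
  have c0: "c q \<ge> 0" and c: "?P q (c q)" if "q \<in> {1..<p}" for q
    using bspec[OF cc that] by (rule conjunct1, rule conjunct2)
  define C where "C = 1 + (\<Sum>l\<in>{1..<p}. c (p - l))"
  have C0: "C \<ge> 0" unfolding C_def by (intro add_nonneg_nonneg sum_nonneg c0) auto
  have "?P p C"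
  proof (intro allI impI)
    fix a b :: real and N :: nat and M :: real and D :: "nat \<Rightarrow> real \<Rightarrow> complex"
    assume ab: "a \<le> b" and N: "N > 0"
      and D: "\<forall>m<p. \<forall>t\<in>{a..b}. (D m has_vector_derivative D (Suc m) t) (at t within {a..b})"
      and per: "\<forall>j. Suc j < p \<longrightarrow> D j a = D j b"
      and M: "\<forall>t\<in>{a..b}. norm (D p t) \<le> M"
    define d where "d = (b - a) / real N"
    have d0: "d \<ge> 0" using ab by (simp add: d_def)
    have Nd: "real N * d = b - a" using N by (simp add: d_def)
    define t where "t j = a + real j * d" for j :: nat
    define S where "S l = d *\<^sub>R (\<Sum>j<N. D l (t j))" for l
    have tle: "t j \<le> b" if "j \<le> N" for j
    proof -
      have "real j * d \<le> real N * d" using that d0 by (intro mult_right_mono) auto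
      then show ?thesis using Nd by (simp add: t_def)
    qed
    have tge: "a \<le> t j" for j using d0 by (simp add: t_def)
    have tS: "t (Suc j) = t j + d" for j by (simp add: t_def algebra_simps)
    have sub: "{t j..t j + d} \<subseteq> {a..b}" if "j < N" for j
      using tle[of "Suc j"] tge[of j] that by (auto simp: tS)
    have cont: "continuous_on {a..b} (D 0)"
      using D less.prems by (meson continuous_on_eq_continuous_within has_vector_derivative_continuous)
    have split: "integral {a..b} (D 0) = (\<Sum>j<N. integral {t j..t j + d} (D 0))"
    proof -
      have "integral {a..t n} (D 0) = (\<Sum>j<n. integral {t j..t j + d} (D 0))" if "n \<le> N" for n
        using that
      proof (induction n)
        case 0 then show ?case by (simp add: t_def)
      next
        case (Suc n)
        have "integral {a..t n} (D 0) + integral {t n..t (Suc n)} (D 0) = integral {a..t (Suc n)} (D 0)"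
        proof (rule Henstock_Kurzweil_Integration.integral_combine)
          show "a \<le> t n" "t n \<le> t (Suc n)" using tge d0 by (auto simp: tS)
          show "D 0 integrable_on {a..t (Suc n)}"
            using tle[OF Suc.prems] by (intro integrable_continuous_interval continuous_on_subset[OF cont]) auto
        qed
        then show ?case using Suc by (simp add: tS)
      qed
      from this[of N] show ?thesis using Nd by (simp add: t_def)
    qed
    have cell: "norm (integral {t j..t j + d} (D 0) - (\<Sum>l<p. (d ^ Suc l / fact (Suc l)) *\<^sub>R D l (t j))) \<le> M * d ^ Suc p"
      if "j < N" for j
    proof (rule taylor_cell)
      show "(D m has_vector_derivative D (Suc m) s) (at s within {t j..t j + d})"
        if "m < p" "s \<in> {t j..t j + d}" for m s
        using D sub[OF \<open>j < N\<close>] that by (blast intro: chain_subset)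
    qed (use less.prems d0 M sub[OF that] in auto)
    have "norm (integral {a..b} (D 0) - (\<Sum>j<N. (\<Sum>l<p. (d ^ Suc l / fact (Suc l)) *\<^sub>R D l (t j)))) \<le> (\<Sum>j<N. M * d ^ Suc p)"
      unfolding split sum_subtractf[symmetric] by (rule sum_norm_le) (use cell in auto)
    also have "\<dots> = d ^ p * (b - a) * M" unfolding Nd[symmetric] by simp
    also have "(\<Sum>j<N. (\<Sum>l<p. (d ^ Suc l / fact (Suc l)) *\<^sub>R D l (t j))) = (\<Sum>l<p. (d ^ l / fact (Suc l)) *\<^sub>R S l)"
      by (subst sum.swap) (simp add: S_def scaleR_sum_right mult.commute)
    also have "\<dots> = S 0 + (\<Sum>l\<in>{1..<p}. (d ^ l / fact (Suc l)) *\<^sub>R S l)"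
      using less.prems by (simp add: lessThan_atLeast0 sum.atLeast_Suc_lessThan)
    finally have main: "norm (integral {a..b} (D 0) - (S 0 + (\<Sum>l\<in>{1..<p}. (d ^ l / fact (Suc l)) *\<^sub>R S l))) \<le> d ^ p * (b - a) * M" .
    have M0: "M \<ge> 0" using bspec[OF M, of a] ab order_trans[OF norm_ge_zero[of "D p a"]] by auto
    have Sl: "norm ((d ^ l / fact (Suc l)) *\<^sub>R S l) \<le> c (p - l) * (d ^ p * (b - a) * M)" if l: "l \<in> {1..<p}" for l
    proof -
      have ql: "p - l \<in> {1..<p}" using l by auto
      have "norm (S l - integral {a..b} (D l)) \<le> c (p - l) * d ^ (p - l) * (b - a) * M"
        using c[OF ql, rule_format, of a b N "\<lambda>j. D (l + j)" M] ab N D per M l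
        by (simp add: S_def t_def d_def)
      moreover have "integral {a..b} (D l) = 0"
      proof -
        obtain l' where l': "l = Suc l'" using l by (cases l) auto
        have "(D l has_integral D l' b - D l' a) {a..b}"
          by (rule fundamental_theorem_of_calculus) (use ab D l l' in auto)
        then show ?thesis using per l l' by (auto dest: integral_unique)
      qed
      ultimately have "norm (S l) \<le> c (p - l) * d ^ (p - l) * (b - a) * M" by simp
      moreover have "d ^ l / fact (Suc l) \<le> d ^ l"
        using d0 by (simp add: divide_le_eq mult_le_cancel_left1 fact_ge_1 del: fact_Suc)
      ultimately have "d ^ l / fact (Suc l) * norm (S l) \<le> d ^ l * (c (p - l) * d ^ (p - l) * (b - a) * M)"
        using d0 by (intro mult_mono) auto
      also have "\<dots> = c (p - l) * (d ^ (l + (p - l)) * (b - a) * M)" by (simp add: power_add algebra_simps)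
      finally show ?thesis using l d0 by simp
    qed
    have "norm (\<Sum>l\<in>{1..<p}. (d ^ l / fact (Suc l)) *\<^sub>R S l) \<le> (\<Sum>l\<in>{1..<p}. c (p - l) * (d ^ p * (b - a) * M))"
      by (rule sum_norm_le) (use Sl in auto)
    also have "\<dots> = (C - 1) * (d ^ p * (b - a) * M)" by (simp add: C_def sum_distrib_right)
    finally have rest: "norm (\<Sum>l\<in>{1..<p}. (d ^ l / fact (Suc l)) *\<^sub>R S l) \<le> (C - 1) * (d ^ p * (b - a) * M)" .
    have "norm (S 0 - integral {a..b} (D 0)) \<le> norm (integral {a..b} (D 0) - (S 0 + (\<Sum>l\<in>{1..<p}. (d ^ l / fact (Suc l)) *\<^sub>R S l)))
        + norm (\<Sum>l\<in>{1..<p}. (d ^ l / fact (Suc l)) *\<^sub>R S l)"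
      by norm
    also have "\<dots> \<le> C * d ^ p * (b - a) * M" using main rest by (simp add: algebra_simps)
    finally show "norm (((b - a) / real N) *\<^sub>R (\<Sum>j<N. D 0 (a + real j * ((b - a) / real N))) - integral {a..b} (D 0))
       \<le> C * ((b - a) / real N) ^ p * (b - a) * M"
      by (simp add: S_def t_def d_def)
  qed
  then have "trapezoid_bound p C" unfolding trapezoid_bound_def using C0 by (rule conjI[rotated])
  then show ?case by (rule exI)
qed

section \<open>Orders of vanishing\<close>

text \<open>
  A function that is small of order \<open>p\<close> at the left end has zero Taylor coefficients below \<open>p\<close>.
\<close>

lemma vanishing_order:
  fixes D :: "nat \<Rightarrow> real \<Rightarrow> 'a::banach"
  assumes "a < b"
    and D: "\<And>m t. m < p \<Longrightarrow> t \<in> {a..b} \<Longrightarrow> (D m has_vector_derivative D (Suc m) t) (at t within {a..b})"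
    and M: "\<And>t. t \<in> {a..b} \<Longrightarrow> norm (D p t) \<le> M"
    and e: "e > 0" and K: "\<And>t. t \<in> {a<..<a+e} \<inter> {a..b} \<Longrightarrow> norm (D 0 t) \<le> K * (t - a) ^ p"
    and "j < p"
  shows "D j a = 0"
  using \<open>j < p\<close>
proof (induction j rule: less_induct)
  case (less j)
  have j0: "D i a = 0" if "i < j" for i using less that by auto
  \<comment> \<open>The lower coefficients vanish, so Taylor's formula bounds \<open>(t - a) ^ j\<close> times the \<open>j\<close>-th one by
    multiples of \<open>(t - a) ^ p\<close> and \<open>(t - a) ^ Suc j\<close>. Divide and let \<open>t\<close> tend to \<open>a\<close>.\<close>
  have "continuous_on {a..b} (D (Suc j)) \<or> Suc j = p"
    using D[of "Suc j"] less.prems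
    by (metis Suc_lessI continuous_on_eq_continuous_within has_vector_derivative_continuous)
  then have "bounded (D (Suc j) ` {a..b})"
  proof
    assume "continuous_on {a..b} (D (Suc j))"
    then show ?thesis by (intro compact_imp_bounded compact_continuous_image) auto
  next
    assume "Suc j = p"
    then show ?thesis using M by (auto simp: bounded_iff intro!: exI[of _ M])
  qed
  then obtain B where B: "\<And>t. t \<in> {a..b} \<Longrightarrow> norm (D (Suc j) t) \<le> B"
    unfolding bounded_iff by (metis imageI)
  have B0: "B \<ge> 0" using B[of a] \<open>a < b\<close> order_trans[OF norm_ge_zero[of "D (Suc j) a"]] by auto
  have est: "norm (D j a) / fact j \<le> (B + \<bar>K\<bar> * (b - a) ^ (p - Suc j)) * (t - a)" if t: "t \<in> {a<..<a+e} \<inter> {a..b}" for t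
  proof -
    have "((\<lambda>x. ((t - x) ^ (Suc j - 1) / fact (Suc j - 1)) *\<^sub>R D (Suc j) x) has_integral D 0 t - (\<Sum>i<Suc j. ((t-a) ^ i / fact i) *\<^sub>R D i a)) {a..t}"
    proof (rule Taylor_has_integral)
      fix m s assume "m < Suc j" "a \<le> s" "s \<le> t"
      then have "(D m has_vector_derivative D (Suc m) s) (at s within {a..b})"
        using D[of m s] t less.prems by auto
      then show "(D m has_vector_derivative D (Suc m) s) (at s within {a..t})"
        by (rule chain_subset) (use t in auto)
    qed (use t in auto)
    moreover have "(\<Sum>i<Suc j. ((t-a) ^ i / fact i) *\<^sub>R D i a) = ((t-a) ^ j / fact j) *\<^sub>R D j a"
      using j0 by simp
    ultimately have ti: "((\<lambda>x. ((t - x) ^ j / fact j) *\<^sub>R D (Suc j) x) has_integral D 0 t - ((t-a) ^ j / fact j) *\<^sub>R D j a) (cbox a t)"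
      by simp
    have "norm (D 0 t - ((t-a) ^ j / fact j) *\<^sub>R D j a) \<le> ((t - a) ^ j * B) * measure lborel (cbox a t)"
    proof (rule has_integral_bound[OF _ ti])
      fix x assume x: "x \<in> cbox a t"
      have "(t - x) ^ j / fact j \<le> (t - x) ^ j"
        using x by (simp add: divide_le_eq mult_le_cancel_left1 fact_ge_1)
      also have "\<dots> \<le> (t - a) ^ j" using x by (intro power_mono) auto
      finally show "norm (((t - x) ^ j / fact j) *\<^sub>R D (Suc j) x) \<le> (t - a) ^ j * B"
        using x t B[of x] mult_mono[of "(t - x) ^ j / fact j" "(t - a) ^ j" "norm (D (Suc j) x)" B] by auto
    qed (use t B0 in auto)
    then have 1: "norm (D 0 t - ((t-a) ^ j / fact j) *\<^sub>R D j a) \<le> (t - a) ^ j * (B * (t - a))"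
      using t by simp
    have "norm (D 0 t) \<le> \<bar>K\<bar> * (t - a) ^ p"
      using K[OF t] t by (smt (verit) IntD1 greaterThanLessThan_iff mult_right_mono zero_le_power)
    also have "(t - a) ^ p = (t - a) ^ j * ((t - a) ^ (p - Suc j) * (t - a))"
      using less.prems by (simp flip: power_add power_Suc2 add: Suc_diff_Suc)
    also have "\<bar>K\<bar> * \<dots> \<le> \<bar>K\<bar> * ((t - a) ^ j * ((b - a) ^ (p - Suc j) * (t - a)))"
      using t by (intro mult_left_mono mult_right_mono power_mono) auto
    finally have 2: "norm (D 0 t) \<le> (t - a) ^ j * (\<bar>K\<bar> * (b - a) ^ (p - Suc j) * (t - a))"
      by (simp add: algebra_simps)
    have "(t - a) ^ j * (norm (D j a) / fact j) = norm (((t-a) ^ j / fact j) *\<^sub>R D j a)"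
      using t by simp
    also have "\<dots> \<le> (t - a) ^ j * (B * (t - a)) + (t - a) ^ j * (\<bar>K\<bar> * (b - a) ^ (p - Suc j) * (t - a))"
      using 1 2 norm_triangle_sub[of "((t-a) ^ j / fact j) *\<^sub>R D j a" "D 0 t"]
      unfolding norm_minus_commute[of _ "D 0 t"] by linarith
    also have "\<dots> = (t - a) ^ j * ((B + \<bar>K\<bar> * (b - a) ^ (p - Suc j)) * (t - a))"
      by (simp add: algebra_simps)
    finally have "(t - a) ^ j * (norm (D j a) / fact j) \<le> (t - a) ^ j * ((B + \<bar>K\<bar> * (b - a) ^ (p - Suc j)) * (t - a))" .
    moreover have "0 < (t - a) ^ j" using t by simp
    ultimately show ?thesis using mult_le_cancel_left_pos by blast
  qed
  have ev: "eventually (\<lambda>t. t \<in> {a<..<a+e} \<inter> {a..b}) (at_right a)"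
    unfolding eventually_at_right[OF less_add_one] using e \<open>a < b\<close>
    by (intro exI[of _ "min (a+e) b"]) auto
  have "((\<lambda>t. (B + \<bar>K\<bar> * (b - a) ^ (p - Suc j)) * (t - a)) \<longlongrightarrow> (B + \<bar>K\<bar> * (b - a) ^ (p - Suc j)) * (a - a)) (at_right a)"
    by (intro tendsto_intros)
  then have "norm (D j a) / fact j \<le> (B + \<bar>K\<bar> * (b - a) ^ (p - Suc j)) * (a - a)"
    by (rule tendsto_lowerbound) (use est ev in \<open>auto elim: eventually_mono\<close>)
  then show ?case by (simp add: divide_le_eq)
qed

lemma vanishing_order_right:
  fixes D :: "nat \<Rightarrow> real \<Rightarrow> 'a::banach"
  assumes "a < b"
    and D: "\<And>m t. m < p \<Longrightarrow> t \<in> {a..b} \<Longrightarrow> (D m has_vector_derivative D (Suc m) t) (at t within {a..b})"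
    and M: "\<And>t. t \<in> {a..b} \<Longrightarrow> norm (D p t) \<le> M"
    and e: "e > 0" and K: "\<And>t. t \<in> {b-e<..<b} \<inter> {a..b} \<Longrightarrow> norm (D 0 t) \<le> K * (b - t) ^ p"
    and "j < p"
  shows "D j b = 0"
proof -
  have "(\<lambda>j t. (-1) ^ j *\<^sub>R D j (- t)) j (- b) = 0"
  proof (rule vanishing_order[where a = "-b" and b = "-a" and p = p and M = M and e = e and K = K])
    fix m t assume m: "m < p" "t \<in> {-b..-a}"
    have "((D m \<circ> uminus) has_vector_derivative (- 1) *\<^sub>R D (Suc m) (- t)) (at t within {-b..-a})"
      by (rule vector_diff_chain_within)
        (use m D[of m "-t"] in \<open>auto intro!: derivative_eq_intros simp: has_vector_derivative_def\<close>)
    then have "((\<lambda>t. (-1) ^ m *\<^sub>R (D m \<circ> uminus) t) has_vector_derivative (-1) ^ m *\<^sub>R ((- 1) *\<^sub>R D (Suc m) (- t))) (at t within {-b..-a})"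
      by (rule has_vector_derivative_scaleR[OF DERIV_const, simplified])
    then show "((\<lambda>t. (-1) ^ m *\<^sub>R D m (- t)) has_vector_derivative (-1) ^ Suc m *\<^sub>R D (Suc m) (- t)) (at t within {-b..-a})"
      by (simp add: o_def)
  next
    fix t assume "t \<in> {- b<..<- b + e} \<inter> {- b..- a}"
    then show "norm ((- 1) ^ 0 *\<^sub>R D 0 (- t)) \<le> K * (t - - b) ^ p"
      using K[of "-t"] by (auto simp: algebra_simps)
  qed (use assms in auto)
  then show ?thesis by simp
qed

text \<open>
  The order of vanishing drops by one under differentiation: the Taylor
  coefficients of \<open>D 0\<close> up to order \<open>p\<close> are zero, so Taylor's formula for \<open>D 1\<close> has only its remainder.
\<close>

lemma derivative_vanishing_order:
  fixes D :: "nat \<Rightarrow> real \<Rightarrow> real"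
  assumes "a < b"
    and D: "\<And>m t. t \<in> {a..b} \<Longrightarrow> (D m has_real_derivative D (Suc m) t) (at t within {a..b})"
    and e: "e > 0" and K: "\<And>t. t \<in> {a<..<a+e} \<inter> {a..b} \<Longrightarrow> \<bar>D 0 t\<bar> \<le> K * (t - a) ^ Suc p"
  shows "\<exists>K'. \<forall>t\<in>{a..b}. \<bar>D 1 t\<bar> \<le> K' * (t - a) ^ p"
proof -
  have cont: "continuous_on {a..b} (D m)" for m
    using D by (meson DERIV_continuous continuous_on_eq_continuous_within)
  have bd: "\<exists>B. \<forall>t\<in>{a..b}. norm (D m t) \<le> B" for m
    using compact_imp_bounded[OF compact_continuous_image[OF cont[of m]]] by (auto simp: bounded_iff)
  obtain M where M: "\<forall>t\<in>{a..b}. norm (D (Suc p) t) \<le> M" using bd by blast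
  have Dv: "(D m has_vector_derivative D (Suc m) t) (at t within {a..b})" if "t \<in> {a..b}" for m t
    using D[OF that] by (simp add: has_real_derivative_iff_has_vector_derivative)
  have z: "D j a = 0" if "j < Suc p" for j
    by (rule vanishing_order[of a b "Suc p" D M e K j]) (use assms M Dv that in auto)
  have M0: "M \<ge> 0" using bspec[OF M, of a] \<open>a < b\<close> by auto
  have "\<bar>D 1 t\<bar> \<le> M * (t - a) ^ p" if t: "t \<in> {a..b}" for t
  proof (cases p)
    case 0 then show ?thesis using M t by auto
  next
    case (Suc q)
    have "((\<lambda>x. ((t - x) ^ (p - 1) / fact (p - 1)) *\<^sub>R D (Suc p) x) has_integral D 1 t - (\<Sum>i<p. ((t-a) ^ i / fact i) *\<^sub>R D (Suc i) a)) {a..t}"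
    proof (rule Taylor_has_integral[where Df = "\<lambda>i. D (Suc i)"])
      fix m s assume "m < p" "a \<le> s" "s \<le> t"
      then have "(D (Suc m) has_vector_derivative D (Suc (Suc m)) s) (at s within {a..b})"
        using Dv t by auto
      then show "(D (Suc m) has_vector_derivative D (Suc (Suc m)) s) (at s within {a..t})"
        by (rule chain_subset) (use t in auto)
    qed (use t Suc in auto)
    moreover have "(\<Sum>i<p. ((t-a) ^ i / fact i) *\<^sub>R D (Suc i) a) = 0"
      using z by simp
    ultimately have ti: "((\<lambda>x. ((t - x) ^ q / fact q) *\<^sub>R D (Suc p) x) has_integral D 1 t) (cbox a t)"
      using Suc by simp
    have "norm (D 1 t) \<le> ((t - a) ^ q * M) * measure lborel (cbox a t)"
    proof (rule has_integral_bound[OF _ ti])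
      fix x assume x: "x \<in> cbox a t"
      have "(t - x) ^ q / fact q \<le> (t - x) ^ q"
        using x by (simp add: divide_le_eq mult_le_cancel_left1 fact_ge_1)
      also have "\<dots> \<le> (t - a) ^ q" using x by (intro power_mono) auto
      finally show "norm (((t - x) ^ q / fact q) *\<^sub>R D (Suc p) x) \<le> (t - a) ^ q * M"
        using x t bspec[OF M, of x] mult_mono[of "(t - x) ^ q / fact q" "(t - a) ^ q" "\<bar>D (Suc p) x\<bar>" M] by (auto simp: abs_mult)
    qed (use t M0 in auto)
    then show ?thesis using t Suc by (simp add: algebra_simps)
  qed
  then show ?thesis by blast
qed

lemma derivative_vanishing_order_right:
  fixes D :: "nat \<Rightarrow> real \<Rightarrow> real"
  assumes "a < b"
    and D: "\<And>m t. t \<in> {a..b} \<Longrightarrow> (D m has_real_derivative D (Suc m) t) (at t within {a..b})"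
    and e: "e > 0" and K: "\<And>t. t \<in> {b-e<..<b} \<inter> {a..b} \<Longrightarrow> \<bar>D 0 t\<bar> \<le> K * (b - t) ^ Suc p"
  shows "\<exists>K'. \<forall>t\<in>{a..b}. \<bar>D 1 t\<bar> \<le> K' * (b - t) ^ p"
proof -
  define E where "E m t = (-1) ^ m * D m (- t)" for m t
  have "\<exists>K'. \<forall>t\<in>{-b..-a}. \<bar>E 1 t\<bar> \<le> K' * (t - - b) ^ p"
  proof (rule derivative_vanishing_order[where e = e and K = K])
    fix m t assume t: "t \<in> {-b..-a}"
    have im: "uminus ` {-b..-a} = {a..b}" by (simp add: image_uminus_atLeastAtMost)
    have "(D m has_real_derivative D (Suc m) (- t)) (at (- t) within uminus ` {-b..-a})"
      unfolding im using D t by auto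
    moreover have "(uminus has_real_derivative - 1) (at t within {-b..-a})" by (auto intro!: derivative_eq_intros)
    ultimately have "((D m \<circ> uminus) has_real_derivative D (Suc m) (- t) * - 1) (at t within {-b..-a})"
      by (rule DERIV_image_chain)
    from DERIV_cmult[OF this, of "(-1) ^ m"]
    show "(E m has_real_derivative E (Suc m) t) (at t within {-b..-a})" by (simp add: E_def[abs_def] o_def)
  next
    fix t assume "t \<in> {- b<..<- b + e} \<inter> {- b..- a}"
    then show "\<bar>E 0 t\<bar> \<le> K * (t - - b) ^ Suc p"
      using K[of "-t"] by (auto simp: E_def algebra_simps)
  qed (use assms in auto)
  then obtain K' where K': "\<forall>t\<in>{-b..-a}. \<bar>E 1 t\<bar> \<le> K' * (t - - b) ^ p" ..
  have "\<bar>D 1 t\<bar> \<le> K' * (b - t) ^ p" if "t \<in> {a..b}" for t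
    using bspec[OF K', of "- t"] that by (simp add: E_def algebra_simps)
  then show ?thesis by blast
qed

section \<open>Test functions and the fundamental lemma of the calculus of variations\<close>

text \<open>
  Smoothness by coinduction: it suffices to exhibit a set of differentiable functions that is
  closed under partial derivatives.
\<close>

lemma smooth_closure:
  assumes "\<phi> \<in> F" "\<And>u x. u \<in> F \<Longrightarrow> u differentiable (at x)"
    and "\<And>u b. u \<in> F \<Longrightarrow> b \<in> Basis \<Longrightarrow> (\<lambda>x. frechet_derivative u (at x) b) \<in> F"
  shows "smooth \<phi>"
proof -
  have "partials bs \<phi> \<in> F" if "bs \<in> lists Basis" for bs
    using that by (induction bs) (use assms in auto)
  then show ?thesis using assms(2) by (auto simp: smooth_def)
qed

text \<open>
  The classical function \<open>exp (- 1 / t)\<close> that is flat at \<open>0\<close>, with a polynomial factor in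
  \<open>1 / t\<close> that makes the family closed under differentiation.
\<close>

definition flat :: "real poly \<Rightarrow> real \<Rightarrow> real" where
  "flat p t = (if t > 0 then poly p (1 / t) * exp (- 1 / t) else 0)"

lemma poly_over_exp_tendsto_0: "((\<lambda>u::real. u ^ k * poly q u / exp u) \<longlongrightarrow> 0) at_top"
proof (induction q arbitrary: k)
  case 0 then show ?case by simp
next
  case (pCons a q)
  have "((\<lambda>u. a * (u ^ k / exp u) + u ^ Suc k * poly q u / exp u) \<longlongrightarrow> a * 0 + 0) at_top"
    by (intro tendsto_intros tendsto_power_div_exp_0 pCons.IH)
  then show ?case by (simp add: algebra_simps add_divide_distrib)
qed

lemma flat_tendsto_0: "(flat q \<longlongrightarrow> 0) (at_right 0)"
proof -
  have "((\<lambda>t. poly q (inverse t) / exp (inverse t)) \<longlongrightarrow> 0) (at_right (0::real))"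
    by (rule filterlim_compose[OF _ filterlim_inverse_at_top_right])
      (use poly_over_exp_tendsto_0[of 0 q] in simp)
  then show ?thesis
    by (rule Lim_transform_eventually)
      (auto simp: eventually_at_right_field flat_def exp_minus field_simps intro!: exI[of _ 1])
qed

lemma flat_derivative: "(flat p has_real_derivative flat ([:0, 0, 1:] * (p - pderiv p)) t) (at t)"
proof -
  let ?q = "[:0, 0, 1:] * (p - pderiv p)"
  consider "t > 0" | "t < 0" | "t = 0" by linarith
  then show ?thesis
  proof cases
    case 1
    have "((\<lambda>t. poly p (1 / t) * exp (- 1 / t)) has_real_derivative flat ?q t) (at t)"
      using 1 by (auto intro!: derivative_eq_intros poly_DERIV[THEN DERIV_chain2] simp: flat_def field_simps power2_eq_square)
    moreover have "\<forall>\<^sub>F s in nhds t. flat p s = poly p (1 / s) * exp (- 1 / s)"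
      by (rule eventually_mono[OF eventually_nhds_in_open[of "{0<..}" t]]) (use 1 in \<open>auto simp: flat_def\<close>)
    ultimately show ?thesis by (subst DERIV_cong_ev[OF refl _ refl])
  next
    case 2
    have "((\<lambda>t. 0) has_real_derivative flat ?q t) (at t)"
      using 2 by (simp add: flat_def)
    moreover have "\<forall>\<^sub>F s in nhds t. flat p s = 0"
      by (rule eventually_mono[OF eventually_nhds_in_open[of "{..<0}" t]]) (use 2 in \<open>auto simp: flat_def\<close>)
    ultimately show ?thesis by (subst DERIV_cong_ev[OF refl _ refl])
  next
    case 3
    have "((\<lambda>h. flat p h / h) \<longlongrightarrow> 0) (at_right 0)"
      by (rule Lim_transform_eventually[OF flat_tendsto_0[of "[:0, 1:] * p"]])
        (auto simp: eventually_at_right_field flat_def field_simps intro!: exI[of _ 1])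
    moreover have "((\<lambda>h. flat p h / h) \<longlongrightarrow> 0) (at_left 0)"
      by (rule Lim_transform_eventually[OF tendsto_const])
        (auto simp: eventually_at_left_field flat_def intro!: exI[of _ "-1"])
    ultimately have "((\<lambda>h. flat p h / h) \<longlongrightarrow> 0) (at 0)"
      by (simp add: filterlim_split_at)
    then show ?thesis using 3 by (simp add: has_field_derivative_iff flat_def)
  qed
qed

text \<open>
  The algebra generated by flat functions of affine functions is closed under partial
  derivatives, hence consists of smooth functions.
\<close>

inductive_set flat_algebra :: "field set" where
  flat: "(\<lambda>x. of_real (flat p (c + x \<bullet> v))) \<in> flat_algebra"
| const: "(\<lambda>x. c) \<in> flat_algebra"
| add: "\<phi> \<in> flat_algebra \<Longrightarrow> \<psi> \<in> flat_algebra \<Longrightarrow> (\<lambda>x. \<phi> x + \<psi> x) \<in> flat_algebra"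
| mult: "\<phi> \<in> flat_algebra \<Longrightarrow> \<psi> \<in> flat_algebra \<Longrightarrow> (\<lambda>x. \<phi> x * \<psi> x) \<in> flat_algebra"

lemma flat_algebra_derivative:
  assumes "\<phi> \<in> flat_algebra"
  shows "\<exists>G. (\<forall>b. (\<lambda>x. G x b) \<in> flat_algebra) \<and> (\<forall>x. (\<phi> has_derivative G x) (at x))"
  using assms
proof induction
  case (flat p c v)
  let ?q = "[:0, 0, 1:] * (p - pderiv p)"
  define G :: "plane \<Rightarrow> plane \<Rightarrow> complex" where "G x h = of_real (flat ?q (c + x \<bullet> v)) * of_real (h \<bullet> v)" for x h
  have "((\<lambda>x. of_real (flat p (c + x \<bullet> v))) has_derivative G x) (at x)" for x
  proof -
    have "((\<lambda>x. flat p (c + x \<bullet> v)) has_derivative (\<lambda>h. (h \<bullet> v) * flat ?q (c + x \<bullet> v))) (at x)"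
      by (rule has_derivative_compose[OF _ flat_derivative[unfolded has_field_derivative_def], THEN has_derivative_eq_rhs])
        (auto intro!: derivative_eq_intros simp: mult.commute)
    from bounded_linear.has_derivative[OF bounded_linear_of_real this] show ?thesis
      by (simp add: G_def[abs_def] mult.commute)
  qed
  moreover have "(\<lambda>x. G x b) \<in> flat_algebra" for b
    unfolding G_def by (intro flat_algebra.intros)
  ultimately show ?case by blast
next
  case (const c)
  show ?case by (rule exI[of _ "\<lambda>x h. 0"]) (auto intro: flat_algebra.const)
next
  case (add \<phi> \<psi>)
  then obtain G1 G2 where "\<forall>b. (\<lambda>x. G1 x b) \<in> flat_algebra" "\<forall>x. (\<phi> has_derivative G1 x) (at x)"
      "\<forall>b. (\<lambda>x. G2 x b) \<in> flat_algebra" "\<forall>x. (\<psi> has_derivative G2 x) (at x)" by blast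
  then show ?case by (intro exI[of _ "\<lambda>x b. G1 x b + G2 x b"]) (auto intro!: flat_algebra.add derivative_intros)
next
  case (mult \<phi> \<psi>)
  then obtain G1 G2 where "\<forall>b. (\<lambda>x. G1 x b) \<in> flat_algebra" "\<forall>x. (\<phi> has_derivative G1 x) (at x)"
      "\<forall>b. (\<lambda>x. G2 x b) \<in> flat_algebra" "\<forall>x. (\<psi> has_derivative G2 x) (at x)" by blast
  then show ?case using mult.hyps
    by (intro exI[of _ "\<lambda>x b. \<phi> x * G2 x b + G1 x b * \<psi> x"]) (auto intro!: flat_algebra.add flat_algebra.mult has_derivative_mult)
qed

lemma smooth_flat_algebra: "\<phi> \<in> flat_algebra \<Longrightarrow> smooth \<phi>"
proof (rule smooth_closure[of _ flat_algebra])
  fix u :: field and x b assume u: "u \<in> flat_algebra"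
  from flat_algebra_derivative[OF u] obtain G where
    G: "\<forall>b. (\<lambda>x. G x b) \<in> flat_algebra" "\<forall>x. (u has_derivative G x) (at x)" by blast
  show "u differentiable (at x)" unfolding differentiable_def by (rule exI[of _ "G x"], rule spec[OF G(2)])
  have "frechet_derivative u (at x) = G x" for x by (rule frechet_derivative_at[symmetric, OF spec[OF G(2)]])
  then show "(\<lambda>x. frechet_derivative u (at x) b) \<in> flat_algebra" using spec[OF G(1), of b] by simp
qed

text \<open>
  Products of \<open>exp (- 1 / (n * s))\<close>, with \<open>s\<close> running over the four signed distances to the sides,
  and extended by \<open>0\<close> to \<open>s \<le> 0\<close>, increase to the indicator function of the open box as \<open>n\<close> grows.
\<close>

lemma box_indicator_limit:
  fixes c d :: plane
  obtains \<phi> :: "nat \<Rightarrow> field" where "\<And>j. smooth (\<phi> j)" "\<And>j x. x \<notin> cbox c d \<Longrightarrow> \<phi> j x = 0"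
    "\<And>j x. norm (\<phi> j x) \<le> 1" "\<And>x. (\<lambda>j. \<phi> j x) \<longlonglongrightarrow> indicator (box c d) x"
proof -
  define s where "s j t = flat 1 (real (Suc j) * t)" for j t
  define \<phi> :: "nat \<Rightarrow> field" where "\<phi> j x = of_real (s j (fst x - fst c)) * of_real (s j (fst d - fst x)) *
      of_real (s j (snd x - snd c)) * of_real (s j (snd d - snd x))" for j x
  have s01: "0 \<le> s j t" "s j t \<le> 1" for j t by (auto simp: s_def flat_def)
  have s0: "s j t = 0" if "t \<le> 0" for j t
    using that by (auto simp: s_def flat_def zero_less_mult_iff)
  have slim: "(\<lambda>j. s j t) \<longlonglongrightarrow> (if t > 0 then 1 else 0)" for t
  proof (cases "t > 0")
    case True
    have "(\<lambda>j. exp (- (1 / t) * inverse (real (Suc j)))) \<longlonglongrightarrow> exp (- (1 / t) * 0)"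
      by (intro tendsto_intros LIMSEQ_inverse_real_of_nat)
    moreover have "s j t = exp (- (1 / t) * inverse (real (Suc j)))" for j
      using True by (simp add: s_def flat_def zero_less_mult_iff field_simps del: of_nat_Suc)
    ultimately show ?thesis using True by simp
  next
    case False then show ?thesis using s0 by simp
  qed
  have "s j (fst x - fst c) = flat 1 (- (real (Suc j) * fst c) + x \<bullet> (real (Suc j), 0))"
    "s j (snd x - snd c) = flat 1 (- (real (Suc j) * snd c) + x \<bullet> (0, real (Suc j)))"
    "s j (fst d - fst x) = flat 1 ((real (Suc j) * fst d) + x \<bullet> (- real (Suc j), 0))"
    "s j (snd d - snd x) = flat 1 ((real (Suc j) * snd d) + x \<bullet> (0, - real (Suc j)))" for j and x :: plane
    by (simp_all add: s_def inner_prod_def algebra_simps)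
  then have "\<phi> j \<in> flat_algebra" for j
    unfolding \<phi>_def[abs_def] by (simp only:) (intro flat_algebra.intros)
  then have 1: "smooth (\<phi> j)" for j by (rule smooth_flat_algebra)
  have box: "x \<in> box c d \<longleftrightarrow> 0 < fst x - fst c \<and> 0 < fst d - fst x \<and> 0 < snd x - snd c \<and> 0 < snd d - snd x" for x :: plane
    by (cases x, cases c, cases d) (auto simp: mem_box Basis_prod_def)
  have cbox: "x \<in> cbox c d \<longleftrightarrow> 0 \<le> fst x - fst c \<and> 0 \<le> fst d - fst x \<and> 0 \<le> snd x - snd c \<and> 0 \<le> snd d - snd x" for x :: plane
    by (cases x, cases c, cases d) (auto simp: mem_box Basis_prod_def)
  have 2: "\<phi> j x = 0" if "x \<notin> cbox c d" for j x
    using that unfolding cbox de_Morgan_conj not_le by (elim disjE) (simp_all add: \<phi>_def s0)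
  have 3: "norm (\<phi> j x) \<le> 1" for j x
    unfolding \<phi>_def norm_mult norm_of_real
    by (intro mult_le_one mult_nonneg_nonneg) (use s01 in auto)
  have 4: "(\<lambda>j. \<phi> j x) \<longlonglongrightarrow> indicator (box c d) x" for x
  proof -
    have "(\<lambda>j. \<phi> j x) \<longlonglongrightarrow> of_real (if fst x - fst c > 0 then 1 else 0) * of_real (if fst d - fst x > 0 then 1 else 0) *
        of_real (if snd x - snd c > 0 then 1 else 0) * of_real (if snd d - snd x > 0 then 1 else 0)"
      unfolding \<phi>_def by (intro tendsto_intros slim)
    then show ?thesis by (auto simp: indicator_def box)
  qed
  show ?thesis by (rule that[OF 1 2 3 4])
qed

text \<open>
  A Borel version makes joint measurability with a second variable available.
\<close>

lemma borel_version:
  fixes u :: "plane \<Rightarrow> complex"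
  assumes u: "u \<in> borel_measurable (lebesgue_on \<Omega>)" and \<Omega>: "\<Omega> \<in> sets lebesgue"
  obtains u' where "u' \<in> borel_measurable borel" "AE x in lebesgue_on \<Omega>. u' x = u x"
proof -
  have "(\<lambda>x. if x \<in> \<Omega> then u x else 0) \<in> borel_measurable lebesgue"
    using u \<Omega> borel_measurable_if by blast
  then have "(\<lambda>x. Re (if x \<in> \<Omega> then u x else 0)) \<in> borel_measurable (completion lborel)"
    "(\<lambda>x. Im (if x \<in> \<Omega> then u x else 0)) \<in> borel_measurable (completion lborel)"
    by measurable
  from this[THEN completion_ex_borel_measurable_real] obtain r i where
    [measurable]: "r \<in> borel_measurable borel" "i \<in> borel_measurable borel"
    and r: "AE x in lborel. Re (if x \<in> \<Omega> then u x else 0) = r x"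
    and i: "AE x in lborel. Im (if x \<in> \<Omega> then u x else 0) = i x"
    by auto
  have "AE x in lborel. x \<in> \<Omega> \<longrightarrow> Complex (r x) (i x) = u x"
    using r i by eventually_elim (auto simp: complex_eq_iff)
  then have "AE x in lebesgue. x \<in> \<Omega> \<longrightarrow> Complex (r x) (i x) = u x"
    by (rule AE_completion)
  then have "AE x in lebesgue_on \<Omega>. Complex (r x) (i x) = u x"
    using \<Omega> by (simp add: AE_restrict_space_iff)
  moreover have "(\<lambda>x. Complex (r x) (i x)) \<in> borel_measurable borel"
    unfolding borel_measurable_complex_iff by simp
  ultimately show ?thesis using that[of "\<lambda>x. Complex (r x) (i x)"] by blast
qed

lemma integral_box_eq_0:
  fixes f :: field
  assumes f: "integrable (lebesgue_on \<Omega>) f" and \<Omega>: "\<Omega> \<in> sets lebesgue"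
    and zero: "\<And>\<phi>. test_function \<Omega> \<phi> \<Longrightarrow> (LINT x|lebesgue_on \<Omega>. f x * \<phi> x) = 0"
    and sub: "box c d \<subseteq> cbox a b" "cbox a b \<subseteq> interior \<Omega>"
  shows "(LINT x|lebesgue_on \<Omega>. f x * indicator (box c d) x) = 0"
proof (cases "box c d = {}")
  case False
  then have cd: "cbox c d \<subseteq> cbox a b"
    using sub(1) closure_box closure_minimal closed_cbox by metis
  obtain \<phi> :: "nat \<Rightarrow> field" where \<phi>: "\<And>j. smooth (\<phi> j)" "\<And>j x. x \<notin> cbox c d \<Longrightarrow> \<phi> j x = 0"
    "\<And>j x. norm (\<phi> j x) \<le> 1" "\<And>x. (\<lambda>j. \<phi> j x) \<longlonglongrightarrow> indicator (box c d) x"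
    using box_indicator_limit[of c d] by blast
  have test: "test_function \<Omega> (\<phi> j)" for j
    unfolding test_function_def using \<phi>(1,2) cd sub(2) by (auto intro!: exI[of _ "cbox c d"])
  have [measurable]: "f \<in> borel_measurable (lebesgue_on \<Omega>)" using f by auto
  have meas: "\<phi> j \<in> borel_measurable (lebesgue_on \<Omega>)" for j
  proof -
    have "\<forall>x. \<phi> j differentiable (at x)"
      using \<phi>(1)[of j] unfolding smooth_def by (auto dest: bspec[of _ _ "[]"])
    then have "continuous_on UNIV (\<phi> j)"
      by (simp add: continuous_at_imp_continuous_on differentiable_imp_continuous_within)
    then have "\<phi> j \<in> borel_measurable borel" by (rule borel_measurable_continuous_onI)
    then show ?thesis by (intro measurable_restrict_space1 measurable_completion) simp
  qed
  have ind: "(indicator (box c d) :: field) \<in> borel_measurable (lebesgue_on \<Omega>)"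
    by (intro measurable_restrict_space1 measurable_completion) simp
  have "(\<lambda>j. LINT x|lebesgue_on \<Omega>. f x * \<phi> j x) \<longlonglongrightarrow> (LINT x|lebesgue_on \<Omega>. f x * indicator (box c d) x)"
  proof (rule integral_dominated_convergence[where w = "\<lambda>x. norm (f x)"])
    show "AE x in lebesgue_on \<Omega>. (\<lambda>j. f x * \<phi> j x) \<longlonglongrightarrow> f x * indicator (box c d) x"
      by (intro AE_I2 tendsto_intros \<phi>)
    show "AE x in lebesgue_on \<Omega>. norm (f x * \<phi> j x) \<le> norm (f x)" for j
      using \<phi>(3)[of j] by (intro AE_I2) (simp add: norm_mult mult_left_le)
  qed (use f meas ind in \<open>auto intro!: borel_measurable_times\<close>)
  then show ?thesis using zero[OF test] by (simp add: LIMSEQ_const_iff)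
qed simp

text \<open>
  By approximation the integral of \<open>f\<close> vanishes over every box whose closure lies in the
  interior of \<open>\<Omega>\<close>. Inside a fixed box such boxes generate the Borel sets and are stable under intersection, so
  the integral vanishes over all Borel subsets and \<open>f\<close> is zero almost everywhere there. Countably many boxes cover the interior.
\<close>

lemma fundamental_lemma:
  fixes f :: field
  assumes f: "integrable (lebesgue_on \<Omega>) f" and \<Omega>: "\<Omega> \<in> sets lebesgue"
    and null: "negligible (\<Omega> - interior \<Omega>)"
    and zero: "\<And>\<phi>. test_function \<Omega> \<phi> \<Longrightarrow> (LINT x|lebesgue_on \<Omega>. f x * \<phi> x) = 0"
  shows "AE x in lebesgue_on \<Omega>. f x = 0"
proof -
  obtain h where h[measurable]: "h \<in> borel_measurable borel" and hf: "AE x in lebesgue_on \<Omega>. h x = f x"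
    using borel_version[OF borel_measurable_integrable[OF f] \<Omega>] by blast
  have fm: "f \<in> borel_measurable (lebesgue_on \<Omega>)" using f by auto
  have ind: "(indicator (box a b) :: field) \<in> borel_measurable (lebesgue_on \<Omega>)" for a b
    by (intro measurable_restrict_space1 measurable_completion) simp
  have hm: "h \<in> borel_measurable (lebesgue_on \<Omega>)"
    by (intro measurable_restrict_space1 measurable_completion) simp
  have hint: "integrable (lebesgue_on \<Omega>) h"
    using f hf hm fm by (subst integrable_cong_AE[of _ _ f]) auto
  have box0: "AE x in lebesgue. x \<in> box a b \<longrightarrow> h x = 0" if ab: "cbox a b \<subseteq> interior \<Omega>" for a b
  proof -
    have abO: "box a b \<subseteq> \<Omega>" using ab box_subset_cbox interior_subset by blast
    define g where "g x = indicator (box a b) x *\<^sub>R h x" for x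
    have [measurable]: "g \<in> borel_measurable borel" unfolding g_def by measurable
    have "integrable lebesgue (\<lambda>x. indicator \<Omega> x *\<^sub>R h x)"
      using hint \<Omega> by (simp add: integrable_restrict_space)
    then have "integrable lebesgue (\<lambda>x. indicator (box a b) x *\<^sub>R (indicator \<Omega> x *\<^sub>R h x))"
      by (rule integrable_mult_indicator[rotated]) simp
    also have "(\<lambda>x. indicator (box a b) x *\<^sub>R (indicator \<Omega> x *\<^sub>R h x)) = g"
      using abO by (intro ext) (auto simp: g_def indicator_def)
    finally have gint: "integrable lborel g" by (simp add: integrable_completion)
    have P: "(LINT x:A|lborel. g x) = 0" if "A \<in> sets borel" for A
    proof -
      have "Int_stable (range (\<lambda>(a, b). box a b :: plane set))"
        by (auto simp: Int_stable_def box_Int_box)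
      moreover have "range (\<lambda>(a, b). box a b :: plane set) \<subseteq> Pow UNIV" by simp
      moreover have "A \<in> sigma_sets UNIV (range (\<lambda>(a, b). box a b :: plane set))"
        using that unfolding borel_eq_box by simp
      ultimately show ?thesis
      proof (induction rule: sigma_sets_induct_disjoint)
        case (basic A)
        then obtain c d where A: "A = box c d" by auto
        have "\<exists>c' d'. A \<inter> box a b = box c' d'" unfolding A box_Int_box by (rule exI, rule exI, rule refl)
        then obtain c' d' where Iab: "A \<inter> box a b = box c' d'" by (elim exE)
        have "(LINT x:A|lborel. g x) = (LINT x|lborel. indicator (box c' d') x *\<^sub>R h x)"
          unfolding Iab[symmetric] set_lebesgue_integral_def g_def
          by (intro Bochner_Integration.integral_cong) (auto simp: indicator_def)
        also have "\<dots> = (LINT x|lebesgue. indicator (box c' d') x *\<^sub>R h x)"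
          by (rule integral_completion[symmetric]) simp
        also have "\<dots> = (LINT x|lebesgue. indicator \<Omega> x *\<^sub>R (h x * indicator (box c' d') x))"
          using Iab abO by (intro Bochner_Integration.integral_cong) (auto simp: indicator_def)
        also have "\<dots> = (LINT x|lebesgue_on \<Omega>. h x * indicator (box c' d') x)"
          using \<Omega> by (subst integral_restrict_space) auto
        also have "\<dots> = (LINT x|lebesgue_on \<Omega>. f x * indicator (box c' d') x)"
          by (rule integral_cong_AE) (use hf hm fm ind in \<open>auto intro!: borel_measurable_times\<close>)
        also have "\<dots> = 0"
          by (rule integral_box_eq_0[OF f \<Omega> zero _ ab]) (use Iab box_subset_cbox in auto)
        finally show ?case .
      next
        case empty show ?case by (simp add: set_lebesgue_integral_def)
      next
        case (compl A)
        then have [measurable]: "A \<in> sets borel" by (simp add: borel_eq_box)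
        have "(LINT x|lborel. g x) = (LINT x|lborel. indicator \<Omega> x *\<^sub>R (h x * indicator (box a b) x))"
          using abO by (intro Bochner_Integration.integral_cong) (auto simp: indicator_def g_def)
        also have "\<dots> = (LINT x|lborel. indicator (box a b) x *\<^sub>R h x)"
          using abO by (intro Bochner_Integration.integral_cong) (auto simp: indicator_def)
        also have "\<dots> = (LINT x|lebesgue. indicator (box a b) x *\<^sub>R h x)"
          by (rule integral_completion[symmetric]) simp
        also have "\<dots> = (LINT x|lebesgue. indicator \<Omega> x *\<^sub>R (h x * indicator (box a b) x))"
          using abO by (intro Bochner_Integration.integral_cong) (auto simp: indicator_def)
        also have "\<dots> = (LINT x|lebesgue_on \<Omega>. h x * indicator (box a b) x)"
          using \<Omega> by (subst integral_restrict_space) auto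
        also have "\<dots> = (LINT x|lebesgue_on \<Omega>. f x * indicator (box a b) x)"
          by (rule integral_cong_AE) (use hf hm fm ind in \<open>auto intro!: borel_measurable_times\<close>)
        also have "\<dots> = 0"
          by (rule integral_box_eq_0[OF f \<Omega> zero box_subset_cbox ab])
        finally have all: "(LINT x|lborel. g x) = 0" .
        have "(LINT x|lborel. g x) = (LINT x|lborel. indicator A x *\<^sub>R g x + indicator (UNIV - A) x *\<^sub>R g x)"
          by (intro Bochner_Integration.integral_cong) (auto simp: indicator_def)
        also have "\<dots> = (LINT x:A|lborel. g x) + (LINT x:(UNIV - A)|lborel. g x)"
          unfolding set_lebesgue_integral_def
          by (intro Bochner_Integration.integral_add integrable_mult_indicator gint) auto
        finally show ?case using all compl by simp
      next
        case (union F)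
        then have [measurable]: "\<And>i. F i \<in> sets borel" by (simp add: borel_eq_box subset_eq)
        have "(LINT x:(\<Union>i. F i)|lborel. g x) = (\<Sum>i. (LINT x:(F i)|lborel. g x))"
          by (rule lebesgue_integral_countable_add)
            (use union.hyps(1) gint in \<open>auto simp: disjoint_family_on_def set_integrable_def intro!: integrable_mult_indicator\<close>)
        then show ?case using union by simp
      qed
    qed
    have "AE x in lborel. g x = 0"
      by (rule sigma_finite_measure.density_zero[OF lborel.sigma_finite_measure_axioms gint]) (use P in auto)
    then have "AE x in lborel. x \<in> box a b \<longrightarrow> h x = 0"
      by eventually_elim (auto simp: g_def)
    then show ?thesis by (rule AE_completion)
  qed
  have "\<exists>\<D>. countable \<D> \<and> \<D> \<subseteq> Pow (interior \<Omega>) \<and> (\<forall>X\<in>\<D>. \<exists>a b. X = cbox a b) \<and> \<Union>\<D> = interior \<Omega>"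
  proof (rule open_countable_Union_open_cbox[OF open_interior, of \<Omega>])
    fix \<D> assume "countable \<D>" "\<D> \<subseteq> Pow (interior \<Omega>)" "\<Union>\<D> = interior \<Omega>"
      and c: "\<And>X. X \<in> \<D> \<Longrightarrow> \<exists>a b. X = cbox a b"
    moreover have "\<forall>X\<in>\<D>. \<exists>a b. X = cbox a b" by (intro ballI c)
    ultimately show ?thesis by (intro exI[of _ \<D>] conjI)
  qed
  then obtain \<D> where D: "countable \<D>" "\<D> \<subseteq> Pow (interior \<Omega>)"
      "\<forall>X\<in>\<D>. \<exists>a b. X = cbox a b" "\<Union>\<D> = interior \<Omega>"
    by (elim exE conjE)
  have "AE x in lebesgue. x \<in> X \<longrightarrow> h x = 0" if X: "X \<in> \<D>" for X
  proof -
    from bspec[OF D(3) X] obtain a b where X': "X = cbox a b" by (elim exE)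
    have ab: "X = cbox a b" "cbox a b \<subseteq> interior \<Omega>" using D(2) X X' by blast+
    have "AE x in lebesgue. x \<notin> cbox a b - box a b"
      using negligible_frontier_interval[of a b] by (intro AE_not_in) (simp add: negligible_iff_null_sets)
    with box0[OF ab(2)] show ?thesis unfolding ab by eventually_elim auto
  qed
  then have "AE x in lebesgue. \<forall>X\<in>\<D>. x \<in> X \<longrightarrow> h x = 0"
    by (subst AE_ball_countable[OF D(1)]) blast
  moreover have "AE x in lebesgue. x \<notin> \<Omega> - interior \<Omega>"
    using null by (intro AE_not_in) (simp add: negligible_iff_null_sets)
  ultimately have "AE x in lebesgue. x \<in> \<Omega> \<longrightarrow> h x = 0"
    by eventually_elim (use D(4) in blast)
  then have "AE x in lebesgue_on \<Omega>. h x = 0"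
    using \<Omega> by (simp add: AE_restrict_space_iff)
  with hf show ?thesis by eventually_elim simp
qed

section \<open>Seminorms and semi-inner products on spaces of functions\<close>

text \<open>
  A linear space of functions with a seminorm, as a predicate on sets. A single axiom for
  linear combinations covers sums, differences and multiples.
\<close>

locale seminormed_family =
  fixes V :: "field set" and N :: "field \<Rightarrow> real"
  assumes lin: "u \<in> V \<Longrightarrow> v \<in> V \<Longrightarrow> (\<lambda>x. a * u x + b * v x) \<in> V"
    and norm_nonneg: "u \<in> V \<Longrightarrow> 0 \<le> N u"
    and norm_lin: "u \<in> V \<Longrightarrow> v \<in> V \<Longrightarrow> N (\<lambda>x. a * u x + b * v x) \<le> cmod a * N u + cmod b * N v"
begin

lemma add_mem: "u \<in> V \<Longrightarrow> v \<in> V \<Longrightarrow> (\<lambda>x. u x + v x) \<in> V"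
  using lin[of u v 1 1] by simp

lemma diff_mem: "u \<in> V \<Longrightarrow> v \<in> V \<Longrightarrow> (\<lambda>x. u x - v x) \<in> V"
  using lin[of u v 1 "-1"] by simp

lemma scale_mem: "u \<in> V \<Longrightarrow> (\<lambda>x. a * u x) \<in> V"
  using lin[of u u a 0] by simp

lemma norm_add: "u \<in> V \<Longrightarrow> v \<in> V \<Longrightarrow> N (\<lambda>x. u x + v x) \<le> N u + N v"
  using norm_lin[of u v 1 1] by simp

lemma norm_diff: "u \<in> V \<Longrightarrow> v \<in> V \<Longrightarrow> N (\<lambda>x. u x - v x) \<le> N u + N v"
  using norm_lin[of u v 1 "-1"] by simp

lemma norm_scale_le: "u \<in> V \<Longrightarrow> N (\<lambda>x. a * u x) \<le> cmod a * N u"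
  using norm_lin[of u u a 0] by simp

lemma norm_diff_triangle:
  assumes "u \<in> V" "v \<in> V"
  shows "N u \<le> N v + N (\<lambda>x. u x - v x)"
  using norm_add[OF assms(2) diff_mem[OF assms]] by simp

lemma norm_minus_commute: "u \<in> V \<Longrightarrow> v \<in> V \<Longrightarrow> N (\<lambda>x. u x - v x) = N (\<lambda>x. v x - u x)"
  using norm_scale_le[OF diff_mem, of u v "-1"] norm_scale_le[OF diff_mem, of v u "-1"]
  by (simp add: order_antisym)

lemma norm_zero: "u \<in> V \<Longrightarrow> N (\<lambda>x. 0) = 0"
  using norm_scale_le[of u 0] norm_nonneg[OF scale_mem, of u 0] by simp

lemma sum_mem: "finite A \<Longrightarrow> A \<noteq> {} \<Longrightarrow> (\<And>i. i \<in> A \<Longrightarrow> u i \<in> V) \<Longrightarrow> (\<lambda>x. \<Sum>i\<in>A. u i x) \<in> V"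
  by (induction A rule: finite_ne_induct) (auto intro: add_mem)

lemma subfamily:
  assumes "U \<subseteq> V" "\<And>u v a b. u \<in> U \<Longrightarrow> v \<in> U \<Longrightarrow> (\<lambda>x. a * u x + b * v x) \<in> U"
  shows "seminormed_family U N"
  using assms norm_nonneg norm_lin by unfold_locales blast+

end

locale semi_inner_family =
  fixes V :: "field set" and ip :: "field \<Rightarrow> field \<Rightarrow> complex"
  assumes ip_closed: "u \<in> V \<Longrightarrow> v \<in> V \<Longrightarrow> (\<lambda>x. a * u x + b * v x) \<in> V"
    and ip_lin: "u \<in> V \<Longrightarrow> v \<in> V \<Longrightarrow> z \<in> V \<Longrightarrow> ip (\<lambda>x. a * u x + b * v x) z = a * ip u z + b * ip v z"
    and ip_commute: "u \<in> V \<Longrightarrow> v \<in> V \<Longrightarrow> ip v u = cnj (ip u v)"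
    and ip_nonneg: "u \<in> V \<Longrightarrow> 0 \<le> Re (ip u u)"
begin

lemma ip_self: "u \<in> V \<Longrightarrow> ip u u = of_real (Re (ip u u))"
  using ip_commute[of u u] by (metis complex_cnj_cancel_iff complex_eq_iff complex_cnj of_real_Re Reals_cnj_iff)

lemma ip_lin_self:
  assumes "u \<in> V" "v \<in> V"
  shows "Re (ip (\<lambda>x. a * u x + b * v x) (\<lambda>x. a * u x + b * v x)) =
    (cmod a)\<^sup>2 * Re (ip u u) + (cmod b)\<^sup>2 * Re (ip v v) + 2 * Re (a * cnj b * ip u v)"
proof -
  let ?w = "\<lambda>x. a * u x + b * v x"
  have w: "?w \<in> V" using assms by (rule ip_closed)
  have 1: "ip ?w ?w = a * ip u ?w + b * ip v ?w" using assms w by (simp add: ip_lin)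
  have 2: "ip u ?w = cnj a * cnj (ip u u) + cnj b * ip u v"
    using ip_commute[OF w assms(1)] ip_lin[OF assms(1,2,1), of a b] ip_commute[OF assms] by simp
  have 3: "ip v ?w = cnj a * cnj (ip u v) + cnj b * cnj (ip v v)"
    using ip_commute[OF w assms(2)] ip_lin[OF assms(1,2,2), of a b] by simp
  have "a * (cnj a * cnj (ip u u)) = of_real ((cmod a)\<^sup>2 * Re (ip u u))"
    by (subst ip_self[OF assms(1)]) (simp add: mult.assoc[symmetric] complex_norm_square[symmetric])
  moreover have "b * (cnj b * cnj (ip v v)) = of_real ((cmod b)\<^sup>2 * Re (ip v v))"
    by (subst ip_self[OF assms(2)]) (simp add: mult.assoc[symmetric] complex_norm_square[symmetric])
  ultimately have "Re (ip ?w ?w) = (cmod a)\<^sup>2 * Re (ip u u) + (cmod b)\<^sup>2 * Re (ip v v)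
      + Re (a * cnj b * ip u v + cnj (a * cnj b * ip u v))"
    unfolding 1 2 3 by (simp add: algebra_simps)
  then show ?thesis by (simp add: algebra_simps)
qed

text \<open>
  The usual discriminant argument; it also covers vectors of seminorm zero.
\<close>

lemma Cauchy_Schwarz:
  assumes "u \<in> V" "v \<in> V"
  shows "cmod (ip u v) \<le> sqrt (Re (ip u u)) * sqrt (Re (ip v v))"
proof -
  define p q c where "p = Re (ip u u)" and "q = Re (ip v v)" and "c = cmod (ip u v)"
  have p0: "p \<ge> 0" and q0: "q \<ge> 0" and c0: "c \<ge> 0"
    using ip_nonneg assms by (auto simp: p_def q_def c_def)
  \<comment> \<open>A unimodular factor makes the mixed term negative, so a real quadratic form is nonnegative.\<close>
  obtain s where s: "cmod s = 1" "s * ip u v = of_real c"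
  proof (cases "ip u v = 0")
    case True then show ?thesis using that[of 1] by (simp add: c_def)
  next
    case False
    then show ?thesis using that[of "of_real c / ip u v"] by (simp add: c_def norm_divide)
  qed
  have quad: "0 \<le> r\<^sup>2 * p + q - 2 * r * c" for r :: real
  proof -
    have "0 \<le> Re (ip (\<lambda>x. (of_real (-r) * s) * u x + 1 * v x) (\<lambda>x. (of_real (-r) * s) * u x + 1 * v x))"
      by (rule ip_nonneg[OF ip_closed[OF assms]])
    also have "\<dots> = (cmod (of_real (-r) * s))\<^sup>2 * p + q + 2 * Re (of_real (-r) * s * ip u v)"
      by (subst ip_lin_self[OF assms]) (simp add: p_def q_def)
    also have "of_real (-r) * s * ip u v = of_real (- r * c)"
      using s(2) by (simp add: mult.assoc)
    finally show ?thesis using s(1) by (simp add: norm_mult)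
  qed
  have "c\<^sup>2 \<le> p * q"
  proof (cases "p = 0")
    case True
    have "c = 0"
    proof (rule ccontr)
      assume "c \<noteq> 0"
      then show False using quad[of "(q + 1) / c"] True q0 by simp
    qed
    then show ?thesis using True by simp
  next
    case False
    then show ?thesis using quad[of "c / p"] p0 by (simp add: field_simps power2_eq_square)
  qed
  then have "c \<le> sqrt (p * q)" by (rule real_le_rsqrt)
  then show ?thesis by (simp add: p_def q_def c_def real_sqrt_mult)
qed

sublocale seminormed_family V "\<lambda>u. sqrt (Re (ip u u))"
proof
  fix u v a b assume uv: "u \<in> V" "v \<in> V"
  let ?p = "sqrt (Re (ip u u))" and ?q = "sqrt (Re (ip v v))"
  show "(\<lambda>x. a * u x + b * v x) \<in> V" using uv by (rule ip_closed)
  have "Re (a * cnj b * ip u v) \<le> cmod a * cmod b * (?p * ?q)"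
    using complex_Re_le_cmod[of "a * cnj b * ip u v"] mult_left_mono[OF Cauchy_Schwarz[OF uv], of "cmod a * cmod b"]
    by (simp add: norm_mult)
  then have "Re (ip (\<lambda>x. a * u x + b * v x) (\<lambda>x. a * u x + b * v x)) \<le> (cmod a * ?p + cmod b * ?q)\<^sup>2"
    using ip_nonneg[OF uv(1)] ip_nonneg[OF uv(2)]
    by (simp add: ip_lin_self[OF uv] power2_sum power_mult_distrib algebra_simps)
  then show "sqrt (Re (ip (\<lambda>x. a * u x + b * v x) (\<lambda>x. a * u x + b * v x))) \<le> cmod a * ?p + cmod b * ?q"
    by (rule real_le_lsqrt[rotated]) (use uv ip_nonneg in auto)
qed (use ip_nonneg in auto)

end

section \<open>Square-integrable functions\<close>

lemma L2_mult_integrable: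
  assumes "u \<in> L2 M" "v \<in> L2 M"
  shows "integrable M (\<lambda>x. u x * v x)"
proof (rule Bochner_Integration.integrable_bound[where f = "\<lambda>x. (cmod (u x))\<^sup>2 + (cmod (v x))\<^sup>2"])
  show "AE x in M. norm (u x * v x) \<le> norm ((cmod (u x))\<^sup>2 + (cmod (v x))\<^sup>2)"
  proof (rule AE_I2)
    fix x
    have "0 \<le> (cmod (u x) - cmod (v x))\<^sup>2" "0 \<le> cmod (u x) * cmod (v x)" by auto
    then have "cmod (u x) * cmod (v x) \<le> (cmod (u x))\<^sup>2 + (cmod (v x))\<^sup>2"
      unfolding power2_diff by linarith
    then show "norm (u x * v x) \<le> norm ((cmod (u x))\<^sup>2 + (cmod (v x))\<^sup>2)" by (simp add: norm_mult)
  qed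
qed (use assms in \<open>auto simp: L2_def\<close>)

lemma L2_cnj: "u \<in> L2 M \<Longrightarrow> (\<lambda>x. cnj (u x)) \<in> L2 M"
  by (auto simp: L2_def intro: borel_measurable_continuous_on[OF continuous_on_cnj[OF continuous_on_id]])

lemma L2_scale: "u \<in> L2 M \<Longrightarrow> (\<lambda>x. a * u x) \<in> L2 M"
  by (auto simp: L2_def norm_mult power_mult_distrib)

lemma L2_add:
  assumes "u \<in> L2 M" "v \<in> L2 M"
  shows "(\<lambda>x. u x + v x) \<in> L2 M"
proof -
  have [measurable]: "u \<in> borel_measurable M" "v \<in> borel_measurable M" using assms by (auto simp: L2_def)
  have "integrable M (\<lambda>x. (cmod (u x + v x))\<^sup>2)"
  proof (rule Bochner_Integration.integrable_bound[where f = "\<lambda>x. 2 * (cmod (u x))\<^sup>2 + 2 * (cmod (v x))\<^sup>2"])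
    show "AE x in M. norm ((cmod (u x + v x))\<^sup>2) \<le> norm (2 * (cmod (u x))\<^sup>2 + 2 * (cmod (v x))\<^sup>2)"
    proof (rule AE_I2)
      fix x
      have "(cmod (u x + v x))\<^sup>2 \<le> (cmod (u x) + cmod (v x))\<^sup>2"
        by (intro power_mono norm_triangle_ineq) auto
      also have "\<dots> \<le> 2 * (cmod (u x))\<^sup>2 + 2 * (cmod (v x))\<^sup>2"
        using zero_le_power2[of "cmod (u x) - cmod (v x)"] unfolding power2_diff power2_sum by linarith
      finally show "norm ((cmod (u x + v x))\<^sup>2) \<le> norm (2 * (cmod (u x))\<^sup>2 + 2 * (cmod (v x))\<^sup>2)" by simp
    qed
  qed (use assms in \<open>auto simp: L2_def\<close>)
  then show ?thesis by (auto simp: L2_def)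
qed

lemma L2_lin: "u \<in> L2 M \<Longrightarrow> v \<in> L2 M \<Longrightarrow> (\<lambda>x. a * u x + b * v x) \<in> L2 M"
  by (intro L2_add L2_scale)

lemma norm_sq_integral: "u \<in> L2 M \<Longrightarrow> (LINT x|M. u x * cnj (u x)) = of_real (LINT x|M. (cmod (u x))\<^sup>2)"
  unfolding complex_norm_square[symmetric] integral_complex_of_real ..

text \<open>
  The linearity rule of this instance is what the Sobolev inner product needs in each
  multi-index separately.
\<close>

lemma L2_scalar_product: "semi_inner_family (L2 M) (\<lambda>u v. LINT x|M. u x * cnj (v x))"
  for M :: "plane measure"
proof
  fix u v z :: field and a b
  assume "u \<in> L2 M" "v \<in> L2 M"
  then show "(\<lambda>x. a * u x + b * v x) \<in> L2 M" by (rule L2_lin)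
  assume "z \<in> L2 M"
  have "(LINT x|M. (a * u x + b * v x) * cnj (z x)) = (LINT x|M. a * (u x * cnj (z x)) + b * (v x * cnj (z x)))"
    by (simp add: algebra_simps)
  also have "\<dots> = a * (LINT x|M. u x * cnj (z x)) + b * (LINT x|M. v x * cnj (z x))"
    using \<open>u \<in> L2 M\<close> \<open>v \<in> L2 M\<close> \<open>z \<in> L2 M\<close>
    by (subst Bochner_Integration.integral_add) (auto intro!: integrable_mult_right L2_mult_integrable L2_cnj)
  finally show "(LINT x|M. (a * u x + b * v x) * cnj (z x)) = a * (LINT x|M. u x * cnj (z x)) + b * (LINT x|M. v x * cnj (z x))" .
next
  fix u v :: field
  assume "u \<in> L2 M" "v \<in> L2 M"
  have "cnj (LINT x|M. u x * cnj (v x)) = (LINT x|M. cnj (u x * cnj (v x)))"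
    by (rule Bochner_Integration.integral_cnj[symmetric])
  then show "(LINT x|M. v x * cnj (u x)) = cnj (LINT x|M. u x * cnj (v x))"
    by (simp add: mult.commute)
next
  fix u :: field
  assume "u \<in> L2 M"
  then show "0 \<le> Re (LINT x|M. u x * cnj (u x))" by (simp add: norm_sq_integral)
qed

section \<open>Weak derivatives and the Sobolev inner product\<close>

text \<open>
  Boundedness makes continuous functions square integrable on \<open>\<Omega>\<close>. The boundary part that belongs to
  \<open>\<Omega>\<close> is a null set, so test functions, which live in the interior, detect functions on \<open>\<Omega>\<close>.
\<close>

locale sobolev_domain =
  fixes \<Omega> :: "plane set"
  assumes bounded: "bounded \<Omega>" and sets: "\<Omega> \<in> sets lebesgue"
    and boundary_null: "negligible (\<Omega> - interior \<Omega>)"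
begin

abbreviation "M \<equiv> lebesgue_on \<Omega>"

sublocale finite_measure M
  by (rule finite_measure_lebesgue_on) (rule bounded_set_imp_lmeasurable[OF bounded sets])

lemma continuous_L2:
  fixes \<phi> :: field
  assumes "continuous_on UNIV \<phi>"
  shows "\<phi> \<in> L2 M"
proof -
  have "\<phi> \<in> borel_measurable borel" using assms by (rule borel_measurable_continuous_onI)
  then have m[measurable]: "\<phi> \<in> borel_measurable M"
    by (intro measurable_restrict_space1 measurable_completion) simp
  have "compact (\<phi> ` closure \<Omega>)"
    using bounded by (intro compact_continuous_image continuous_on_subset[OF assms]) (auto simp: compact_closure)
  then obtain B where B: "\<And>x. x \<in> closure \<Omega> \<Longrightarrow> cmod (\<phi> x) \<le> B"
    using compact_imp_bounded[of "\<phi> ` closure \<Omega>"] unfolding bounded_iff by blast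
  have "AE x in M. norm ((cmod (\<phi> x))\<^sup>2) \<le> B\<^sup>2"
    using B closure_subset[of \<Omega>] by (intro AE_I2) (auto simp: abs_square_le_1 power_mono)
  then have "integrable M (\<lambda>x. (cmod (\<phi> x))\<^sup>2)" by (intro integrable_const_bound) auto
  then show ?thesis by (simp add: L2_def m)
qed

lemma L2_integrable: "u \<in> L2 M \<Longrightarrow> integrable M u"
  using L2_mult_integrable[of u M "\<lambda>_. 1"] continuous_L2[of "\<lambda>_. 1"] by simp

lemma smooth_partial_continuous:
  assumes "smooth \<phi>"
  shows "continuous_on UNIV (multi_partial \<beta> \<phi>)"
proof -
  have "replicate (fst \<beta>) (1, 0) @ replicate (snd \<beta>) (0, 1) \<in> lists (Basis :: plane set)"
    by (auto simp: Basis_prod_def in_lists_conv_set)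
  then show ?thesis
    using assms unfolding smooth_def multi_partial_def
    by (simp add: continuous_at_imp_continuous_on differentiable_imp_continuous_within)
qed

lemma smooth_continuous: "smooth \<phi> \<Longrightarrow> continuous_on UNIV \<phi>"
  using smooth_partial_continuous[of \<phi> "(0, 0)"] by (simp add: multi_partial_def)

lemma test_function_L2: "test_function \<Omega> \<phi> \<Longrightarrow> multi_partial \<beta> \<phi> \<in> L2 M" "test_function \<Omega> \<phi> \<Longrightarrow> \<phi> \<in> L2 M"
  by (auto simp: test_function_def intro: continuous_L2 smooth_partial_continuous smooth_continuous)

text \<open>
  This makes the arbitrary choice in \<open>weak_partial\<close> harmless: it is linear and depends only on
  the almost-everywhere class.
\<close>

lemma weak_partial_unique:
  assumes "has_weak_partial \<Omega> \<beta> u d" "has_weak_partial \<Omega> \<beta> u e"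
  shows "AE x in M. d x = e x"
proof -
  have de: "d \<in> L2 M" "e \<in> L2 M" using assms by (auto simp: has_weak_partial_def)
  have "AE x in M. d x - e x = 0"
  proof (rule fundamental_lemma[OF _ sets boundary_null])
    show "integrable M (\<lambda>x. d x - e x)" using de by (intro Bochner_Integration.integrable_diff L2_integrable)
    fix \<phi> assume t: "test_function \<Omega> \<phi>"
    have "(- 1) ^ (fst \<beta> + snd \<beta>) * (LINT x|M. d x * \<phi> x) = (- 1) ^ (fst \<beta> + snd \<beta>) * (LINT x|M. e x * \<phi> x)"
      using assms[unfolded has_weak_partial_def, THEN conjunct2, rule_format, OF t] by (rule trans[OF sym])
    then have "(LINT x|M. d x * \<phi> x) = (LINT x|M. e x * \<phi> x)" by simp
    then show "(LINT x|M. (d x - e x) * \<phi> x) = 0"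
      using de test_function_L2(2)[OF t] by (simp add: left_diff_distrib L2_mult_integrable)
  qed
  then show ?thesis by simp
qed

lemma has_weak_partial_lin:
  assumes uv: "u \<in> L2 M" "v \<in> L2 M"
    and d: "has_weak_partial \<Omega> \<beta> u d" and e: "has_weak_partial \<Omega> \<beta> v e"
  shows "has_weak_partial \<Omega> \<beta> (\<lambda>x. a * u x + b * v x) (\<lambda>x. a * d x + b * e x)"
  unfolding has_weak_partial_def
proof (intro conjI allI impI)
  have de: "d \<in> L2 M" "e \<in> L2 M" using d e by (auto simp: has_weak_partial_def)
  then show "(\<lambda>x. a * d x + b * e x) \<in> L2 M" by (rule L2_lin)
  fix \<phi> assume t: "test_function \<Omega> \<phi>"
  have lin: "(LINT x|M. (a * f x + b * g x) * \<psi> x) = a * (LINT x|M. f x * \<psi> x) + b * (LINT x|M. g x * \<psi> x)"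
    if "f \<in> L2 M" "g \<in> L2 M" "\<psi> \<in> L2 M" for f g \<psi>
  proof -
    have "(LINT x|M. (a * f x + b * g x) * \<psi> x) = (LINT x|M. a * (f x * \<psi> x) + b * (g x * \<psi> x))"
      by (simp add: algebra_simps)
    then show ?thesis
      using that by (subst (asm) Bochner_Integration.integral_add) (auto intro!: integrable_mult_right L2_mult_integrable)
  qed
  show "(LINT x|M. (a * u x + b * v x) * multi_partial \<beta> \<phi> x) =
      (- 1) ^ (fst \<beta> + snd \<beta>) * (LINT x|M. (a * d x + b * e x) * \<phi> x)"
  proof -
    have du: "(LINT x|M. u x * multi_partial \<beta> \<phi> x) = (- 1) ^ (fst \<beta> + snd \<beta>) * (LINT x|M. d x * \<phi> x)"
      using d t unfolding has_weak_partial_def by blast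
    have ev: "(LINT x|M. v x * multi_partial \<beta> \<phi> x) = (- 1) ^ (fst \<beta> + snd \<beta>) * (LINT x|M. e x * \<phi> x)"
      using e t unfolding has_weak_partial_def by blast
    show ?thesis
      unfolding lin[OF uv test_function_L2(1)[OF t]] lin[OF de test_function_L2(2)[OF t]] du ev
      by (simp add: algebra_simps)
  qed
qed

lemma has_weak_partial_AE:
  assumes "u \<in> L2 M" "v \<in> L2 M" "AE x in M. u x = v x" "has_weak_partial \<Omega> \<beta> u d"
  shows "has_weak_partial \<Omega> \<beta> v d"
proof -
  have "(LINT x|M. v x * multi_partial \<beta> \<phi> x) = (LINT x|M. u x * multi_partial \<beta> \<phi> x)"
    if "test_function \<Omega> \<phi>" for \<phi>
  proof (rule integral_cong_AE)
    show "AE x in M. v x * multi_partial \<beta> \<phi> x = u x * multi_partial \<beta> \<phi> x"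
      using assms(3) by eventually_elim simp
  qed (use assms test_function_L2(1)[OF that, of \<beta>] in \<open>auto simp: L2_def intro!: borel_measurable_times\<close>)
  then show ?thesis using assms(4) by (simp add: has_weak_partial_def)
qed

lemma weak_partial_works: "\<exists>d. has_weak_partial \<Omega> \<beta> u d \<Longrightarrow> has_weak_partial \<Omega> \<beta> u (weak_partial \<Omega> \<beta> u)"
  unfolding weak_partial_def by (rule someI_ex[of "has_weak_partial \<Omega> \<beta> u"])

lemma weak_partial_eq: "has_weak_partial \<Omega> \<beta> u d \<Longrightarrow> AE x in M. weak_partial \<Omega> \<beta> u x = d x"
  by (rule weak_partial_unique[OF weak_partial_works]) (rule exI)

definition multi_indices :: "nat \<Rightarrow> (nat \<times> nat) set" where
  "multi_indices n = {(p, q). p + q \<le> n}"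

lemma finite_multi_indices: "finite (multi_indices n)"
  by (rule finite_subset[of _ "{..n} \<times> {..n}"]) (auto simp: multi_indices_def)

lemma sobolev_iff: "u \<in> sobolev n \<Omega> \<longleftrightarrow> u \<in> L2 M \<and> (\<forall>\<beta>\<in>multi_indices n. \<exists>d. has_weak_partial \<Omega> \<beta> u d)"
  by (simp add: sobolev_def multi_indices_def)

lemma sobolev_L2: "u \<in> sobolev n \<Omega> \<Longrightarrow> u \<in> L2 M"
  by (simp add: sobolev_iff)

lemma sobolev_weak_partial:
  "u \<in> sobolev n \<Omega> \<Longrightarrow> \<beta> \<in> multi_indices n \<Longrightarrow> has_weak_partial \<Omega> \<beta> u (weak_partial \<Omega> \<beta> u)"
  by (auto simp: sobolev_iff intro: weak_partial_works)

lemma sobolev_weak_partial_L2: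
  "u \<in> sobolev n \<Omega> \<Longrightarrow> \<beta> \<in> multi_indices n \<Longrightarrow> weak_partial \<Omega> \<beta> u \<in> L2 M"
  using sobolev_weak_partial by (auto simp: has_weak_partial_def)

text \<open>
  The inner product that induces \<open>sobolev_norm\<close>.
\<close>

definition sob_ip :: "nat \<Rightarrow> field \<Rightarrow> field \<Rightarrow> complex" where
  "sob_ip n u v = (\<Sum>\<beta>\<in>multi_indices n. LINT x|M. weak_partial \<Omega> \<beta> u x * cnj (weak_partial \<Omega> \<beta> v x))"

lemma weak_partial_lin:
  assumes "u \<in> sobolev n \<Omega>" "v \<in> sobolev n \<Omega>" "\<beta> \<in> multi_indices n"
  shows "AE x in M. weak_partial \<Omega> \<beta> (\<lambda>x. a * u x + b * v x) x = a * weak_partial \<Omega> \<beta> u x + b * weak_partial \<Omega> \<beta> v x"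
  by (rule weak_partial_eq[OF has_weak_partial_lin[OF sobolev_L2[OF assms(1)] sobolev_L2[OF assms(2)]
      sobolev_weak_partial[OF assms(1,3)] sobolev_weak_partial[OF assms(2,3)]]])

lemma sobolev_lin:
  assumes "u \<in> sobolev n \<Omega>" "v \<in> sobolev n \<Omega>"
  shows "(\<lambda>x. a * u x + b * v x) \<in> sobolev n \<Omega>"
  unfolding sobolev_iff
proof (intro conjI ballI exI)
  show "(\<lambda>x. a * u x + b * v x) \<in> L2 M" by (rule L2_lin[OF assms[THEN sobolev_L2]])
  show "has_weak_partial \<Omega> \<beta> (\<lambda>x. a * u x + b * v x) (\<lambda>x. a * weak_partial \<Omega> \<beta> u x + b * weak_partial \<Omega> \<beta> v x)"
    if "\<beta> \<in> multi_indices n" for \<beta>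
    by (rule has_weak_partial_lin[OF assms[THEN sobolev_L2] assms[THEN sobolev_weak_partial, OF that]])
qed

text \<open>
  Any representatives of the weak derivatives may be used to compute the inner product.
\<close>

lemma sob_ip_eq:
  assumes "v \<in> sobolev n \<Omega>" "u \<in> sobolev n \<Omega>"
    and "\<And>\<beta>. \<beta> \<in> multi_indices n \<Longrightarrow> AE x in M. weak_partial \<Omega> \<beta> u x = d \<beta> x"
    and "\<And>\<beta>. \<beta> \<in> multi_indices n \<Longrightarrow> d \<beta> \<in> L2 M"
  shows "sob_ip n u v = (\<Sum>\<beta>\<in>multi_indices n. LINT x|M. d \<beta> x * cnj (weak_partial \<Omega> \<beta> v x))"
  unfolding sob_ip_def
proof (rule sum.cong[OF refl])
  fix \<beta> assume b: "\<beta> \<in> multi_indices n"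
  show "(LINT x|M. weak_partial \<Omega> \<beta> u x * cnj (weak_partial \<Omega> \<beta> v x)) = (LINT x|M. d \<beta> x * cnj (weak_partial \<Omega> \<beta> v x))"
  proof (rule integral_cong_AE)
    show "AE x in M. weak_partial \<Omega> \<beta> u x * cnj (weak_partial \<Omega> \<beta> v x) = d \<beta> x * cnj (weak_partial \<Omega> \<beta> v x)"
      using assms(3)[OF b] by eventually_elim simp
  qed (use b sobolev_weak_partial_L2[OF assms(1) b, THEN L2_cnj] sobolev_weak_partial_L2[OF assms(2) b] assms(4)[OF b]
       in \<open>auto simp: L2_def intro!: borel_measurable_times\<close>)
qed

lemma sob_ip_self:
  assumes "u \<in> sobolev n \<Omega>"
  shows "sob_ip n u u = of_real (\<Sum>\<beta>\<in>multi_indices n. LINT x|M. (cmod (weak_partial \<Omega> \<beta> u x))\<^sup>2)"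
  unfolding sob_ip_def of_real_sum
  by (rule sum.cong[OF refl]) (rule norm_sq_integral, rule sobolev_weak_partial_L2[OF assms])

lemma sobolev_norm_eq:
  assumes "u \<in> sobolev n \<Omega>"
  shows "sobolev_norm n \<Omega> u = sqrt (Re (sob_ip n u u))"
  unfolding sobolev_norm_def sob_ip_self[OF assms] by (simp add: multi_indices_def)

lemma semi_inner_sobolev: "semi_inner_family (sobolev n \<Omega>) (sob_ip n)"
proof
  fix u v a b assume uv: "u \<in> sobolev n \<Omega>" "v \<in> sobolev n \<Omega>"
  show "(\<lambda>x. a * u x + b * v x) \<in> sobolev n \<Omega>" using uv by (rule sobolev_lin)
  fix z assume z: "z \<in> sobolev n \<Omega>"
  have "sob_ip n (\<lambda>x. a * u x + b * v x) z = (\<Sum>\<beta>\<in>multi_indices n.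
      LINT x|M. (a * weak_partial \<Omega> \<beta> u x + b * weak_partial \<Omega> \<beta> v x) * cnj (weak_partial \<Omega> \<beta> z x))"
    by (rule sob_ip_eq[OF z sobolev_lin[OF uv]])
      (use uv weak_partial_lin in \<open>auto intro!: L2_lin sobolev_weak_partial_L2\<close>)
  also have "\<dots> = (\<Sum>\<beta>\<in>multi_indices n. a * (LINT x|M. weak_partial \<Omega> \<beta> u x * cnj (weak_partial \<Omega> \<beta> z x))
      + b * (LINT x|M. weak_partial \<Omega> \<beta> v x * cnj (weak_partial \<Omega> \<beta> z x)))"
  proof (rule sum.cong[OF refl])
    fix \<beta> assume b: "\<beta> \<in> multi_indices n"
    show "(LINT x|M. (a * weak_partial \<Omega> \<beta> u x + b * weak_partial \<Omega> \<beta> v x) * cnj (weak_partial \<Omega> \<beta> z x)) =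
      a * (LINT x|M. weak_partial \<Omega> \<beta> u x * cnj (weak_partial \<Omega> \<beta> z x))
      + b * (LINT x|M. weak_partial \<Omega> \<beta> v x * cnj (weak_partial \<Omega> \<beta> z x))"
      by (rule semi_inner_family.ip_lin[OF L2_scalar_product]) (rule sobolev_weak_partial_L2[OF uv(1) b]
        sobolev_weak_partial_L2[OF uv(2) b] sobolev_weak_partial_L2[OF z b])+
  qed
  also have "\<dots> = a * sob_ip n u z + b * sob_ip n v z"
    by (simp add: sob_ip_def sum.distrib sum_distrib_left)
  finally show "sob_ip n (\<lambda>x. a * u x + b * v x) z = a * sob_ip n u z + b * sob_ip n v z" .
next
  fix u v assume uv: "u \<in> sobolev n \<Omega>" "v \<in> sobolev n \<Omega>"
  show "sob_ip n v u = cnj (sob_ip n u v)"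
    unfolding sob_ip_def cnj_sum
    by (rule sum.cong[OF refl]) (rule semi_inner_family.ip_commute[OF L2_scalar_product];
        rule sobolev_weak_partial_L2[OF uv(1)] sobolev_weak_partial_L2[OF uv(2)])
next
  fix u assume "u \<in> sobolev n \<Omega>"
  then show "0 \<le> Re (sob_ip n u u)" by (simp add: sob_ip_self sum_nonneg)
qed

lemma seminormed_sobolev: "seminormed_family (sobolev n \<Omega>) (sobolev_norm n \<Omega>)"
proof -
  have 1: "seminormed_family (sobolev n \<Omega>) (\<lambda>u. sqrt (Re (sob_ip n u u)))"
  proof -
    interpret semi_inner_family "sobolev n \<Omega>" "sob_ip n" by (rule semi_inner_sobolev)
    show ?thesis by (rule seminormed_family_axioms)
  qed
  show ?thesis
  proof
    fix u v a b assume uv: "u \<in> sobolev n \<Omega>" "v \<in> sobolev n \<Omega>"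
    show *: "(\<lambda>x. a * u x + b * v x) \<in> sobolev n \<Omega>" using uv by (rule sobolev_lin)
    show "sobolev_norm n \<Omega> (\<lambda>x. a * u x + b * v x) \<le> cmod a * sobolev_norm n \<Omega> u + cmod b * sobolev_norm n \<Omega> v"
      unfolding sobolev_norm_eq[OF *] sobolev_norm_eq[OF uv(1)] sobolev_norm_eq[OF uv(2)]
      by (rule seminormed_family.norm_lin[OF 1 uv])
  next
    fix u assume u: "u \<in> sobolev n \<Omega>"
    show "0 \<le> sobolev_norm n \<Omega> u"
      unfolding sobolev_norm_eq[OF u] by (rule seminormed_family.norm_nonneg[OF 1 u])
  qed
qed

lemma sobolev_norm_sq:
  assumes "u \<in> sobolev n \<Omega>"
  shows "cmod (sob_ip n u u) = (sobolev_norm n \<Omega> u)\<^sup>2"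
proof -
  have pos: "0 \<le> Re (sob_ip n u u)"
    by (rule semi_inner_family.ip_nonneg[OF semi_inner_sobolev assms])
  have "cmod (sob_ip n u u) = \<bar>Re (sob_ip n u u)\<bar>"
    unfolding sob_ip_self[OF assms] norm_of_real Re_complex_of_real ..
  then show ?thesis unfolding sobolev_norm_eq[OF assms] real_sqrt_pow2[OF pos] abs_of_nonneg[OF pos] .
qed

lemma sobolev_norm_AE_0:
  assumes "u \<in> sobolev n \<Omega>" "AE x in M. u x = 0"
  shows "sobolev_norm n \<Omega> u = 0"
proof -
  have z: "has_weak_partial \<Omega> \<beta> u (\<lambda>_. 0)" for \<beta>
  proof (rule has_weak_partial_AE)
    show "AE x in M. (\<lambda>_. 0) x = u x" using assms(2) by eventually_elim simp
    show "has_weak_partial \<Omega> \<beta> (\<lambda>_. 0) (\<lambda>_. 0)" by (simp add: has_weak_partial_def L2_def)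
  qed (use sobolev_L2[OF assms(1)] in \<open>auto simp: L2_def\<close>)
  have "sob_ip n u u = (\<Sum>\<beta>\<in>multi_indices n. LINT x|M. 0 * cnj (weak_partial \<Omega> \<beta> u x))"
    by (rule sob_ip_eq) (use assms weak_partial_eq[OF z] in \<open>auto simp: L2_def\<close>)
  then show ?thesis using assms by (simp add: sobolev_norm_eq)
qed

lemma sobolev_mono: "m \<le> n \<Longrightarrow> sobolev n \<Omega> \<subseteq> sobolev m \<Omega>"
  by (auto simp: sobolev_def)

lemma sobolev_norm_mono:
  assumes "m \<le> n"
  shows "sobolev_norm m \<Omega> u \<le> sobolev_norm n \<Omega> u"
  unfolding sobolev_norm_def
proof (rule real_sqrt_le_mono, rule sum_mono2)
  show "finite {(p, q). p + q \<le> n}" using finite_multi_indices by (simp add: multi_indices_def)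
qed (use assms in auto)

lemma L2_le_sobolev_norm:
  assumes "u \<in> sobolev n \<Omega>"
  shows "(LINT x|M. (cmod (u x))\<^sup>2) \<le> (sobolev_norm n \<Omega> u)\<^sup>2"
proof -
  have "has_weak_partial \<Omega> (0, 0) u u" using sobolev_L2[OF assms] by (simp add: has_weak_partial_def multi_partial_def)
  from weak_partial_eq[OF this]
  have "(LINT x|M. (cmod (u x))\<^sup>2) = (LINT x|M. (cmod (weak_partial \<Omega> (0, 0) u x))\<^sup>2)"
    using sobolev_L2[OF assms] sobolev_weak_partial_L2[OF assms, of "(0, 0)"]
    by (intro integral_cong_AE) (auto simp: L2_def multi_indices_def)
  also have "\<dots> \<le> (\<Sum>\<beta>\<in>multi_indices n. LINT x|M. (cmod (weak_partial \<Omega> \<beta> u x))\<^sup>2)"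
    by (rule member_le_sum[of "(0, 0)"]) (auto simp: finite_multi_indices, simp add: multi_indices_def)
  also have "\<dots> = (sobolev_norm n \<Omega> u)\<^sup>2"
    by (simp add: sobolev_norm_def multi_indices_def sum_nonneg)
  finally show ?thesis .
qed

end

section \<open>Integration over a parameter\<close>

context sobolev_domain
begin

text \<open>
  Approximate the family by families that are constant in the parameter on the cells of a
  grid, with Borel values; these are jointly measurable. If the grids are refined so fast that the squared errors are
  summable, then for every parameter the approximations converge almost everywhere in \<open>x\<close>.
\<close>

lemma joint_version_exists:
  fixes u :: "real \<Rightarrow> field"
  assumes u: "\<And>\<alpha>. \<alpha> \<in> {a..b} \<Longrightarrow> u \<alpha> \<in> L2 M"
    and cont: "\<And>e. e > 0 \<Longrightarrow> \<exists>\<delta>>0. \<forall>s\<in>{a..b}. \<forall>t\<in>{a..b}. \<bar>s - t\<bar> < \<delta> \<longrightarrow>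
        (LINT x|M. (cmod (u s x - u t x))\<^sup>2) \<le> e"
  shows "\<exists>u'. joint_version {a<..b} \<Omega> u u'"
proof -
  have "\<forall>n::nat. \<exists>\<delta>>0. \<forall>s\<in>{a..b}. \<forall>t\<in>{a..b}. \<bar>s - t\<bar> < \<delta> \<longrightarrow> (LINT x|M. (cmod (u s x - u t x))\<^sup>2) \<le> (1/2) ^ n"
    by (intro allI cont) simp
  from choice[OF this] obtain \<delta> :: "nat \<Rightarrow> real" where
    d: "\<And>n. \<delta> n > 0" "\<And>n s t. s \<in> {a..b} \<Longrightarrow> t \<in> {a..b} \<Longrightarrow> \<bar>s - t\<bar> < \<delta> n \<Longrightarrow> (LINT x|M. (cmod (u s x - u t x))\<^sup>2) \<le> (1/2) ^ n"
    by blast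
  have "\<forall>\<alpha>. \<exists>v. v \<in> borel_measurable borel \<and> (\<alpha> \<in> {a..b} \<longrightarrow> (AE x in M. v x = u \<alpha> x))"
  proof
    fix \<alpha>
    show "\<exists>v. v \<in> borel_measurable borel \<and> (\<alpha> \<in> {a..b} \<longrightarrow> (AE x in M. v x = u \<alpha> x))"
    proof (cases "\<alpha> \<in> {a..b}")
      case True
      then have "u \<alpha> \<in> borel_measurable M" using u by (simp add: L2_def)
      from borel_version[OF this sets] obtain v where "v \<in> borel_measurable borel" "AE x in M. v x = u \<alpha> x" by blast
      then show ?thesis by (intro exI[of _ v] conjI impI)
    next
      case False
      then have "(\<lambda>_. 0 :: complex) \<in> borel_measurable borel \<and> (\<alpha> \<in> {a..b} \<longrightarrow> (AE x in M. (\<lambda>_. 0) x = u \<alpha> x))"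
        by (intro conjI borel_measurable_const impI) blast
      then show ?thesis by (intro exI[of _ "\<lambda>_. 0"])
    qed
  qed
  from choice[OF this] obtain v :: "real \<Rightarrow> field" where
    v: "\<And>\<alpha>. v \<alpha> \<in> borel_measurable borel" "\<And>\<alpha>. \<alpha> \<in> {a..b} \<Longrightarrow> AE x in M. v \<alpha> x = u \<alpha> x" by blast
  \<comment> \<open>Freeze the parameter at the left end of its cell in a grid of mesh \<open>\<delta> n / 2\<close>.\<close>
  define i where "i n \<alpha> = \<lfloor>(\<alpha> - a) / (\<delta> n / 2)\<rfloor>" for n \<alpha>
  define r where "r n j = a + real_of_int j * (\<delta> n / 2)" for n j
  have r: "a \<le> r n (i n \<alpha>) \<and> r n (i n \<alpha>) \<le> \<alpha> \<and> \<alpha> - r n (i n \<alpha>) < \<delta> n" if "\<alpha> \<in> {a<..b}" for n \<alpha>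
  proof -
    let ?q = "(\<alpha> - a) / (\<delta> n / 2)"
    have q: "?q * (\<delta> n / 2) = \<alpha> - a" using d(1)[of n] by simp
    have q0: "0 \<le> ?q" using d(1)[of n] that by simp
    have "real_of_int \<lfloor>?q\<rfloor> * (\<delta> n / 2) \<le> ?q * (\<delta> n / 2)"
      using d(1)[of n] by (intro mult_right_mono) auto
    moreover have "?q * (\<delta> n / 2) \<le> (real_of_int \<lfloor>?q\<rfloor> + 1) * (\<delta> n / 2)"
      using d(1)[of n] by (intro mult_right_mono) linarith+
    moreover have "0 \<le> real_of_int \<lfloor>?q\<rfloor> * (\<delta> n / 2)"
      using d(1)[of n] q0 by (intro mult_nonneg_nonneg) auto
    ultimately show ?thesis using d(1)[of n] unfolding q r_def i_def by (auto simp: algebra_simps)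
  qed
  define w where "w n \<alpha> x = v (r n (i n \<alpha>)) x" for n \<alpha> x
  have wm: "(\<lambda>z. w n (fst z) (snd z)) \<in> borel_measurable borel" for n
    unfolding w_def
  proof (rule measurable_compose_countable[where f = "\<lambda>j z. v (r n j) (snd z)" and g = "\<lambda>z. i n (fst z)"])
    have snd: "(\<lambda>z. snd z) \<in> (borel :: (real \<times> plane) measure) \<rightarrow>\<^sub>M borel"
      and fst: "(\<lambda>z. fst z) \<in> (borel :: (real \<times> plane) measure) \<rightarrow>\<^sub>M borel"
      by (intro borel_measurable_continuous_onI continuous_intros)+
    show "(\<lambda>z. v (r n j) (snd z)) \<in> borel_measurable (borel :: (real \<times> plane) measure)" for j
      by (rule measurable_compose[OF snd v(1)])
    have "i n \<in> borel \<rightarrow>\<^sub>M count_space UNIV" unfolding i_def by measurable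
    then show "(\<lambda>z. i n (fst z)) \<in> (borel :: (real \<times> plane) measure) \<rightarrow>\<^sub>M count_space UNIV"
      by (rule measurable_compose[OF fst])
  qed
  define w' where "w' \<alpha> x = lim (\<lambda>n. w n \<alpha> x)" for \<alpha> x
  have "(\<lambda>z. w' (fst z) (snd z)) \<in> borel_measurable borel"
    unfolding w'_def by (rule borel_measurable_lim_metric[OF wm])
  then have "(\<lambda>(\<alpha>, x). w' \<alpha> x) \<in> borel_measurable borel" by (simp add: case_prod_beta)
  moreover have "AE x in M. w' \<alpha> x = u \<alpha> x" if al: "\<alpha> \<in> {a<..b}" for \<alpha>
  proof -
    have rab: "r n (i n \<alpha>) \<in> {a..b}" for n using r[OF al, of n] al by auto
    have alab: "\<alpha> \<in> {a..b}" using al by auto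
    have um: "u \<beta> \<in> borel_measurable M" if "\<beta> \<in> {a..b}" for \<beta> using u[OF that] by (simp add: L2_def)
    define f where "f n x = (cmod (u (r n (i n \<alpha>)) x - u \<alpha> x))\<^sup>2" for n x
    have fm[measurable]: "f n \<in> borel_measurable M" for n
      unfolding f_def using um[OF rab[of n]] um[OF alab] by measurable
    have fi: "integrable M (f n)" for n
      using L2_lin[OF u[OF rab[of n]] u[OF alab], of 1 "-1"] unfolding f_def L2_def by simp
    have "(\<integral>\<^sup>+x. ennreal (f n x) \<partial>M) \<le> ennreal ((1/2) ^ n)" for n
    proof -
      have "(\<integral>\<^sup>+x. ennreal (f n x) \<partial>M) = ennreal (LINT x|M. f n x)"
        by (rule nn_integral_eq_integral[OF fi]) (simp add: f_def)
      also have "\<dots> \<le> ennreal ((1/2) ^ n)"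
        unfolding f_def using r[OF al, of n] by (intro ennreal_leI d(2) rab alab) auto
      finally show ?thesis .
    qed
    then have "(\<integral>\<^sup>+x. (\<Sum>n. ennreal (f n x)) \<partial>M) \<le> (\<Sum>n. ennreal ((1/2) ^ n))"
      by (subst nn_integral_suminf) (auto intro!: suminf_le)
    also have "\<dots> = ennreal (\<Sum>n. (1/2) ^ n)"
      by (rule suminf_ennreal2) (auto simp: summable_geometric)
    also have "\<dots> < \<infinity>" by simp
    finally have "(\<integral>\<^sup>+x. (\<Sum>n. ennreal (f n x)) \<partial>M) \<noteq> \<infinity>" by simp
    then have "AE x in M. (\<Sum>n. ennreal (f n x)) \<noteq> \<infinity>"
      by (intro nn_integral_PInf_AE) auto
    moreover have "AE x in M. \<forall>n. v (r n (i n \<alpha>)) x = u (r n (i n \<alpha>)) x"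
      using v(2)[OF rab] by (simp add: AE_all_countable)
    ultimately show ?thesis
    proof eventually_elim
      case (elim x)
      have "summable (\<lambda>n. f n x)"
        by (rule summable_suminf_not_top) (use elim in \<open>auto simp: f_def\<close>)
      then have "(\<lambda>n. f n x) \<longlonglongrightarrow> 0" by (rule summable_LIMSEQ_zero)
      then have "(\<lambda>n. sqrt (f n x)) \<longlonglongrightarrow> sqrt 0" by (rule tendsto_real_sqrt)
      then have "(\<lambda>n. w n \<alpha> x - u \<alpha> x) \<longlonglongrightarrow> 0"
        using elim(2) by (simp add: f_def w_def tendsto_norm_zero_iff)
      then have "(\<lambda>n. w n \<alpha> x) \<longlonglongrightarrow> u \<alpha> x" by (simp add: LIM_zero_iff)
      then show ?case unfolding w'_def by (rule limI)
    qed
  qed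
  ultimately show ?thesis unfolding joint_version_def by blast
qed

text \<open>
  Square integrability follows from the Cauchy--Schwarz inequality in the parameter and Tonelli's theorem, the
  exchange of integrals from Fubini's theorem.
\<close>

lemma joint_version_integral:
  assumes ab: "a \<le> b" and jv: "joint_version {a<..b} \<Omega> u u'"
    and u: "\<And>\<alpha>. \<alpha> \<in> {a<..b} \<Longrightarrow> u \<alpha> \<in> L2 M"
    and B: "\<And>\<alpha>. \<alpha> \<in> {a<..b} \<Longrightarrow> (LINT x|M. (cmod (u \<alpha> x))\<^sup>2) \<le> B"
  defines "T \<equiv> restrict_space lborel {a<..b}"
  defines "U \<equiv> \<lambda>x. LINT \<alpha>|T. u' \<alpha> x"
  shows "U \<in> L2 M"
    and "\<psi> \<in> L2 M \<Longrightarrow> (LINT x|M. U x * \<psi> x) = (LINT \<alpha>|T. LINT x|M. u \<alpha> x * \<psi> x)"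
    and "\<psi> \<in> L2 M \<Longrightarrow> integrable T (\<lambda>\<alpha>. LINT x|M. u \<alpha> x * \<psi> x)"
proof -
  have jm: "(\<lambda>(\<alpha>, x). u' \<alpha> x) \<in> borel_measurable borel"
    and jae: "\<And>\<alpha>. \<alpha> \<in> {a<..b} \<Longrightarrow> AE x in M. u' \<alpha> x = u \<alpha> x"
    using jv by (auto simp: joint_version_def)
  have eT: "emeasure T (space T) = ennreal (b - a)"
    using ab by (simp add: T_def emeasure_restrict_space space_restrict_space)
  have sT: "space T = {a<..b}" by (simp add: T_def space_restrict_space)
  interpret T: finite_measure T by (rule finite_measureI) (simp add: eT)
  interpret P: pair_sigma_finite T M ..
  have id1: "(\<lambda>\<alpha>. \<alpha>) \<in> T \<rightarrow>\<^sub>M borel" unfolding T_def by (rule measurable_restrict_space1) simp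
  have id2: "(\<lambda>x. x) \<in> M \<rightarrow>\<^sub>M borel"
    by (rule measurable_restrict_space1) (rule measurable_completion, simp)
  have pm: "(\<lambda>z. u' (fst z) (snd z)) \<in> borel_measurable (T \<Otimes>\<^sub>M M)"
  proof -
    have "(\<lambda>z. (fst z, snd z)) \<in> T \<Otimes>\<^sub>M M \<rightarrow>\<^sub>M (borel \<Otimes>\<^sub>M borel)"
      by (intro measurable_Pair measurable_compose[OF measurable_fst id1] measurable_compose[OF measurable_snd id2])
    then have "(\<lambda>z. (fst z, snd z)) \<in> T \<Otimes>\<^sub>M M \<rightarrow>\<^sub>M borel" by (simp only: borel_prod)
    from measurable_compose[OF this jm] show ?thesis by simp
  qed
  have pm': "(\<lambda>z. u' (snd z) (fst z)) \<in> borel_measurable (M \<Otimes>\<^sub>M T)"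
    using measurable_compose[OF measurable_pair_swap' pm] by (simp add: case_prod_beta)
  have um: "u \<alpha> \<in> borel_measurable M" if "\<alpha> \<in> {a<..b}" for \<alpha> using u[OF that] by (simp add: L2_def)
  have um': "u' \<alpha> \<in> borel_measurable M" if "\<alpha> \<in> {a<..b}" for \<alpha>
    using measurable_compose[OF measurable_Pair1' pm, of \<alpha>] that sT by simp
  have um'': "(\<lambda>\<alpha>. u' \<alpha> x) \<in> borel_measurable T" if "x \<in> \<Omega>" for x
    using measurable_compose[OF measurable_Pair2' pm, of x] that by simp
  have slice: "(\<integral>\<^sup>+x. ennreal ((cmod (u' \<alpha> x))\<^sup>2) \<partial>M) \<le> ennreal B" if "\<alpha> \<in> {a<..b}" for \<alpha>
  proof -
    have "(\<integral>\<^sup>+x. ennreal ((cmod (u' \<alpha> x))\<^sup>2) \<partial>M) = (\<integral>\<^sup>+x. ennreal ((cmod (u \<alpha> x))\<^sup>2) \<partial>M)"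
      by (rule nn_integral_cong_AE) (use jae[OF that] in eventually_elim, simp)
    also have "\<dots> = ennreal (LINT x|M. (cmod (u \<alpha> x))\<^sup>2)"
      by (rule nn_integral_eq_integral) (use u[OF that] in \<open>auto simp: L2_def\<close>)
    finally show ?thesis using B[OF that] by (simp add: ennreal_leI)
  qed
  have total: "(\<integral>\<^sup>+\<alpha>. \<integral>\<^sup>+x. ennreal ((cmod (u' \<alpha> x))\<^sup>2) \<partial>M \<partial>T) < \<infinity>"
  proof -
    have "(\<integral>\<^sup>+\<alpha>. \<integral>\<^sup>+x. ennreal ((cmod (u' \<alpha> x))\<^sup>2) \<partial>M \<partial>T) \<le> (\<integral>\<^sup>+\<alpha>. ennreal B \<partial>T)"
      by (rule nn_integral_mono) (use slice sT in auto)
    also have "\<dots> < \<infinity>" by (simp add: eT ennreal_mult_less_top)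
    finally show ?thesis .
  qed
  have Um: "U \<in> borel_measurable M"
    unfolding U_def by (rule T.borel_measurable_lebesgue_integral) (use pm' in \<open>simp add: case_prod_beta\<close>)
  \<comment> \<open>Cauchy--Schwarz in the parameter, then Tonelli.\<close>
  have pt: "ennreal ((cmod (U x))\<^sup>2) \<le> (\<integral>\<^sup>+\<alpha>. ennreal ((cmod (u' \<alpha> x))\<^sup>2) \<partial>T) * ennreal (b - a)" if x: "x \<in> \<Omega>" for x
  proof -
    have "ennreal (cmod (U x)) \<le> (\<integral>\<^sup>+\<alpha>. ennreal (cmod (u' \<alpha> x)) \<partial>T)"
      unfolding U_def
      by (cases "integrable T (\<lambda>\<alpha>. u' \<alpha> x)") (auto simp: integral_norm_bound_ennreal not_integrable_integral_eq)
    then have "ennreal (cmod (U x)) ^ 2 \<le> (\<integral>\<^sup>+\<alpha>. ennreal (cmod (u' \<alpha> x)) * 1 \<partial>T)\<^sup>2"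
      by (simp add: power_mono)
    also have "\<dots> \<le> (\<integral>\<^sup>+\<alpha>. (ennreal (cmod (u' \<alpha> x)))\<^sup>2 \<partial>T) * (\<integral>\<^sup>+\<alpha>. 1\<^sup>2 \<partial>T)"
      by (rule Cauchy_Schwarz_nn_integral) (use um''[OF x] in auto)
    finally show ?thesis by (simp add: eT ennreal_power)
  qed
  have "(\<integral>\<^sup>+x. ennreal ((cmod (U x))\<^sup>2) \<partial>M) \<le> (\<integral>\<^sup>+x. (\<integral>\<^sup>+\<alpha>. ennreal ((cmod (u' \<alpha> x))\<^sup>2) \<partial>T) * ennreal (b - a) \<partial>M)"
    by (rule nn_integral_mono) (use pt in auto)
  also have "\<dots> = (\<integral>\<^sup>+x. (\<integral>\<^sup>+\<alpha>. ennreal ((cmod (u' \<alpha> x))\<^sup>2) \<partial>T) \<partial>M) * ennreal (b - a)"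
    by (rule nn_integral_multc, rule T.borel_measurable_nn_integral) (use pm' in \<open>simp add: case_prod_beta\<close>)
  also have "(\<integral>\<^sup>+x. (\<integral>\<^sup>+\<alpha>. ennreal ((cmod (u' \<alpha> x))\<^sup>2) \<partial>T) \<partial>M) = (\<integral>\<^sup>+\<alpha>. \<integral>\<^sup>+x. ennreal ((cmod (u' \<alpha> x))\<^sup>2) \<partial>M \<partial>T)"
    by (rule P.Fubini') (use pm in \<open>simp add: case_prod_beta\<close>)
  also have "\<dots> * ennreal (b - a) < \<infinity>" using total by (simp add: ennreal_mult_less_top)
  finally have "integrable M (\<lambda>x. (cmod (U x))\<^sup>2)"
    using Um by (intro integrableI_bounded) auto
  then show UL2: "U \<in> L2 M" using Um by (simp add: L2_def)
  assume psi: "\<psi> \<in> L2 M"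
  then have psim[measurable]: "\<psi> \<in> borel_measurable M" by (simp add: L2_def)
  have pint: "integrable (T \<Otimes>\<^sub>M M) (\<lambda>(\<alpha>, x). u' \<alpha> x * \<psi> x)"
  proof (rule integrableI_bounded)
    show m: "(\<lambda>(\<alpha>, x). u' \<alpha> x * \<psi> x) \<in> borel_measurable (T \<Otimes>\<^sub>M M)"
      unfolding case_prod_beta by (intro borel_measurable_times pm measurable_compose[OF measurable_snd psim])
    have "(\<integral>\<^sup>+z. ennreal (norm (case z of (\<alpha>, x) \<Rightarrow> u' \<alpha> x * \<psi> x)) \<partial>(T \<Otimes>\<^sub>M M)) =
        (\<integral>\<^sup>+\<alpha>. \<integral>\<^sup>+x. ennreal (cmod (u' \<alpha> x * \<psi> x)) \<partial>M \<partial>T)"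
      using m by (subst nn_integral_fst[symmetric]) auto
    also have "\<dots> \<le> (\<integral>\<^sup>+\<alpha>. ennreal B + ennreal (LINT x|M. (cmod (\<psi> x))\<^sup>2) \<partial>T)"
    proof (rule nn_integral_mono)
      fix \<alpha> assume "\<alpha> \<in> space T"
      then have al: "\<alpha> \<in> {a<..b}" by (simp add: sT)
      have "(\<integral>\<^sup>+x. ennreal (cmod (u' \<alpha> x * \<psi> x)) \<partial>M) \<le> (\<integral>\<^sup>+x. ennreal ((cmod (u' \<alpha> x))\<^sup>2) + ennreal ((cmod (\<psi> x))\<^sup>2) \<partial>M)"
      proof (rule nn_integral_mono)
        fix x
        have "0 \<le> (cmod (u' \<alpha> x) - cmod (\<psi> x))\<^sup>2" "0 \<le> cmod (u' \<alpha> x) * cmod (\<psi> x)" by auto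
        then have "cmod (u' \<alpha> x * \<psi> x) \<le> (cmod (u' \<alpha> x))\<^sup>2 + (cmod (\<psi> x))\<^sup>2"
          unfolding power2_diff norm_mult by linarith
        then show "ennreal (cmod (u' \<alpha> x * \<psi> x)) \<le> ennreal ((cmod (u' \<alpha> x))\<^sup>2) + ennreal ((cmod (\<psi> x))\<^sup>2)"
          by (simp add: ennreal_leI flip: ennreal_plus)
      qed
      also have "\<dots> = (\<integral>\<^sup>+x. ennreal ((cmod (u' \<alpha> x))\<^sup>2) \<partial>M) + (\<integral>\<^sup>+x. ennreal ((cmod (\<psi> x))\<^sup>2) \<partial>M)"
        by (rule nn_integral_add) (use um'[OF al] in auto)
      also have "(\<integral>\<^sup>+x. ennreal ((cmod (\<psi> x))\<^sup>2) \<partial>M) = ennreal (LINT x|M. (cmod (\<psi> x))\<^sup>2)"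
        by (rule nn_integral_eq_integral) (use psi in \<open>auto simp: L2_def\<close>)
      finally show "(\<integral>\<^sup>+x. ennreal (cmod (u' \<alpha> x * \<psi> x)) \<partial>M) \<le> ennreal B + ennreal (LINT x|M. (cmod (\<psi> x))\<^sup>2)"
        using slice[OF al] by (meson add_right_mono order_trans)
    qed
    also have "\<dots> < \<infinity>" by (simp add: eT ennreal_mult_less_top)
    finally show "(\<integral>\<^sup>+z. ennreal (norm (case z of (\<alpha>, x) \<Rightarrow> u' \<alpha> x * \<psi> x)) \<partial>(T \<Otimes>\<^sub>M M)) < \<infinity>" .
  qed
  have inner: "(LINT x|M. u' \<alpha> x * \<psi> x) = (LINT x|M. u \<alpha> x * \<psi> x)" if "\<alpha> \<in> {a<..b}" for \<alpha>
  proof (rule integral_cong_AE)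
    show "AE x in M. u' \<alpha> x * \<psi> x = u \<alpha> x * \<psi> x" using jae[OF that] by eventually_elim simp
  qed (use um[OF that] um'[OF that] in auto)
  have "(LINT x|M. U x * \<psi> x) = (LINT x|M. LINT \<alpha>|T. u' \<alpha> x * \<psi> x)" by (simp add: U_def)
  also have "\<dots> = (LINT \<alpha>|T. LINT x|M. u' \<alpha> x * \<psi> x)" by (rule P.Fubini_integral[OF pint])
  also have "\<dots> = (LINT \<alpha>|T. LINT x|M. u \<alpha> x * \<psi> x)"
    by (rule Bochner_Integration.integral_cong[OF refl]) (use inner sT in auto)
  finally show "(LINT x|M. U x * \<psi> x) = (LINT \<alpha>|T. LINT x|M. u \<alpha> x * \<psi> x)" .
  have "integrable T (\<lambda>\<alpha>. LINT x|M. u' \<alpha> x * \<psi> x)"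
    using P.integrable_fst'[OF pint] by simp
  then show "integrable T (\<lambda>\<alpha>. LINT x|M. u \<alpha> x * \<psi> x)"
    by (subst Bochner_Integration.integrable_cong[OF refl, of T _ "\<lambda>\<alpha>. LINT x|M. u' \<alpha> x * \<psi> x"]) (use inner sT in auto)
qed

text \<open>
  The weak derivative of the integral is the integral of a jointly measurable version of the
  weak derivatives: tested against \<open>\<phi>\<close>, both sides are integrals over the parameter.
\<close>

lemma sobolev_integral:
  assumes ab: "a \<le> b" and w: "\<And>\<alpha>. \<alpha> \<in> {a..b} \<Longrightarrow> w \<alpha> \<in> sobolev n \<Omega>"
    and K: "\<And>\<alpha>. \<alpha> \<in> {a..b} \<Longrightarrow> sobolev_norm n \<Omega> (w \<alpha>) \<le> K"
    and cont: "\<And>e. e > 0 \<Longrightarrow> \<exists>\<delta>>0. \<forall>s\<in>{a..b}. \<forall>t\<in>{a..b}. \<bar>s - t\<bar> < \<delta> \<longrightarrow>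
        sobolev_norm n \<Omega> (\<lambda>x. w s x - w t x) \<le> e"
    and jv: "joint_version {a<..b} \<Omega> w w'"
  defines "U \<equiv> \<lambda>x. LINT \<alpha>:{a<..b}|lborel. w' \<alpha> x"
  shows "U \<in> sobolev n \<Omega>"
    and "v \<in> sobolev n \<Omega> \<Longrightarrow> sob_ip n U v = (LINT \<alpha>:{a<..b}|lborel. sob_ip n (w \<alpha>) v)"
proof -
  interpret S: seminormed_family "sobolev n \<Omega>" "sobolev_norm n \<Omega>" by (rule seminormed_sobolev)
  let ?T = "restrict_space lborel {a<..b}"
  have sp: "space ?T = {a<..b}" by (simp add: space_restrict_space)
  have restr: "(LINT \<alpha>:{a<..b}|lborel. f \<alpha>) = (LINT \<alpha>|?T. f \<alpha>)" for f :: "real \<Rightarrow> complex"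
    unfolding set_lebesgue_integral_def by (subst integral_restrict_space) auto
  have ind: "(LINT x|M. (cmod (weak_partial \<Omega> \<beta> u x))\<^sup>2) \<le> (sobolev_norm n \<Omega> u)\<^sup>2" if "\<beta> \<in> multi_indices n" "u \<in> sobolev n \<Omega>" for \<beta> u
  proof -
    have "(LINT x|M. (cmod (weak_partial \<Omega> \<beta> u x))\<^sup>2) \<le> (\<Sum>\<beta>\<in>multi_indices n. LINT x|M. (cmod (weak_partial \<Omega> \<beta> u x))\<^sup>2)"
      by (rule member_le_sum[OF that(1)]) (auto simp: finite_multi_indices)
    also have "\<dots> = (sobolev_norm n \<Omega> u)\<^sup>2"
      unfolding sobolev_norm_def multi_indices_def[symmetric] by (simp add: sum_nonneg)
    finally show ?thesis .
  qed
  have K2: "(sobolev_norm n \<Omega> (w \<alpha>))\<^sup>2 \<le> K\<^sup>2" if "\<alpha> \<in> {a<..b}" for \<alpha>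
    by (rule power_mono[OF K S.norm_nonneg[OF w]]) (use that in auto)
  have L2w: "w \<alpha> \<in> L2 M" if "\<alpha> \<in> {a<..b}" for \<alpha> by (rule sobolev_L2[OF w]) (use that in auto)
  have Bw: "(LINT x|M. (cmod (w \<alpha> x))\<^sup>2) \<le> K\<^sup>2" if "\<alpha> \<in> {a<..b}" for \<alpha>
    by (rule order_trans[OF L2_le_sobolev_norm K2[OF that]]) (use w that in auto)
  note JU = joint_version_integral[OF ab jv L2w Bw, folded restr]
  have UL2: "U \<in> L2 M" unfolding U_def by (rule JU(1))
  have "\<exists>d. joint_version {a<..b} \<Omega> (\<lambda>\<alpha>. weak_partial \<Omega> \<beta> (w \<alpha>)) d" if b: "\<beta> \<in> multi_indices n" for \<beta>
  proof (rule joint_version_exists)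
    show "weak_partial \<Omega> \<beta> (w \<alpha>) \<in> L2 M" if "\<alpha> \<in> {a..b}" for \<alpha>
      by (rule sobolev_weak_partial_L2[OF w[OF that] b])
    fix e :: real assume "e > 0"
    then obtain \<delta> where \<delta>: "\<delta> > 0" "\<And>s t. s \<in> {a..b} \<Longrightarrow> t \<in> {a..b} \<Longrightarrow> \<bar>s - t\<bar> < \<delta> \<Longrightarrow> sobolev_norm n \<Omega> (\<lambda>x. w s x - w t x) \<le> sqrt e"
      using cont[of "sqrt e"] by auto
    have "(LINT x|M. (cmod (weak_partial \<Omega> \<beta> (w s) x - weak_partial \<Omega> \<beta> (w t) x))\<^sup>2) \<le> e"
      if st: "s \<in> {a..b}" "t \<in> {a..b}" "\<bar>s - t\<bar> < \<delta>" for s t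
    proof -
      have "(LINT x|M. (cmod (weak_partial \<Omega> \<beta> (w s) x - weak_partial \<Omega> \<beta> (w t) x))\<^sup>2) =
          (LINT x|M. (cmod (weak_partial \<Omega> \<beta> (\<lambda>x. w s x - w t x) x))\<^sup>2)"
      proof (rule integral_cong_AE)
        show "AE x in M. (cmod (weak_partial \<Omega> \<beta> (w s) x - weak_partial \<Omega> \<beta> (w t) x))\<^sup>2 =
            (cmod (weak_partial \<Omega> \<beta> (\<lambda>x. w s x - w t x) x))\<^sup>2"
          using weak_partial_lin[OF w[OF st(1)] w[OF st(2)] b, of 1 "-1"] by eventually_elim simp
      qed (use sobolev_weak_partial_L2[OF w[OF st(1)] b] sobolev_weak_partial_L2[OF w[OF st(2)] b]
            sobolev_weak_partial_L2[OF S.diff_mem[OF w[OF st(1)] w[OF st(2)]] b] in \<open>auto simp: L2_def\<close>)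
      also have "\<dots> \<le> (sobolev_norm n \<Omega> (\<lambda>x. w s x - w t x))\<^sup>2"
        by (rule ind[OF b S.diff_mem[OF w[OF st(1)] w[OF st(2)]]])
      also have "\<dots> \<le> (sqrt e)\<^sup>2"
        by (rule power_mono[OF \<delta>(2)[OF st] S.norm_nonneg[OF S.diff_mem[OF w[OF st(1)] w[OF st(2)]]]])
      finally show ?thesis using \<open>e > 0\<close> by simp
    qed
    then show "\<exists>\<delta>>0. \<forall>s\<in>{a..b}. \<forall>t\<in>{a..b}. \<bar>s - t\<bar> < \<delta> \<longrightarrow>
        (LINT x|M. (cmod (weak_partial \<Omega> \<beta> (w s) x - weak_partial \<Omega> \<beta> (w t) x))\<^sup>2) \<le> e"
      using \<delta>(1) by blast
  qed
  then have "\<forall>\<beta>\<in>multi_indices n. \<exists>d. joint_version {a<..b} \<Omega> (\<lambda>\<alpha>. weak_partial \<Omega> \<beta> (w \<alpha>)) d" by (rule ballI)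
  from bchoice[OF this] obtain d where
    jd: "\<forall>\<beta>\<in>multi_indices n. joint_version {a<..b} \<Omega> (\<lambda>\<alpha>. weak_partial \<Omega> \<beta> (w \<alpha>)) (d \<beta>)" ..
  define D where "D \<beta> x = (LINT \<alpha>:{a<..b}|lborel. d \<beta> \<alpha> x)" for \<beta> x
  have JD: "D \<beta> \<in> L2 M"
    "\<And>\<psi>. \<psi> \<in> L2 M \<Longrightarrow> (LINT x|M. D \<beta> x * \<psi> x) = (LINT \<alpha>|?T. LINT x|M. weak_partial \<Omega> \<beta> (w \<alpha>) x * \<psi> x)"
    "\<And>\<psi>. \<psi> \<in> L2 M \<Longrightarrow> integrable ?T (\<lambda>\<alpha>. LINT x|M. weak_partial \<Omega> \<beta> (w \<alpha>) x * \<psi> x)"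
    if b: "\<beta> \<in> multi_indices n" for \<beta>
  proof -
    have 1: "weak_partial \<Omega> \<beta> (w \<alpha>) \<in> L2 M" if "\<alpha> \<in> {a<..b}" for \<alpha>
      by (rule sobolev_weak_partial_L2[OF w b]) (use that in auto)
    have 2: "(LINT x|M. (cmod (weak_partial \<Omega> \<beta> (w \<alpha>) x))\<^sup>2) \<le> K\<^sup>2" if "\<alpha> \<in> {a<..b}" for \<alpha>
      by (rule order_trans[OF ind[OF b w] K2[OF that]]) (use that in auto)
    note J = joint_version_integral[OF ab bspec[OF jd b] 1 2]
    show "D \<beta> \<in> L2 M" unfolding D_def restr by (rule J(1))
    show "\<And>\<psi>. \<psi> \<in> L2 M \<Longrightarrow> (LINT x|M. D \<beta> x * \<psi> x) = (LINT \<alpha>|?T. LINT x|M. weak_partial \<Omega> \<beta> (w \<alpha>) x * \<psi> x)"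
      unfolding D_def restr by (rule J(2))
    show "\<And>\<psi>. \<psi> \<in> L2 M \<Longrightarrow> integrable ?T (\<lambda>\<alpha>. LINT x|M. weak_partial \<Omega> \<beta> (w \<alpha>) x * \<psi> x)"
      by (rule J(3))
  qed
  have hwp: "has_weak_partial \<Omega> \<beta> U (D \<beta>)" if b: "\<beta> \<in> multi_indices n" for \<beta>
    unfolding has_weak_partial_def
  proof (intro conjI allI impI JD(1)[OF b])
    fix \<phi> assume t: "test_function \<Omega> \<phi>"
    have "(LINT x|M. U x * multi_partial \<beta> \<phi> x) = (LINT \<alpha>|?T. LINT x|M. w \<alpha> x * multi_partial \<beta> \<phi> x)"
      unfolding U_def restr by (rule joint_version_integral(2)[OF ab jv L2w Bw test_function_L2(1)[OF t]])
    also have "\<dots> = (LINT \<alpha>|?T. (- 1) ^ (fst \<beta> + snd \<beta>) * (LINT x|M. weak_partial \<Omega> \<beta> (w \<alpha>) x * \<phi> x))"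
    proof (rule Bochner_Integration.integral_cong[OF refl])
      fix \<alpha> assume "\<alpha> \<in> space ?T"
      then have "w \<alpha> \<in> sobolev n \<Omega>" using w sp by auto
      from sobolev_weak_partial[OF this b] t
      show "(LINT x|M. w \<alpha> x * multi_partial \<beta> \<phi> x) = (- 1) ^ (fst \<beta> + snd \<beta>) * (LINT x|M. weak_partial \<Omega> \<beta> (w \<alpha>) x * \<phi> x)"
        by (auto simp: has_weak_partial_def)
    qed
    also have "\<dots> = (- 1) ^ (fst \<beta> + snd \<beta>) * (LINT \<alpha>|?T. LINT x|M. weak_partial \<Omega> \<beta> (w \<alpha>) x * \<phi> x)"
      by (rule integral_mult_right_zero)
    also have "(LINT \<alpha>|?T. LINT x|M. weak_partial \<Omega> \<beta> (w \<alpha>) x * \<phi> x) = (LINT x|M. D \<beta> x * \<phi> x)"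
      by (rule JD(2)[OF b test_function_L2(2)[OF t], symmetric])
    finally show "(LINT x|M. U x * multi_partial \<beta> \<phi> x) = (- 1) ^ (fst \<beta> + snd \<beta>) * (LINT x|M. D \<beta> x * \<phi> x)" .
  qed
  show U: "U \<in> sobolev n \<Omega>" unfolding sobolev_iff
    by (intro conjI UL2 ballI exI) (rule hwp)
  assume v: "v \<in> sobolev n \<Omega>"
  have vb: "(\<lambda>x. cnj (weak_partial \<Omega> \<beta> v x)) \<in> L2 M" if "\<beta> \<in> multi_indices n" for \<beta>
    by (rule L2_cnj[OF sobolev_weak_partial_L2[OF v that]])
  have "sob_ip n U v = (\<Sum>\<beta>\<in>multi_indices n. LINT x|M. D \<beta> x * cnj (weak_partial \<Omega> \<beta> v x))"
    by (rule sob_ip_eq[OF v U weak_partial_eq[OF hwp] JD(1)])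
  also have "\<dots> = (\<Sum>\<beta>\<in>multi_indices n. LINT \<alpha>|?T. LINT x|M. weak_partial \<Omega> \<beta> (w \<alpha>) x * cnj (weak_partial \<Omega> \<beta> v x))"
    by (rule sum.cong[OF refl]) (rule JD(2)[OF _ vb])
  also have "\<dots> = (LINT \<alpha>|?T. (\<Sum>\<beta>\<in>multi_indices n. LINT x|M. weak_partial \<Omega> \<beta> (w \<alpha>) x * cnj (weak_partial \<Omega> \<beta> v x)))"
    by (rule Bochner_Integration.integral_sum[symmetric]) (rule JD(3)[OF _ vb])
  finally show "sob_ip n U v = (LINT \<alpha>:{a<..b}|lborel. sob_ip n (w \<alpha>) v)"
    unfolding restr sob_ip_def .
qed

end

section \<open>Functions with zero trace\<close>

lemma smooth_lin:
  assumes "smooth \<phi>" "smooth \<psi>"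
  shows "smooth (\<lambda>x. a * \<phi> x + b * \<psi> x)"
proof -
  have d: "partials bs \<phi> differentiable (at x)" "partials bs \<psi> differentiable (at x)" if "bs \<in> lists Basis" for bs x
    by (rule bspec[OF assms(1)[unfolded smooth_def] that, THEN spec], rule bspec[OF assms(2)[unfolded smooth_def] that, THEN spec])
  have lin: "((\<lambda>y. a * f y + b * g y) has_derivative (\<lambda>h. a * frechet_derivative f (at x) h + b * frechet_derivative g (at x) h)) (at x)"
    if "f differentiable (at x)" "g differentiable (at x)" for f g :: field and x
    using that unfolding frechet_derivative_works
    by (intro has_derivative_add has_derivative_mult_right)
  have "partials bs (\<lambda>x. a * \<phi> x + b * \<psi> x) = (\<lambda>x. a * partials bs \<phi> x + b * partials bs \<psi> x)"
    if "bs \<in> lists Basis" for bs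
    using that
  proof (induction bs)
    case (Cons c bs)
    then have bs: "bs \<in> lists Basis" by simp
    show ?case
      by (simp add: Cons.IH frechet_derivative_at[OF lin[OF d[OF bs]], symmetric])
  qed simp
  then show ?thesis unfolding smooth_def
    by (auto intro!: differentiableI[OF lin[OF d]])
qed

lemma L2_lin_sq:
  assumes "u \<in> L2 M" "v \<in> L2 M"
  shows "(LINT x|M. (cmod (a * u x + b * v x))\<^sup>2) \<le>
    2 * (cmod a)\<^sup>2 * (LINT x|M. (cmod (u x))\<^sup>2) + 2 * (cmod b)\<^sup>2 * (LINT x|M. (cmod (v x))\<^sup>2)"
proof -
  have i: "integrable M (\<lambda>x. (cmod (u x))\<^sup>2)" "integrable M (\<lambda>x. (cmod (v x))\<^sup>2)"
    "integrable M (\<lambda>x. (cmod (a * u x + b * v x))\<^sup>2)"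
    using assms L2_lin[OF assms, of a b] by (auto simp: L2_def)
  have "(LINT x|M. (cmod (a * u x + b * v x))\<^sup>2) \<le> (LINT x|M. 2 * (cmod a)\<^sup>2 * (cmod (u x))\<^sup>2 + 2 * (cmod b)\<^sup>2 * (cmod (v x))\<^sup>2)"
  proof (rule integral_mono)
    fix x
    have "(cmod (a * u x + b * v x))\<^sup>2 \<le> (cmod a * cmod (u x) + cmod b * cmod (v x))\<^sup>2"
      by (intro power_mono order_trans[OF norm_triangle_ineq]) (auto simp: norm_mult)
    also have "\<dots> \<le> 2 * (cmod a * cmod (u x))\<^sup>2 + 2 * (cmod b * cmod (v x))\<^sup>2"
      using zero_le_power2[of "cmod a * cmod (u x) - cmod b * cmod (v x)"]
      unfolding power2_diff power2_sum by linarith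
    finally show "(cmod (a * u x + b * v x))\<^sup>2 \<le> 2 * (cmod a)\<^sup>2 * (cmod (u x))\<^sup>2 + 2 * (cmod b)\<^sup>2 * (cmod (v x))\<^sup>2"
      by (simp add: power_mult_distrib)
  qed (use i in auto)
  also have "\<dots> = 2 * (cmod a)\<^sup>2 * (LINT x|M. (cmod (u x))\<^sup>2) + 2 * (cmod b)\<^sup>2 * (LINT x|M. (cmod (v x))\<^sup>2)"
    using i by (subst Bochner_Integration.integral_add) auto
  finally show ?thesis .
qed

locale periodicity_cell =
  fixes \<Lambda> H :: real and \<zeta> :: "real \<Rightarrow> real"
  assumes period_pos: "\<Lambda> > 0" and profile_continuous: "continuous_on UNIV \<zeta>"
begin

abbreviation "I \<equiv> {- \<Lambda> / 2 <.. \<Lambda> / 2}"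

lemma cell_iff: "x \<in> cell \<Lambda> \<zeta> H \<longleftrightarrow> - \<Lambda> / 2 < fst x \<and> fst x \<le> \<Lambda> / 2 \<and> \<zeta> (fst x) < snd x \<and> snd x < H"
  by (auto simp: cell_def layer_def case_prod_beta)

lemma profile_continuous': "continuous_on S (\<lambda>x::plane. \<zeta> (fst x))"
  by (rule continuous_on_compose2[OF profile_continuous]) (auto intro: continuous_intros)

lemma sobolev_domain_cell: "sobolev_domain (cell \<Lambda> \<zeta> H)"
proof
  have "compact (\<zeta> ` {- \<Lambda> / 2..\<Lambda> / 2})"
    by (intro compact_continuous_image continuous_on_subset[OF profile_continuous]) auto
  from bounded_iff[THEN iffD1, OF compact_imp_bounded[OF this]]
  obtain B where "\<forall>y \<in> \<zeta> ` {- \<Lambda> / 2..\<Lambda> / 2}. norm y \<le> B" ..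
  then have B: "\<bar>\<zeta> s\<bar> \<le> B" if "s \<in> {- \<Lambda> / 2..\<Lambda> / 2}" for s
    using that by simp
  have "cell \<Lambda> \<zeta> H \<subseteq> cbox (- \<Lambda> / 2, - B) (\<Lambda> / 2, H)"
  proof
    fix x assume "x \<in> cell \<Lambda> \<zeta> H"
    then show "x \<in> cbox (- \<Lambda> / 2, - B) (\<Lambda> / 2, H)"
      using B[of "fst x"] by (cases x) (auto simp: cell_iff cbox_Pair_eq)
  qed
  then show "bounded (cell \<Lambda> \<zeta> H)" using bounded_cbox bounded_subset by blast
  have z: "(\<lambda>x::plane. \<zeta> (fst x)) \<in> borel_measurable borel"
    by (rule borel_measurable_continuous_onI[OF profile_continuous'])
  have f: "(\<lambda>x::plane. fst x) \<in> borel_measurable borel" "(\<lambda>x::plane. snd x) \<in> borel_measurable borel"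
    by (intro borel_measurable_continuous_onI continuous_intros)+
  have "{x \<in> space borel. - \<Lambda> / 2 < fst x \<and> fst x \<le> \<Lambda> / 2 \<and> \<zeta> (fst x) < snd x \<and> snd x < H} \<in> sets (borel :: plane measure)"
    using z f by measurable
  moreover have "cell \<Lambda> \<zeta> H = {x \<in> space borel. - \<Lambda> / 2 < fst x \<and> fst x \<le> \<Lambda> / 2 \<and> \<zeta> (fst x) < snd x \<and> snd x < H}"
    by (intro set_eqI) (simp add: cell_iff)
  ultimately have "cell \<Lambda> \<zeta> H \<in> sets borel" by simp
  then show "cell \<Lambda> \<zeta> H \<in> sets lebesgue" by (intro sets_completionI_sets) simp
  let ?O = "{x. - \<Lambda> / 2 < fst x} \<inter> {x. fst x < \<Lambda> / 2} \<inter> {x. \<zeta> (fst x) < snd x} \<inter> {x::plane. snd x < H}"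
  have "open ?O"
    by (intro open_Int open_Collect_less continuous_intros profile_continuous')
  moreover have "?O \<subseteq> cell \<Lambda> \<zeta> H" by (auto simp: cell_iff)
  ultimately have Oi: "?O \<subseteq> interior (cell \<Lambda> \<zeta> H)" by (rule interior_maximal[rotated])
  have sub: "cell \<Lambda> \<zeta> H - interior (cell \<Lambda> \<zeta> H) \<subseteq> {x. x \<bullet> (1, 0) = \<Lambda> / 2}"
  proof (intro subsetI)
    fix x assume "x \<in> cell \<Lambda> \<zeta> H - interior (cell \<Lambda> \<zeta> H)"
    then have "x \<in> cell \<Lambda> \<zeta> H" "x \<notin> ?O" using Oi by blast+
    then show "x \<in> {x. x \<bullet> (1, 0) = \<Lambda> / 2}" by (cases x) (auto simp: cell_iff)
  qed
  have "negligible {x::plane. x \<bullet> (1, 0) = \<Lambda> / 2}"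
    by (rule negligible_standard_hyperplane) (simp add: Basis_prod_def)
  then show "negligible (cell \<Lambda> \<zeta> H - interior (cell \<Lambda> \<zeta> H))" using sub by (rule negligible_subset)
qed

sublocale sobolev_domain "cell \<Lambda> \<zeta> H" by (rule sobolev_domain_cell)

text \<open>
  Needed to split the boundary integral of a linear combination, which would otherwise be
  an integral of a possibly non-integrable function.
\<close>

lemma boundary_values_L2:
  assumes "smooth \<psi>"
  shows "(\<lambda>s. \<psi> (s, \<zeta> s)) \<in> L2 (lebesgue_on I)"
proof -
  interpret I: finite_measure "lebesgue_on I" by (rule finite_measure_lebesgue_on) (rule bounded_set_imp_lmeasurable, auto)
  have c: "continuous_on UNIV (\<lambda>s. \<psi> (s, \<zeta> s))"
    by (rule continuous_on_compose2[OF smooth_continuous[OF assms]]) (auto intro!: continuous_intros profile_continuous)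
  then have "(\<lambda>s. \<psi> (s, \<zeta> s)) \<in> borel_measurable borel" by (rule borel_measurable_continuous_onI)
  then have m[measurable]: "(\<lambda>s. \<psi> (s, \<zeta> s)) \<in> borel_measurable (lebesgue_on I)"
    by (intro measurable_restrict_space1 measurable_completion) simp
  have "compact ((\<lambda>s. \<psi> (s, \<zeta> s)) ` {- \<Lambda> / 2..\<Lambda> / 2})"
    by (intro compact_continuous_image continuous_on_subset[OF c]) auto
  from bounded_iff[THEN iffD1, OF compact_imp_bounded[OF this]]
  obtain B where "\<forall>y \<in> (\<lambda>s. \<psi> (s, \<zeta> s)) ` {- \<Lambda> / 2..\<Lambda> / 2}. norm y \<le> B" ..
  then have B: "cmod (\<psi> (s, \<zeta> s)) \<le> B" if "s \<in> {- \<Lambda> / 2..\<Lambda> / 2}" for s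
    using that by simp
  have "AE s in lebesgue_on I. norm ((cmod (\<psi> (s, \<zeta> s)))\<^sup>2) \<le> B\<^sup>2"
    using B by (intro AE_I2) (auto simp: power_mono)
  then have "integrable (lebesgue_on I) (\<lambda>s. (cmod (\<psi> (s, \<zeta> s)))\<^sup>2)" by (rule I.integrable_const_bound) measurable
  then show ?thesis by (simp only: L2_def m mem_Collect_eq simp_thms)
qed

abbreviation "zero_trace u \<equiv> has_bottom_trace \<zeta> H I u (\<lambda>_. 0)"

lemma zero_trace_iff:
  "zero_trace u \<longleftrightarrow> u \<in> sobolev 1 (cell \<Lambda> \<zeta> H) \<and> (\<exists>\<psi>. (\<forall>j. smooth (\<psi> j) \<and> \<psi> j \<in> sobolev 1 (cell \<Lambda> \<zeta> H)) \<and>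
     (\<lambda>j. sobolev_norm 1 (cell \<Lambda> \<zeta> H) (\<lambda>x. \<psi> j x - u x)) \<longlonglongrightarrow> 0 \<and>
     (\<lambda>j. LINT s|lebesgue_on I. (cmod (\<psi> j (s, \<zeta> s)))\<^sup>2) \<longlonglongrightarrow> 0)"
  by (simp add: has_bottom_trace_def cell_def L2_def)

lemma zero_trace_lin:
  assumes "zero_trace u" "zero_trace v"
  shows "zero_trace (\<lambda>x. a * u x + b * v x)"
proof -
  interpret S: seminormed_family "sobolev 1 (cell \<Lambda> \<zeta> H)" "sobolev_norm 1 (cell \<Lambda> \<zeta> H)" by (rule seminormed_sobolev)
  let ?N = "sobolev_norm 1 (cell \<Lambda> \<zeta> H)" and ?B = "\<lambda>\<psi>. LINT s|lebesgue_on I. (cmod (\<psi> (s, \<zeta> s)))\<^sup>2"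
  from assms obtain \<psi> \<eta> where uv: "u \<in> sobolev 1 (cell \<Lambda> \<zeta> H)" "v \<in> sobolev 1 (cell \<Lambda> \<zeta> H)"
    and p: "\<And>j. smooth (\<psi> j)" "\<And>j. \<psi> j \<in> sobolev 1 (cell \<Lambda> \<zeta> H)" "(\<lambda>j. ?N (\<lambda>x. \<psi> j x - u x)) \<longlonglongrightarrow> 0" "(\<lambda>j. ?B (\<psi> j)) \<longlonglongrightarrow> 0"
    and c: "\<And>j. smooth (\<eta> j)" "\<And>j. \<eta> j \<in> sobolev 1 (cell \<Lambda> \<zeta> H)" "(\<lambda>j. ?N (\<lambda>x. \<eta> j x - v x)) \<longlonglongrightarrow> 0" "(\<lambda>j. ?B (\<eta> j)) \<longlonglongrightarrow> 0"
    unfolding zero_trace_iff by blast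
  have 1: "?N (\<lambda>x. (a * \<psi> j x + b * \<eta> j x) - (a * u x + b * v x)) \<le> cmod a * ?N (\<lambda>x. \<psi> j x - u x) + cmod b * ?N (\<lambda>x. \<eta> j x - v x)" for j
    using S.norm_lin[OF S.diff_mem[OF p(2)[of j] uv(1)] S.diff_mem[OF c(2)[of j] uv(2)], of a b]
    by (simp add: algebra_simps)
  have "(\<lambda>j. ?N (\<lambda>x. (a * \<psi> j x + b * \<eta> j x) - (a * u x + b * v x))) \<longlonglongrightarrow> 0"
  proof (rule tendsto_sandwich[OF _ _ tendsto_const])
    show "(\<lambda>j. cmod a * ?N (\<lambda>x. \<psi> j x - u x) + cmod b * ?N (\<lambda>x. \<eta> j x - v x)) \<longlonglongrightarrow> 0"
      using tendsto_add[OF tendsto_mult_right_zero[OF p(3)] tendsto_mult_right_zero[OF c(3)]] by simp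
    show "eventually (\<lambda>j. 0 \<le> ?N (\<lambda>x. (a * \<psi> j x + b * \<eta> j x) - (a * u x + b * v x))) sequentially"
      by (intro always_eventually allI S.norm_nonneg S.diff_mem S.lin p c uv)
  qed (intro always_eventually allI 1)
  moreover have "(\<lambda>j. ?B (\<lambda>x. a * \<psi> j x + b * \<eta> j x)) \<longlonglongrightarrow> 0"
  proof (rule tendsto_sandwich[OF _ _ tendsto_const])
    show "(\<lambda>j. 2 * (cmod a)\<^sup>2 * ?B (\<psi> j) + 2 * (cmod b)\<^sup>2 * ?B (\<eta> j)) \<longlonglongrightarrow> 0"
      using tendsto_add[OF tendsto_mult_right_zero[OF p(4)] tendsto_mult_right_zero[OF c(4)]] by simp
    show "eventually (\<lambda>j. ?B (\<lambda>x. a * \<psi> j x + b * \<eta> j x) \<le> 2 * (cmod a)\<^sup>2 * ?B (\<psi> j) + 2 * (cmod b)\<^sup>2 * ?B (\<eta> j)) sequentially"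
      by (intro always_eventually allI L2_lin_sq boundary_values_L2 p c)
  qed auto
  ultimately show ?thesis unfolding zero_trace_iff
    by (intro conjI S.lin uv exI[of _ "\<lambda>j x. a * \<psi> j x + b * \<eta> j x"] allI smooth_lin p c)
qed

text \<open>
  A diagonal argument: replace each \<open>u l\<close> by a smooth function that is close to it and has small
  boundary values.
\<close>

lemma zero_trace_limit:
  assumes U: "U \<in> sobolev 1 (cell \<Lambda> \<zeta> H)" and u: "\<And>l::nat. zero_trace (u l)"
    and lim: "(\<lambda>l. sobolev_norm 1 (cell \<Lambda> \<zeta> H) (\<lambda>x. u l x - U x)) \<longlonglongrightarrow> 0"
  shows "zero_trace U"
proof -
  interpret S: seminormed_family "sobolev 1 (cell \<Lambda> \<zeta> H)" "sobolev_norm 1 (cell \<Lambda> \<zeta> H)" by (rule seminormed_sobolev)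
  let ?N = "sobolev_norm 1 (cell \<Lambda> \<zeta> H)" and ?B = "\<lambda>\<psi>. LINT s|lebesgue_on I. (cmod (\<psi> (s, \<zeta> s)))\<^sup>2"
  have "\<exists>\<eta>. smooth \<eta> \<and> \<eta> \<in> sobolev 1 (cell \<Lambda> \<zeta> H) \<and> ?N (\<lambda>x. \<eta> x - u l x) < inverse (real (Suc l)) \<and> ?B \<eta> < inverse (real (Suc l))" for l
  proof -
    from u[of l] obtain \<psi> where p: "\<And>j. smooth (\<psi> j)" "\<And>j. \<psi> j \<in> sobolev 1 (cell \<Lambda> \<zeta> H)"
        "(\<lambda>j. ?N (\<lambda>x. \<psi> j x - u l x)) \<longlonglongrightarrow> 0" "(\<lambda>j. ?B (\<psi> j)) \<longlonglongrightarrow> 0"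
      unfolding zero_trace_iff by blast
    have "0 < inverse (real (Suc l))" by simp
    from eventually_conj[OF order_tendstoD(2)[OF p(3) this] order_tendstoD(2)[OF p(4) this]]
    obtain j where "?N (\<lambda>x. \<psi> j x - u l x) < inverse (real (Suc l)) \<and> ?B (\<psi> j) < inverse (real (Suc l))"
      unfolding eventually_sequentially by blast
    then show ?thesis using p(1,2) by (intro exI[of _ "\<psi> j"]) simp
  qed
  then have "\<forall>l. \<exists>\<eta>. smooth \<eta> \<and> \<eta> \<in> sobolev 1 (cell \<Lambda> \<zeta> H) \<and> ?N (\<lambda>x. \<eta> x - u l x) < inverse (real (Suc l)) \<and> ?B \<eta> < inverse (real (Suc l))" ..
  from choice[OF this] obtain \<eta> where
    c: "\<And>l. smooth (\<eta> l)" "\<And>l. \<eta> l \<in> sobolev 1 (cell \<Lambda> \<zeta> H)"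
      "\<And>l. ?N (\<lambda>x. \<eta> l x - u l x) < inverse (real (Suc l))" "\<And>l. ?B (\<eta> l) < inverse (real (Suc l))"
    by blast
  have us: "u l \<in> sobolev 1 (cell \<Lambda> \<zeta> H)" for l using u[of l] unfolding zero_trace_iff by blast
  have 1: "?N (\<lambda>x. \<eta> l x - U x) \<le> inverse (real (Suc l)) + ?N (\<lambda>x. u l x - U x)" for l
  proof -
    have "?N (\<lambda>x. \<eta> l x - U x) = ?N (\<lambda>x. (\<eta> l x - u l x) + (u l x - U x))" by simp
    also have "\<dots> \<le> ?N (\<lambda>x. \<eta> l x - u l x) + ?N (\<lambda>x. u l x - U x)"
      by (rule S.norm_add[OF S.diff_mem[OF c(2) us] S.diff_mem[OF us U]])
    finally show ?thesis using c(3)[of l] by linarith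
  qed
  have "(\<lambda>l. ?N (\<lambda>x. \<eta> l x - U x)) \<longlonglongrightarrow> 0"
  proof (rule tendsto_sandwich[OF _ _ tendsto_const])
    show "(\<lambda>l. inverse (real (Suc l)) + ?N (\<lambda>x. u l x - U x)) \<longlonglongrightarrow> 0"
      using tendsto_add[OF LIMSEQ_inverse_real_of_nat lim] by simp
    show "eventually (\<lambda>l. 0 \<le> ?N (\<lambda>x. \<eta> l x - U x)) sequentially"
      by (intro always_eventually allI S.norm_nonneg S.diff_mem c U)
  qed (intro always_eventually allI 1)
  moreover have "(\<lambda>l. ?B (\<eta> l)) \<longlonglongrightarrow> 0"
  proof (rule tendsto_sandwich[OF _ _ tendsto_const LIMSEQ_inverse_real_of_nat])
    show "eventually (\<lambda>l. ?B (\<eta> l) \<le> inverse (real (Suc l))) sequentially"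
      using c(4) by (intro always_eventually allI less_imp_le)
  qed auto
  ultimately show ?thesis unfolding zero_trace_iff using U c by blast
qed

lemma S_space_iff: "u \<in> S_space \<Lambda> \<zeta> H n zt \<longleftrightarrow> u \<in> sobolev n (cell \<Lambda> \<zeta> H) \<and> (zt \<and> n \<ge> 1 \<longrightarrow> zero_trace u)"
  by (simp add: S_space_def layer_space_def cell_def)

lemma S_space_sobolev: "S_space \<Lambda> \<zeta> H n zt \<subseteq> sobolev n (cell \<Lambda> \<zeta> H)"
  by (auto simp: S_space_iff)

lemma seminormed_S_space: "seminormed_family (S_space \<Lambda> \<zeta> H n zt) (S_norm \<Lambda> \<zeta> H n)"
  unfolding S_norm_def
proof (rule seminormed_family.subfamily[OF seminormed_sobolev S_space_sobolev])
  fix u v a b assume "u \<in> S_space \<Lambda> \<zeta> H n zt" "v \<in> S_space \<Lambda> \<zeta> H n zt"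
  then show "(\<lambda>x. a * u x + b * v x) \<in> S_space \<Lambda> \<zeta> H n zt"
    unfolding S_space_iff using sobolev_lin zero_trace_lin by blast
qed

text \<open>
  For the zero trace only the first-order part of the norm is needed, which the norm of order
  \<open>n\<close> dominates. The exact transform will be such a limit.
\<close>

lemma S_space_limit:
  assumes U: "U \<in> sobolev n (cell \<Lambda> \<zeta> H)" and u: "\<And>l::nat. u l \<in> S_space \<Lambda> \<zeta> H n zt"
    and lim: "(\<lambda>l. S_norm \<Lambda> \<zeta> H n (\<lambda>x. u l x - U x)) \<longlonglongrightarrow> 0"
  shows "U \<in> S_space \<Lambda> \<zeta> H n zt"
  unfolding S_space_iff
proof (intro conjI U impI)
  assume z: "zt \<and> n \<ge> 1"
  interpret S: seminormed_family "sobolev 1 (cell \<Lambda> \<zeta> H)" "sobolev_norm 1 (cell \<Lambda> \<zeta> H)" by (rule seminormed_sobolev)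
  have u': "zero_trace (u l)" for l using u[of l] z by (simp add: S_space_iff)
  have U1: "U \<in> sobolev 1 (cell \<Lambda> \<zeta> H)" using U sobolev_mono z by blast
  have us: "u l \<in> sobolev 1 (cell \<Lambda> \<zeta> H)" for l using u'[of l] unfolding zero_trace_iff by blast
  show "zero_trace U"
  proof (rule zero_trace_limit[OF U1 u'])
    show "(\<lambda>l. sobolev_norm 1 (cell \<Lambda> \<zeta> H) (\<lambda>x. u l x - U x)) \<longlonglongrightarrow> 0"
    proof (rule tendsto_sandwich[OF _ _ tendsto_const lim])
      show "eventually (\<lambda>l. 0 \<le> sobolev_norm 1 (cell \<Lambda> \<zeta> H) (\<lambda>x. u l x - U x)) sequentially"
        by (intro always_eventually allI S.norm_nonneg S.diff_mem us U1)
      show "eventually (\<lambda>l. sobolev_norm 1 (cell \<Lambda> \<zeta> H) (\<lambda>x. u l x - U x) \<le> S_norm \<Lambda> \<zeta> H n (\<lambda>x. u l x - U x)) sequentially"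
        unfolding S_norm_def by (intro always_eventually allI sobolev_norm_mono) (use z in simp)
    qed
  qed
qed

end

section \<open>Functions of class \<open>C\<^sup>n\<close> on an interval\<close>

text \<open>
  Recursion on the order, so that the rules for products, powers and compositions are short inductions. Derivatives at the ends of an interval are one-sided.
\<close>

primrec C_diff :: "nat \<Rightarrow> real set \<Rightarrow> (real \<Rightarrow> real) \<Rightarrow> bool" where
  "C_diff 0 I c \<longleftrightarrow> continuous_on I c"
| "C_diff (Suc n) I c \<longleftrightarrow> (\<exists>c'. C_diff n I c' \<and> (\<forall>t\<in>I. (c has_real_derivative c' t) (at t within I)))"

lemma C_diff_continuous: "C_diff n I c \<Longrightarrow> continuous_on I c"
  by (cases n) (auto intro: DERIV_continuous_on)

lemma C_diff_Suc: "C_diff (Suc n) I c \<Longrightarrow> C_diff n I c"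
proof (induction n arbitrary: c)
  case 0 then show ?case using C_diff_continuous[of 1] by simp
next
  case (Suc n) then show ?case by (metis C_diff.simps(2))
qed

lemma C_diff_cong:
  assumes "C_diff n I c" "\<And>t. t \<in> I \<Longrightarrow> c t = d t"
  shows "C_diff n I d"
proof (cases n)
  case 0 then show ?thesis using assms continuous_on_cong[of I I c d] by simp
next
  case (Suc m)
  then obtain c' where "C_diff m I c'" "\<forall>t\<in>I. (c has_real_derivative c' t) (at t within I)" using assms by auto
  then show ?thesis using Suc assms(2)
    by (auto intro!: exI[of _ c'] intro: has_field_derivative_transform_within[of c _ _ I 1 d])
qed

lemma C_diff_const: "C_diff n I (\<lambda>_. r)"
proof (induction n arbitrary: r)
  case (Suc n) then show ?case by (auto intro!: exI[of _ "\<lambda>_. 0"])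
qed simp

lemma C_diff_add: "C_diff n I c \<Longrightarrow> C_diff n I d \<Longrightarrow> C_diff n I (\<lambda>t. c t + d t)"
proof (induction n arbitrary: c d)
  case 0 then show ?case by (auto intro: continuous_intros)
next
  case (Suc n)
  then obtain c' d' where "C_diff n I c'" "\<forall>t\<in>I. (c has_real_derivative c' t) (at t within I)"
      "C_diff n I d'" "\<forall>t\<in>I. (d has_real_derivative d' t) (at t within I)" by auto
  then show ?case by (auto intro!: exI[of _ "\<lambda>t. c' t + d' t"] Suc.IH derivative_intros)
qed

lemma C_diff_mult: "C_diff n I c \<Longrightarrow> C_diff n I d \<Longrightarrow> C_diff n I (\<lambda>t. c t * d t)"
proof (induction n arbitrary: c d)
  case 0 then show ?case by (auto intro: continuous_intros)
next
  case (Suc n)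
  then obtain c' d' where "C_diff n I c'" "\<forall>t\<in>I. (c has_real_derivative c' t) (at t within I)"
      "C_diff n I d'" "\<forall>t\<in>I. (d has_real_derivative d' t) (at t within I)" by auto
  then show ?case using Suc.prems[THEN C_diff_Suc]
    by (auto intro!: exI[of _ "\<lambda>t. c t * d' t + c' t * d t"] C_diff_add Suc.IH DERIV_mult')
qed

text \<open>
  The induction needs arbitrary exponents, since each derivative lowers the exponent by one.
\<close>

lemma C_diff_powr:
  assumes "C_diff n I c" "\<And>t. t \<in> I \<Longrightarrow> c t > 0"
  shows "C_diff n I (\<lambda>t. c t powr r)"
  using assms
proof (induction n arbitrary: c r)
  case 0
  then have "\<forall>t\<in>I. c t \<noteq> 0" by force
  then show ?case using 0 continuous_on_powr[of I c "\<lambda>_. r"] by simp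
next
  case (Suc n)
  then obtain c' where c: "C_diff n I c'" "\<forall>t\<in>I. (c has_real_derivative c' t) (at t within I)" by auto
  have "((\<lambda>t. c t powr r) has_real_derivative (r * (c t powr (r - 1))) * c' t) (at t within I)" if "t \<in> I" for t
    using DERIV_chain2[OF has_real_derivative_powr[of "c t" r] bspec[OF c(2) that]] Suc.prems(2)[OF that] by simp
  moreover have "C_diff n I (\<lambda>t. (r * (c t powr (r - 1))) * c' t)"
    by (intro C_diff_mult C_diff_const Suc.IH c Suc.prems C_diff_Suc[OF Suc.prems(1)])
  ultimately show ?case by auto
qed

lemma C_diff_sqrt:
  assumes "C_diff n I c" "\<And>t. t \<in> I \<Longrightarrow> c t > 0"
  shows "C_diff n I (\<lambda>t. sqrt (c t))"
  by (rule C_diff_cong[OF C_diff_powr[OF assms, of "1/2"]]) (use assms in \<open>auto simp: powr_half_sqrt less_imp_le\<close>)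

lemma C_diff_subset: "C_diff n I c \<Longrightarrow> J \<subseteq> I \<Longrightarrow> C_diff n J c"
proof (induction n arbitrary: c)
  case 0 then show ?case by (auto intro: continuous_on_subset)
next
  case (Suc n)
  then obtain c' where "C_diff n I c'" "\<forall>t\<in>I. (c has_real_derivative c' t) (at t within I)" by auto
  then show ?case using Suc by (auto intro!: exI[of _ c'] intro: DERIV_subset)
qed

lemma C_diff_chain:
  assumes "\<And>j t. t \<in> I \<Longrightarrow> (D j has_real_derivative D (Suc j) t) (at t within I)"
  shows "C_diff n I (D i)"
proof (induction n arbitrary: i)
  case 0 then show ?case using assms by (auto intro: DERIV_continuous_on)
next
  case (Suc n) then show ?case using assms by (auto intro!: exI[of _ "D (Suc i)"])
qed

lemma real_smooth_C_diff:
  assumes "real_smooth_on I f"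
  shows "C_diff n I f"
proof -
  from assms obtain D where D: "\<forall>t \<in> I. D 0 t = f t"
     "\<forall>j. \<forall>t \<in> I. (D j has_real_derivative D (Suc j) t) (at t within I)"
    unfolding real_smooth_on_def by blast
  show ?thesis by (rule C_diff_cong[of n I "D 0"]) (use D in \<open>auto intro!: C_diff_chain\<close>)
qed

lemma C_diff_affine:
  assumes "C_diff n J c" "(\<lambda>t. p + q * t) ` I \<subseteq> J"
  shows "C_diff n I (\<lambda>t. c (p + q * t))"
  using assms(1)
proof (induction n arbitrary: c)
  case 0
  then show ?case using assms(2) by (auto intro!: continuous_on_compose2[of J c] continuous_intros)
next
  case (Suc n)
  then obtain c' where c: "C_diff n J c'" "\<forall>t\<in>J. (c has_real_derivative c' t) (at t within J)" by auto
  have "((\<lambda>t. c (p + q * t)) has_real_derivative c' (p + q * t) * q) (at t within I)" if "t \<in> I" for t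
  proof -
    have 1: "(c has_real_derivative c' (p + q * t)) (at (p + q * t) within (\<lambda>t. p + q * t) ` I)"
      using c(2) assms(2) that by (intro DERIV_subset[OF _ assms(2)]) auto
    have "((\<lambda>t. p + q * t) has_real_derivative q) (at t within I)" by (auto intro!: derivative_eq_intros)
    from DERIV_image_chain[OF 1 this] show ?thesis by (simp add: o_def)
  qed
  moreover have "C_diff n I (\<lambda>t. c' (p + q * t) * q)" by (intro C_diff_mult C_diff_const Suc.IH c)
  ultimately show ?case by auto
qed

text \<open>
  On the overlap the derivatives from both sides agree, because they are limits at interior points.
\<close>

lemma C_diff_glue:
  assumes "C_diff n {a..<m} c" "C_diff n {l<..b} c" "a < l" "l < m" "m < b"
  shows "C_diff n {a..b} c"
  using assms(1,2)
proof (induction n arbitrary: c)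
  case 0
  have "continuous_on ({a..<m} \<union> {l<..b}) c"
  proof (rule continuous_on_Un_local_open)
    show "openin (top_of_set ({a..<m} \<union> {l<..b})) {a..<m}"
      unfolding openin_open by (rule exI[of _ "{..<m}"]) (use assms in auto)
    show "openin (top_of_set ({a..<m} \<union> {l<..b})) {l<..b}"
      unfolding openin_open by (rule exI[of _ "{l<..}"]) (use assms in auto)
  qed (use 0 in auto)
  moreover have "{a..<m} \<union> {l<..b} = {a..b}" using assms by auto
  ultimately show ?case by simp
next
  case (Suc n)
  then obtain c1 c2 where c1: "C_diff n {a..<m} c1" "\<forall>t\<in>{a..<m}. (c has_real_derivative c1 t) (at t within {a..<m})"
    and c2: "C_diff n {l<..b} c2" "\<forall>t\<in>{l<..b}. (c has_real_derivative c2 t) (at t within {l<..b})" by auto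
  have eq: "c1 t = c2 t" if t: "t \<in> {l<..<m}" for t
  proof -
    have at: "at t within {l<..<m} = at t" by (rule at_within_open[OF t]) simp
    have "(c has_real_derivative c1 t) (at t within {l<..<m})"
      by (rule DERIV_subset[OF bspec[OF c1(2)]]) (use t assms in auto)
    moreover have "(c has_real_derivative c2 t) (at t within {l<..<m})"
      by (rule DERIV_subset[OF bspec[OF c2(2)]]) (use t assms in auto)
    ultimately show ?thesis unfolding at by (rule DERIV_unique)
  qed
  define c' where "c' t = (if t < m then c1 t else c2 t)" for t
  have "C_diff n {a..<m} c'" by (rule C_diff_cong[OF c1(1)]) (simp add: c'_def)
  moreover have "C_diff n {l<..b} c'" by (rule C_diff_cong[OF c2(1)]) (use eq in \<open>auto simp: c'_def\<close>)
  ultimately have "C_diff n {a..b} c'" by (rule Suc.IH)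
  moreover have "(c has_real_derivative c' t) (at t within {a..b})" if t: "t \<in> {a..b}" for t
  proof (cases "t < m")
    case True
    have "at t within {a..b} = at t within {a..<m}"
      by (rule at_within_nhd[of _ "{..<m}"]) (use True t assms in auto)
    then show ?thesis using c1(2) True t by (auto simp: c'_def)
  next
    case False
    have "at t within {a..b} = at t within {l<..b}"
      by (rule at_within_nhd[of _ "{l<..}"]) (use False t assms in auto)
    then show ?thesis using c2(2) False t assms by (auto simp: c'_def)
  qed
  ultimately show ?case by auto
qed

section \<open>Families of class \<open>C\<^sup>n\<close> with values in a seminormed space\<close>

context seminormed_family
begin

definition vlim :: "real set \<Rightarrow> (real \<Rightarrow> field) \<Rightarrow> field \<Rightarrow> real \<Rightarrow> bool" where
  "vlim I f l t \<longleftrightarrow> ((\<lambda>s. N (\<lambda>x. f s x - l x)) \<longlongrightarrow> 0) (at t within I)"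

definition vderiv :: "real set \<Rightarrow> (real \<Rightarrow> field) \<Rightarrow> field \<Rightarrow> real \<Rightarrow> bool" where
  "vderiv I f l t \<longleftrightarrow> ((\<lambda>s. N (\<lambda>x. (f s x - f t x) / of_real (s - t) - l x)) \<longlongrightarrow> 0) (at t within I)"

text \<open>
  The recursive counterpart of \<open>derivative_chain\<close>: the product rule and the chain rule become inductions on
  the order.
\<close>

primrec C_fam :: "nat \<Rightarrow> real set \<Rightarrow> (real \<Rightarrow> field) \<Rightarrow> bool" where
  "C_fam 0 I f \<longleftrightarrow> (\<forall>t\<in>I. f t \<in> V \<and> vlim I f (f t) t)"
| "C_fam (Suc n) I f \<longleftrightarrow> (\<forall>t\<in>I. f t \<in> V \<and> vlim I f (f t) t) \<and>
     (\<exists>f'. C_fam n I f' \<and> (\<forall>t\<in>I. vderiv I f (f' t) t))"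

lemma C_fam_0: "C_fam n I f \<Longrightarrow> C_fam 0 I f"
  by (cases n) auto

lemma C_fam_mem: "C_fam n I f \<Longrightarrow> t \<in> I \<Longrightarrow> f t \<in> V"
  using C_fam_0 by auto

lemma C_fam_vlim: "C_fam n I f \<Longrightarrow> t \<in> I \<Longrightarrow> vlim I f (f t) t"
  using C_fam_0 by auto

lemma C_fam_Suc: "C_fam (Suc n) I f \<Longrightarrow> C_fam n I f"
proof (induction n arbitrary: f)
  case 0 then show ?case by simp
next
  case (Suc n)
  from Suc.prems obtain f' where "C_fam (Suc n) I f'" "\<forall>t\<in>I. vderiv I f (f' t) t" by auto
  then show ?case using Suc.IH[of f'] C_fam_0[OF Suc.prems] by auto
qed

lemma tendsto_0_le:
  assumes "(g \<longlongrightarrow> 0) F" "eventually (\<lambda>s. 0 \<le> f s \<and> f s \<le> g s) F"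
  shows "(f \<longlongrightarrow> (0::real)) F"
  by (rule tendsto_sandwich[OF _ _ tendsto_const assms(1)]) (use assms(2) in \<open>auto elim: eventually_mono\<close>)

lemma eventually_at_within_mem: "eventually (\<lambda>s. s \<in> I \<and> s \<noteq> t) (at t within I)"
  by (simp add: eventually_at_filter)

lemma quotient_mem:
  assumes "f \<in> V" "g \<in> V" "l \<in> V"
  shows "(\<lambda>x. (f x - g x) / r - l x) \<in> V"
  using diff_mem[OF scale_mem[OF diff_mem[OF assms(1,2)], of "1 / r"] assms(3)] by simp

text \<open>
  Changing a family by elements of seminorm zero does not affect differentiability. Since
  functions that agree almost everywhere have difference of seminorm zero, this justifies computing with
  representatives.
\<close>

lemma C_fam_cong:
  assumes f: "C_fam n I f" and g: "\<And>t. t \<in> I \<Longrightarrow> g t \<in> V"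
    and null: "\<And>t. t \<in> I \<Longrightarrow> N (\<lambda>x. g t x - f t x) = 0"
  shows "C_fam n I g"
proof -
  have 0: "g t \<in> V \<and> vlim I g (g t) t" if t: "t \<in> I" for t
    unfolding vlim_def
  proof (intro conjI g[OF t] tendsto_0_le[OF C_fam_vlim[OF f t, unfolded vlim_def]])
    show "eventually (\<lambda>s. 0 \<le> N (\<lambda>x. g s x - g t x) \<and> N (\<lambda>x. g s x - g t x) \<le> N (\<lambda>x. f s x - f t x)) (at t within I)"
      using eventually_at_within_mem
    proof eventually_elim
      case (elim s)
      then have s: "s \<in> I" by simp
      have "N (\<lambda>x. g s x - g t x) = N (\<lambda>x. ((g s x - f s x) - (g t x - f t x)) + (f s x - f t x))"
        by (simp add: algebra_simps)
      also have "\<dots> \<le> N (\<lambda>x. (g s x - f s x) - (g t x - f t x)) + N (\<lambda>x. f s x - f t x)"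
        by (intro norm_add diff_mem g C_fam_mem[OF f] s t)
      also have "N (\<lambda>x. (g s x - f s x) - (g t x - f t x)) \<le> N (\<lambda>x. g s x - f s x) + N (\<lambda>x. g t x - f t x)"
        by (intro norm_diff diff_mem g C_fam_mem[OF f] s t)
      finally show ?case using null s t norm_nonneg[OF diff_mem[OF g[OF s] g[OF t]]] by simp
    qed
  qed
  show ?thesis
  proof (cases n)
    case 0 then show ?thesis using \<open>\<And>t. t \<in> I \<Longrightarrow> g t \<in> V \<and> vlim I g (g t) t\<close> by simp
  next
    case (Suc m)
    then obtain f' where f': "C_fam m I f'" "\<And>t. t \<in> I \<Longrightarrow> vderiv I f (f' t) t" using f by auto
    have "vderiv I g (f' t) t" if t: "t \<in> I" for t
      unfolding vderiv_def
    proof (rule tendsto_0_le[OF f'(2)[OF t, unfolded vderiv_def]])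
      show "eventually (\<lambda>s. 0 \<le> N (\<lambda>x. (g s x - g t x) / of_real (s - t) - f' t x) \<and>
          N (\<lambda>x. (g s x - g t x) / of_real (s - t) - f' t x) \<le> N (\<lambda>x. (f s x - f t x) / of_real (s - t) - f' t x)) (at t within I)"
        using eventually_at_within_mem
      proof eventually_elim
        case (elim s)
        then have s: "s \<in> I" by simp
        let ?r = "complex_of_real (s - t)"
        have "N (\<lambda>x. (g s x - g t x) / ?r - f' t x) =
            N (\<lambda>x. (1 / ?r) * ((g s x - f s x) - (g t x - f t x)) + ((f s x - f t x) / ?r - f' t x))"
          by (simp add: algebra_simps diff_divide_distrib add_divide_distrib)
        also have "\<dots> \<le> N (\<lambda>x. (1 / ?r) * ((g s x - f s x) - (g t x - f t x))) + N (\<lambda>x. (f s x - f t x) / ?r - f' t x)"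
          by (intro norm_add scale_mem quotient_mem diff_mem g C_fam_mem[OF f] C_fam_mem[OF f'(1)] s t)
        also have "N (\<lambda>x. (1 / ?r) * ((g s x - f s x) - (g t x - f t x))) \<le> cmod (1 / ?r) * N (\<lambda>x. (g s x - f s x) - (g t x - f t x))"
          by (intro norm_scale_le diff_mem g C_fam_mem[OF f] s t)
        also have "N (\<lambda>x. (g s x - f s x) - (g t x - f t x)) \<le> N (\<lambda>x. g s x - f s x) + N (\<lambda>x. g t x - f t x)"
          by (intro norm_diff diff_mem g C_fam_mem[OF f] s t)
        finally have "N (\<lambda>x. (g s x - g t x) / ?r - f' t x) \<le> N (\<lambda>x. (f s x - f t x) / ?r - f' t x)"
          using null s t by (simp add: mult_left_mono)
        then show ?case using norm_nonneg[OF quotient_mem[OF g[OF s] g[OF t] C_fam_mem[OF f'(1) t]]] by simp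
      qed
    qed
    then show ?thesis using Suc 0 f'(1) by auto
  qed
qed

lemma vlim_lin:
  assumes mem: "\<And>s. s \<in> I \<Longrightarrow> f s \<in> V" "\<And>s. s \<in> I \<Longrightarrow> g s \<in> V" "k \<in> V" "l \<in> V"
    and lim: "vlim I f k t" "vlim I g l t"
  shows "vlim I (\<lambda>s x. a * f s x + b * g s x) (\<lambda>x. a * k x + b * l x) t"
  unfolding vlim_def
proof (rule tendsto_0_le)
  show "((\<lambda>s. cmod a * N (\<lambda>x. f s x - k x) + cmod b * N (\<lambda>x. g s x - l x)) \<longlongrightarrow> 0) (at t within I)"
    using tendsto_add[OF tendsto_mult_right_zero[OF lim(1)[unfolded vlim_def]] tendsto_mult_right_zero[OF lim(2)[unfolded vlim_def]]] by simp
  show "\<forall>\<^sub>F s in at t within I. 0 \<le> N (\<lambda>x. a * f s x + b * g s x - (a * k x + b * l x)) \<and>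
      N (\<lambda>x. a * f s x + b * g s x - (a * k x + b * l x)) \<le> cmod a * N (\<lambda>x. f s x - k x) + cmod b * N (\<lambda>x. g s x - l x)"
    using eventually_at_within_mem
  proof eventually_elim
    case (elim s)
    then have s: "s \<in> I" by simp
    have "N (\<lambda>x. a * f s x + b * g s x - (a * k x + b * l x)) = N (\<lambda>x. a * (f s x - k x) + b * (g s x - l x))"
      by (simp add: algebra_simps)
    also have "\<dots> \<le> cmod a * N (\<lambda>x. f s x - k x) + cmod b * N (\<lambda>x. g s x - l x)"
      by (intro norm_lin diff_mem mem s)
    finally show ?case using norm_nonneg[OF diff_mem[OF lin[OF mem(1)[OF s] mem(2)[OF s]] lin[OF mem(3,4)]]] by blast
  qed
qed

text \<open>A difference quotient is a family in its own right, so rules for derivatives follow from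
  rules for limits.\<close>

lemma vderiv_iff: "vderiv I f l t \<longleftrightarrow> vlim I (\<lambda>s x. (f s x - f t x) / of_real (s - t)) l t"
  by (simp add: vderiv_def vlim_def)

lemma C_fam_lin: "C_fam n I f \<Longrightarrow> C_fam n I g \<Longrightarrow> C_fam n I (\<lambda>t x. a * f t x + b * g t x)"
proof (induction n arbitrary: f g)
  case 0 then show ?case by (auto intro!: lin vlim_lin)
next
  case (Suc n)
  from Suc.prems obtain f' g' where
    f: "C_fam n I f'" "\<And>t. t \<in> I \<Longrightarrow> vderiv I f (f' t) t" and g: "C_fam n I g'" "\<And>t. t \<in> I \<Longrightarrow> vderiv I g (g' t) t"
    by auto
  have "vderiv I (\<lambda>t x. a * f t x + b * g t x) (\<lambda>x. a * f' t x + b * g' t x) t" if t: "t \<in> I" for t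
  proof -
    have "vlim I (\<lambda>s x. a * ((f s x - f t x) / of_real (s - t)) + b * ((g s x - g t x) / of_real (s - t))) (\<lambda>x. a * f' t x + b * g' t x) t"
    proof (rule vlim_lin)
      show "(\<lambda>x. (f s x - f t x) / complex_of_real (s - t)) \<in> V" if "s \<in> I" for s
        using scale_mem[OF diff_mem[OF C_fam_mem[OF Suc.prems(1) that] C_fam_mem[OF Suc.prems(1) t]], of "1 / of_real (s - t)"] by simp
      show "(\<lambda>x. (g s x - g t x) / complex_of_real (s - t)) \<in> V" if "s \<in> I" for s
        using scale_mem[OF diff_mem[OF C_fam_mem[OF Suc.prems(2) that] C_fam_mem[OF Suc.prems(2) t]], of "1 / of_real (s - t)"] by simp
    qed (use C_fam_mem[OF f(1) t] C_fam_mem[OF g(1) t] f(2)[OF t] g(2)[OF t] in \<open>auto simp: vderiv_iff\<close>)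
    then show ?thesis unfolding vderiv_iff by (simp add: algebra_simps diff_divide_distrib add_divide_distrib)
  qed
  moreover have "C_fam n I (\<lambda>t x. a * f' t x + b * g' t x)" by (rule Suc.IH[OF f(1) g(1)])
  moreover have "\<forall>t\<in>I. (\<lambda>x. a * f t x + b * g t x) \<in> V \<and> vlim I (\<lambda>t x. a * f t x + b * g t x) (\<lambda>x. a * f t x + b * g t x) t"
    using C_fam_0[OF Suc.prems(1)] C_fam_0[OF Suc.prems(2)] by (auto intro!: lin vlim_lin)
  ultimately show ?case by auto
qed

lemma vlim_scale:
  assumes mem: "\<And>s. s \<in> I \<Longrightarrow> f s \<in> V" "l \<in> V" and lim: "vlim I f l t" and c: "(c \<longlongrightarrow> r) (at t within I)"
  shows "vlim I (\<lambda>s x. of_real (c s) * f s x) (\<lambda>x. of_real r * l x) t"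
  unfolding vlim_def
proof (rule tendsto_0_le)
  have "((\<lambda>s. \<bar>c s\<bar> * N (\<lambda>x. f s x - l x) + \<bar>c s - r\<bar> * N l) \<longlongrightarrow> \<bar>r\<bar> * 0 + \<bar>r - r\<bar> * N l) (at t within I)"
    by (intro tendsto_intros c lim[unfolded vlim_def])
  then show "((\<lambda>s. \<bar>c s\<bar> * N (\<lambda>x. f s x - l x) + \<bar>c s - r\<bar> * N l) \<longlongrightarrow> 0) (at t within I)" by simp
  show "\<forall>\<^sub>F s in at t within I. 0 \<le> N (\<lambda>x. of_real (c s) * f s x - of_real r * l x) \<and>
      N (\<lambda>x. of_real (c s) * f s x - of_real r * l x) \<le> \<bar>c s\<bar> * N (\<lambda>x. f s x - l x) + \<bar>c s - r\<bar> * N l"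
    using eventually_at_within_mem
  proof eventually_elim
    case (elim s)
    then have s: "s \<in> I" by simp
    have "N (\<lambda>x. of_real (c s) * f s x - of_real r * l x) = N (\<lambda>x. of_real (c s) * (f s x - l x) + of_real (c s - r) * l x)"
      by (simp add: algebra_simps)
    also have "\<dots> \<le> cmod (of_real (c s)) * N (\<lambda>x. f s x - l x) + cmod (of_real (c s - r)) * N l"
      by (intro norm_lin diff_mem mem s)
    finally show ?case
      using norm_nonneg[OF diff_mem[OF scale_mem[OF mem(1)[OF s]] scale_mem[OF mem(2)]], of "of_real (c s)" "of_real r"]
      unfolding norm_of_real by blast
  qed
qed

text \<open>
  The product rule, from
  \<open>(c s f(s) - c t f(t)) / (s - t) = (c s - c t) / (s - t) f(s) + c t (f(s) - f(t)) / (s - t)\<close>.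
\<close>

lemma C_fam_scale: "C_diff n I c \<Longrightarrow> C_fam n I f \<Longrightarrow> C_fam n I (\<lambda>t x. of_real (c t) * f t x)"
proof (induction n arbitrary: c f)
  case 0 then show ?case by (auto intro!: scale_mem vlim_scale simp: continuous_on_def)
next
  case (Suc n)
  from Suc.prems obtain c' f' where
    c: "C_diff n I c'" "\<And>t. t \<in> I \<Longrightarrow> (c has_real_derivative c' t) (at t within I)"
    and f: "C_fam n I f'" "\<And>t. t \<in> I \<Longrightarrow> vderiv I f (f' t) t" by auto
  note c0 = C_diff_continuous[OF Suc.prems(1)]
  note fm = C_fam_mem[OF Suc.prems(2)]
  have "vderiv I (\<lambda>t x. of_real (c t) * f t x) (\<lambda>x. of_real (c' t) * f t x + of_real (c t) * f' t x) t" if t: "t \<in> I" for t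
  proof -
    have qm: "(\<lambda>x. (f s x - f t x) / complex_of_real (s - t)) \<in> V" if "s \<in> I" for s
      using scale_mem[OF diff_mem[OF fm[OF that] fm[OF t]], of "1 / of_real (s - t)"] by simp
    have 1: "vlim I (\<lambda>s x. of_real ((c s - c t) / (s - t)) * f s x) (\<lambda>x. of_real (c' t) * f t x) t"
      by (rule vlim_scale) (use fm t C_fam_vlim[OF Suc.prems(2) t] c(2)[OF t] in \<open>auto simp: has_field_derivative_iff\<close>)
    have 2: "vlim I (\<lambda>s x. of_real (c t) * ((f s x - f t x) / of_real (s - t))) (\<lambda>x. of_real (c t) * f' t x) t"
      by (rule vlim_scale[OF qm _ _ tendsto_const]) (use C_fam_mem[OF f(1) t] f(2)[OF t] in \<open>auto simp: vderiv_iff\<close>)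
    have "vlim I (\<lambda>s x. 1 * (of_real ((c s - c t) / (s - t)) * f s x) + 1 * (of_real (c t) * ((f s x - f t x) / of_real (s - t))))
        (\<lambda>x. 1 * (of_real (c' t) * f t x) + 1 * (of_real (c t) * f' t x)) t"
      by (rule vlim_lin[OF scale_mem[OF fm] scale_mem[OF qm] scale_mem[OF fm[OF t]] scale_mem[OF C_fam_mem[OF f(1) t]] 1 2])
    also have "(\<lambda>s x. 1 * (of_real ((c s - c t) / (s - t)) * f s x) + 1 * (of_real (c t) * ((f s x - f t x) / of_real (s - t))))
      = (\<lambda>s x. (of_real (c s) * f s x - of_real (c t) * f t x) / of_real (s - t))"
      by (intro ext) (simp add: add_divide_distrib[symmetric] left_diff_distrib right_diff_distrib)
    finally show ?thesis unfolding vderiv_iff by simp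
  qed
  moreover have "C_fam n I (\<lambda>t x. 1 * (of_real (c' t) * f t x) + 1 * (of_real (c t) * f' t x))"
    by (intro C_fam_lin Suc.IH c f C_fam_Suc[OF Suc.prems(2)] C_diff_Suc[OF Suc.prems(1)])
  moreover have "\<forall>t\<in>I. (\<lambda>x. of_real (c t) * f t x) \<in> V \<and> vlim I (\<lambda>t x. of_real (c t) * f t x) (\<lambda>x. of_real (c t) * f t x) t"
    using C_fam_0[OF Suc.prems(2)] c0 by (auto intro!: scale_mem vlim_scale simp: continuous_on_def)
  ultimately show ?case by auto
qed

lemma vlim_compose:
  assumes f: "vlim I f l (\<tau> t)" and l: "N (\<lambda>x. f (\<tau> t) x - l x) = 0" and \<tau>: "continuous (at t within J) \<tau>" "\<tau> ` J \<subseteq> I"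
  shows "vlim J (\<lambda>s. f (\<tau> s)) l t"
proof -
  have "((\<lambda>s. N (\<lambda>x. f s x - l x)) \<longlongrightarrow> N (\<lambda>x. f (\<tau> t) x - l x)) (at (\<tau> t) within I)"
    using f l by (simp add: vlim_def)
  then have "continuous (at (\<tau> t) within I) (\<lambda>s. N (\<lambda>x. f s x - l x))"
    by (simp add: continuous_within)
  then have "continuous (at (\<tau> t) within \<tau> ` J) (\<lambda>s. N (\<lambda>x. f s x - l x))"
    using \<tau>(2) by (rule continuous_within_subset)
  from continuous_within_compose[OF \<tau>(1) this] l show ?thesis
    by (simp add: vlim_def continuous_within o_def)
qed

lemma C_fam_compose:
  "C_fam n I f \<Longrightarrow> C_diff n J \<tau> \<Longrightarrow> \<tau> ` J \<subseteq> I \<Longrightarrow> C_fam n J (\<lambda>t. f (\<tau> t))"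
proof (induction n arbitrary: f)
  case 0
  have "vlim J (\<lambda>t. f (\<tau> t)) (f (\<tau> t)) t" if "t \<in> J" for t
  proof (rule vlim_compose[where I = I])
    have m: "f (\<tau> t) \<in> V" "vlim I f (f (\<tau> t)) (\<tau> t)" using 0 that by auto
    show "vlim I f (f (\<tau> t)) (\<tau> t)" by (rule m(2))
    show "N (\<lambda>x. f (\<tau> t) x - f (\<tau> t) x) = 0" using norm_zero[OF m(1)] by simp
    show "continuous (at t within J) \<tau>" using 0(2) that by (simp add: continuous_on_eq_continuous_within)
    show "\<tau> ` J \<subseteq> I" by (rule 0(3))
  qed
  then show ?case using 0 by auto
next
  case (Suc n)
  from Suc.prems obtain \<tau>' f' where
    \<tau>: "C_diff n J \<tau>'" "\<And>t. t \<in> J \<Longrightarrow> (\<tau> has_real_derivative \<tau>' t) (at t within J)"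
    and f: "C_fam n I f'" "\<And>t. t \<in> I \<Longrightarrow> vderiv I f (f' t) t" by auto
  note fm = C_fam_mem[OF Suc.prems(1)]
  have \<tau>I: "\<tau> t \<in> I" if "t \<in> J" for t using Suc.prems(3) that by auto
  have \<tau>c: "continuous (at t within J) \<tau>" if "t \<in> J" for t using \<tau>(2)[OF that] by (rule DERIV_continuous)
  have "vderiv J (\<lambda>t. f (\<tau> t)) (\<lambda>x. of_real (\<tau>' t) * f' (\<tau> t) x) t" if t: "t \<in> J" for t
  proof -
    \<comment> \<open>The difference quotient of \<open>f\<close>, continued by its limit, composes with \<open>\<tau>\<close> even where \<open>\<tau>\<close> returns
      to the value \<open>\<tau> t\<close>.\<close>
    define q where "q \<sigma> = (if \<sigma> = \<tau> t then f' (\<tau> t) else (\<lambda>x. (f \<sigma> x - f (\<tau> t) x) / of_real (\<sigma> - \<tau> t)))" for \<sigma>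
    have f'm: "f' (\<tau> t) \<in> V" by (rule C_fam_mem[OF f(1) \<tau>I[OF t]])
    have qm: "q \<sigma> \<in> V" if "\<sigma> \<in> I" for \<sigma>
      using scale_mem[OF diff_mem[OF fm[OF that] fm[OF \<tau>I[OF t]]], of "1 / of_real (\<sigma> - \<tau> t)"] f'm by (simp add: q_def)
    have "vlim I q (f' (\<tau> t)) (\<tau> t)"
      using f(2)[OF \<tau>I[OF t]] unfolding vderiv_iff vlim_def
      by (rule Lim_transform_eventually) (auto simp: q_def eventually_at_filter)
    moreover have "N (\<lambda>x. q (\<tau> t) x - f' (\<tau> t) x) = 0" using norm_zero[OF f'm] by (simp add: q_def)
    ultimately have "vlim J (\<lambda>s. q (\<tau> s)) (f' (\<tau> t)) t"
      by (rule vlim_compose[OF _ _ \<tau>c[OF t] Suc.prems(3)])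
    from vlim_scale[OF qm[OF \<tau>I] f'm this \<tau>(2)[OF t, unfolded has_field_derivative_iff]]
    have "vlim J (\<lambda>s x. of_real ((\<tau> s - \<tau> t) / (s - t)) * q (\<tau> s) x) (\<lambda>x. of_real (\<tau>' t) * f' (\<tau> t) x) t" .
    also have "(\<lambda>s x. of_real ((\<tau> s - \<tau> t) / (s - t)) * q (\<tau> s) x) = (\<lambda>s x. (f (\<tau> s) x - f (\<tau> t) x) / of_real (s - t))"
      by (intro ext) (simp add: q_def)
    finally show ?thesis unfolding vderiv_iff .
  qed
  moreover have "C_fam n J (\<lambda>t x. of_real (\<tau>' t) * f' (\<tau> t) x)"
    by (intro C_fam_scale \<tau> Suc.IH f C_diff_Suc[OF Suc.prems(2)] Suc.prems(3))
  moreover have "vlim J (\<lambda>t. f (\<tau> t)) (f (\<tau> t)) t" if t: "t \<in> J" for t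
    by (rule vlim_compose[OF C_fam_vlim[OF Suc.prems(1) \<tau>I[OF t]] _ \<tau>c[OF t] Suc.prems(3)])
      (use norm_zero[OF fm[OF \<tau>I[OF t]]] in simp)
  ultimately show ?case using fm \<tau>I by auto
qed

lemma C_fam_bounded:
  assumes "compact I" "C_fam n I f"
  shows "bdd_above ((\<lambda>t. N (f t)) ` I)"
proof -
  have "((\<lambda>s. N (f s)) \<longlongrightarrow> N (f t)) (at t within I)" if t: "t \<in> I" for t
  proof (rule LIM_zero_cancel, rule tendsto_0_le[THEN tendsto_norm_zero_cancel])
    show "((\<lambda>s. N (\<lambda>x. f s x - f t x)) \<longlongrightarrow> 0) (at t within I)"
      using C_fam_vlim[OF assms(2) t] by (simp add: vlim_def)
    show "\<forall>\<^sub>F s in at t within I. 0 \<le> norm (N (f s) - N (f t)) \<and> norm (N (f s) - N (f t)) \<le> N (\<lambda>x. f s x - f t x)"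
      using eventually_at_within_mem
    proof eventually_elim
      case (elim s)
      then have s: "s \<in> I" by simp
      show ?case
        using norm_diff_triangle[OF C_fam_mem[OF assms(2) s] C_fam_mem[OF assms(2) t]]
          norm_diff_triangle[OF C_fam_mem[OF assms(2) t] C_fam_mem[OF assms(2) s]]
          norm_minus_commute[OF C_fam_mem[OF assms(2) t] C_fam_mem[OF assms(2) s]] by (simp add: abs_le_iff)
    qed
  qed
  then have "continuous_on I (\<lambda>t. N (f t))" by (simp add: continuous_on_def)
  then have "compact ((\<lambda>t. N (f t)) ` I)" using assms(1) by (rule compact_continuous_image)
  then show ?thesis by (intro bounded_imp_bdd_above compact_imp_bounded)
qed

text \<open>
  On a compact interval the boundedness demanded by \<open>derivative_chain\<close> comes from continuity.
\<close>

lemma C_fam_imp_Cn: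
  assumes I: "compact I" and f: "C_fam n I f"
  shows "f \<in> Cn V N I n"
proof -
  have "\<exists>F. derivative_chain V N I n f F" using f
  proof (induction n arbitrary: f)
    case (0 f)
    then show ?case using C_fam_bounded[OF I 0]
      by (intro exI[of _ "\<lambda>_. f"]) (auto simp: derivative_chain_def vlim_def)
  next
    case (Suc n f)
    then obtain f' where f': "C_fam n I f'" "\<And>t. t \<in> I \<Longrightarrow> vderiv I f (f' t) t" by auto
    from Suc.IH[OF f'(1)] obtain F where F: "derivative_chain V N I n f' F" ..
    define G where "G j = (case j of 0 \<Rightarrow> f | Suc i \<Rightarrow> F i)" for j
    have G: "G 0 = f" "\<And>i. G (Suc i) = F i" by (auto simp: G_def)
    have b: "bdd_above ((\<lambda>t. N (f t)) ` I)" by (rule C_fam_bounded[OF I Suc.prems])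
    have "derivative_chain V N I (Suc n) f G"
      unfolding derivative_chain_def
    proof (intro conjI allI impI ballI)
      fix t assume t: "t \<in> I"
      show "G 0 t = f t" by (simp add: G)
      fix j
      show "G j t \<in> V" if "j \<le> Suc n"
        using that F t C_fam_mem[OF Suc.prems t] by (cases j) (auto simp: G derivative_chain_def)
      show "((\<lambda>s. N (\<lambda>x. G j s x - G j t x)) \<longlongrightarrow> 0) (at t within I)" if "j \<le> Suc n"
        using that F t C_fam_vlim[OF Suc.prems t] by (cases j) (auto simp: G derivative_chain_def vlim_def)
      show "((\<lambda>s. N (\<lambda>x. (G j s x - G j t x) / complex_of_real (s - t) - G (Suc j) t x)) \<longlongrightarrow> 0) (at t within I)" if "j < Suc n"
      proof (cases j)
        case 0
        have "F 0 t = f' t" using F t by (auto simp: derivative_chain_def)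
        then show ?thesis using f'(2)[OF t] by (simp add: 0 G vderiv_def)
      next
        case (Suc i)
        then show ?thesis using F t that by (auto simp: G derivative_chain_def)
      qed
    next
      fix j assume "j \<le> Suc n"
      then show "bdd_above ((\<lambda>t. N (G j t)) ` I)"
        using b F by (cases j) (auto simp: G derivative_chain_def)
    qed
    then show ?case by (intro exI[of _ G])
  qed
  then show ?thesis by (simp add: Cn_def)
qed

lemma Cn_imp_C_fam:
  assumes "f \<in> Cn V N I n"
  shows "C_fam n I f"
proof -
  from assms obtain F where "derivative_chain V N I n f F" by (auto simp: Cn_def)
  then show ?thesis
  proof (induction n arbitrary: f F)
    case (0 f F)
    then have F: "\<And>t. t \<in> I \<Longrightarrow> F 0 t = f t" "\<And>t. t \<in> I \<Longrightarrow> F 0 t \<in> V"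
      "\<And>t. t \<in> I \<Longrightarrow> vlim I (F 0) (F 0 t) t" by (auto simp: derivative_chain_def vlim_def)
    then have "C_fam 0 I (F 0)" by simp
    then show ?case
    proof (rule C_fam_cong)
      fix t assume t: "t \<in> I"
      show "f t \<in> V" "N (\<lambda>x. f t x - F 0 t x) = 0" using F(1,2)[OF t] norm_zero[OF F(2)[OF t]] by auto
    qed
  next
    case (Suc n f F)
    have F: "F 0 t = f t" "F 0 t \<in> V" "vlim I (F 0) (F 0 t) t" "vderiv I (F 0) (F 1 t) t" if "t \<in> I" for t
      using Suc.prems that by (auto simp: derivative_chain_def vlim_def vderiv_def)
    have "derivative_chain V N I n (F 1) (\<lambda>j. F (Suc j))"
      using Suc.prems by (auto simp: derivative_chain_def)
    then have "C_fam n I (F 1)" by (rule Suc.IH)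
    then have "C_fam (Suc n) I (F 0)" using F by auto
    then show ?case
    proof (rule C_fam_cong)
      fix t assume t: "t \<in> I"
      show "f t \<in> V" "N (\<lambda>x. f t x - F 0 t x) = 0" using F(1,2)[OF t] norm_zero[OF F(2)[OF t]] by auto
    qed
  qed
qed

end

section \<open>The change of variables on one interval\<close>

text \<open>
  The conditions on the change of variables between two consecutive singular points \<open>a\<close> and \<open>b\<close>.
\<close>

locale singular_substitution =
  fixes a b :: real and g h :: "real \<Rightarrow> real" and \<delta> C :: real
  assumes ab: "a < b" and g_smooth: "real_smooth_on {a..b} g" and g_mono: "mono_on {a..b} g"
    and ga: "g a = a" and gb: "g b = b" and g_pos: "\<And>t. t \<in> {a<..<b} \<Longrightarrow> deriv g t > 0"
    and \<delta>: "\<delta> > 0" and h_smooth: "real_smooth_on {0..<\<delta>} h" and C: "C > 0"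
    and g_left: "\<And>t. t \<in> {a..<a + \<delta>} \<inter> {a..b} \<Longrightarrow> g t - a = C * (h (t - a))\<^sup>2"
    and g_right: "\<And>t. t \<in> {b - \<delta><..b} \<inter> {a..b} \<Longrightarrow> b - g t = C * (h (b - t))\<^sup>2"
begin

lemma g_in: "t \<in> {a..b} \<Longrightarrow> g t \<in> {a..b}"
  using mono_onD[OF g_mono, of a t] mono_onD[OF g_mono, of t b] ab ga gb by auto

definition g' :: "real \<Rightarrow> real" where "g' t = vector_derivative g (at t within {a..b})"

lemma g_chain:
  obtains D where "\<And>t. t \<in> {a..b} \<Longrightarrow> D 0 t = g t"
    "\<And>j t. t \<in> {a..b} \<Longrightarrow> (D j has_real_derivative D (Suc j) t) (at t within {a..b})"
    "\<And>t. t \<in> {a..b} \<Longrightarrow> D 1 t = g' t"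
    "\<And>t. t \<in> {a..b} \<Longrightarrow> (g has_real_derivative g' t) (at t within {a..b})"
proof -
  obtain D where D0: "\<forall>t\<in>{a..b}. D 0 t = g t"
    and D: "\<forall>j. \<forall>t\<in>{a..b}. (D j has_real_derivative D (Suc j) t) (at t within {a..b})"
    using g_smooth unfolding real_smooth_on_def by blast
  have d: "(g has_real_derivative D 1 t) (at t within {a..b})" if t: "t \<in> {a..b}" for t
  proof -
    have "(D 0 has_real_derivative D 1 t) (at t within {a..b})" using D t by auto
    then show ?thesis
      by (rule has_field_derivative_transform_within[of _ _ _ _ 1]) (use D0 t in auto)
  qed
  have 1: "D 1 t = g' t" if t: "t \<in> {a..b}" for t
  proof -
    have "(g has_vector_derivative D 1 t) (at t within {a..b})"
      using d[OF t] by (simp add: has_real_derivative_iff_has_vector_derivative)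
    from vector_derivative_within_closed_interval[OF ab t this] show ?thesis by (simp add: g'_def)
  qed
  show ?thesis
  proof (rule that)
    show "D 0 t = g t" if "t \<in> {a..b}" for t using D0 that by blast
    show "(D j has_real_derivative D (Suc j) t) (at t within {a..b})" if "t \<in> {a..b}" for j t using D that by blast
    show "D 1 t = g' t" if "t \<in> {a..b}" for t by (rule 1[OF that])
    show "(g has_real_derivative g' t) (at t within {a..b})" if "t \<in> {a..b}" for t using d[OF that] 1[OF that] by simp
  qed
qed

lemma g_deriv: "t \<in> {a..b} \<Longrightarrow> (g has_real_derivative g' t) (at t within {a..b})"
  by (rule g_chain)

lemma C_diff_g: "C_diff n {a..b} g"
  by (rule real_smooth_C_diff[OF g_smooth])

lemma C_diff_g': "C_diff n {a..b} g'"
proof -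
  obtain D where D: "\<And>j t. t \<in> {a..b} \<Longrightarrow> (D j has_real_derivative D (Suc j) t) (at t within {a..b})"
    "\<And>t. t \<in> {a..b} \<Longrightarrow> D 1 t = g' t" using g_chain by metis
  show ?thesis by (rule C_diff_cong[OF C_diff_chain[where D = D and i = 1, OF D(1)] D(2)])
qed

lemma g_increasing:
  assumes "s \<in> {a..b}" "t \<in> {a..b}" "s < t"
  shows "g s < g t"
proof -
  have "continuous_on {s..t} g"
    by (rule continuous_on_subset[OF C_diff_continuous[OF C_diff_g]]) (use assms in auto)
  moreover have D: "(g has_real_derivative deriv g x) (at x)" if "s < x" "x < t" for x
  proof -
    have "at x within {a..b} = at x" by (rule at_within_Icc_at) (use that assms in auto)
    then have "(g has_real_derivative g' x) (at x)" using g_deriv[of x] that assms by auto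
    then show ?thesis by (metis DERIV_imp_deriv)
  qed
  ultimately have "\<exists>l z. s < z \<and> z < t \<and> (g has_real_derivative l) (at z) \<and> g t - g s = (t - s) * l"
    by (intro MVT[OF \<open>s < t\<close>]) (auto simp: real_differentiable_def)
  then obtain l z where z: "s < z" "z < t" "(g has_real_derivative l) (at z)" "g t - g s = (t - s) * l" by blast
  then have "l = deriv g z" by (simp add: DERIV_imp_deriv)
  then have "0 < (t - s) * l" using g_pos[of z] z assms by (intro mult_pos_pos) auto
  then show ?thesis using z(4) by linarith
qed

text \<open>
  The square root of \<open>h\<^sup>2\<close> is \<open>h\<close> up to a sign, and the sign is constant: \<open>h\<close> has no zero in the
  open interval, where \<open>g\<close> is larger than \<open>a\<close>.
\<close>

lemma root_h_smooth: "C_diff n {0..<min \<delta> (b - a)} (\<lambda>s. sqrt (C * (h s)\<^sup>2))"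
proof -
  let ?r = "min \<delta> (b - a)"
  have hc: "C_diff n {0..<?r} h" for n
    by (rule C_diff_subset[OF real_smooth_C_diff[OF h_smooth]]) auto
  have val: "C * (h s)\<^sup>2 = g (a + s) - a" if "s \<in> {0..<?r}" for s
    using g_left[of "a + s"] that by auto
  have h0: "h 0 = 0" using val[of 0] C \<delta> ab ga by auto
  have hn0: "h s \<noteq> 0" if "s \<in> {0<..<?r}" for s
    using val[of s] g_increasing[of a "a + s"] that ga by auto
  have conn: "connected (h ` {0<..<?r})"
    by (rule connected_continuous_image[OF continuous_on_subset[OF C_diff_continuous[OF hc[of 0]]]]) auto
  have "(\<forall>s\<in>{0<..<?r}. 0 < h s) \<or> (\<forall>s\<in>{0<..<?r}. h s < 0)"
  proof (rule ccontr)
    assume "\<not> ?thesis"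
    then obtain s t where st: "s \<in> {0<..<?r}" "h s \<le> 0" "t \<in> {0<..<?r}" "0 \<le> h t" by (auto simp: not_less)
    then have "0 \<in> h ` {0<..<?r}"
      using connectedD_interval[OF conn, of "h s" "h t" 0] by blast
    then show False using hn0 by auto
  qed
  then obtain \<sigma> :: real where \<sigma>: "\<And>s. s \<in> {0<..<?r} \<Longrightarrow> \<bar>h s\<bar> = \<sigma> * h s"
  proof
    assume *: "\<forall>s\<in>{0<..<?r}. 0 < h s"
    have "\<bar>h s\<bar> = 1 * h s" if "s \<in> {0<..<?r}" for s using bspec[OF * that] by simp
    then show ?thesis by (rule that)
  next
    assume *: "\<forall>s\<in>{0<..<?r}. h s < 0"
    have "\<bar>h s\<bar> = - 1 * h s" if "s \<in> {0<..<?r}" for s using bspec[OF * that] by simp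
    then show ?thesis by (rule that)
  qed
  have "C_diff n {0..<?r} (\<lambda>s. (sqrt C * \<sigma>) * h s)" by (intro C_diff_mult C_diff_const hc)
  then show ?thesis
  proof (rule C_diff_cong)
    fix s assume s: "s \<in> {0..<?r}"
    have "\<bar>h s\<bar> = \<sigma> * h s" using \<sigma>[of s] s h0 by (cases "s = 0") auto
    then show "sqrt C * \<sigma> * h s = sqrt (C * (h s)\<^sup>2)" by (simp add: real_sqrt_mult)
  qed
qed

text \<open>
  Near \<open>a\<close> the root is the one from the previous lemma; away from \<open>a\<close> it is the root of a positive
  smooth function.
\<close>

lemma sqrt_left_smooth: "C_diff n {a..b} (\<lambda>t. sqrt (g t - a))"
proof -
  define r where "r = min \<delta> (b - a) / 2"
  have r: "0 < r" "r < b - a" "r < \<delta>" using \<delta> ab by (auto simp: r_def min_def)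
  show ?thesis
  proof (rule C_diff_glue)
  show "a < a + r / 2" "a + r / 2 < a + r" "a + r < b" using r by auto
  have "C_diff n {a..<a + r} (\<lambda>t. sqrt (C * (h (- a + 1 * t))\<^sup>2))"
    by (rule C_diff_affine[OF root_h_smooth]) (use r in auto)
  then show "C_diff n {a..<a + r} (\<lambda>t. sqrt (g t - a))"
    by (rule C_diff_cong) (use g_left r in auto)
  show "C_diff n {a + r / 2<..b} (\<lambda>t. sqrt (g t - a))"
  proof (rule C_diff_sqrt)
    have "C_diff n {a..b} (\<lambda>t. g t + - a)" by (intro C_diff_add C_diff_g C_diff_const)
    then have "C_diff n {a..b} (\<lambda>t. g t - a)" by simp
    then show "C_diff n {a + r / 2<..b} (\<lambda>t. g t - a)"
      by (rule C_diff_subset) (use r in auto)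
    show "0 < g t - a" if "t \<in> {a + r / 2<..b}" for t
      using g_increasing[of a t] that r ga ab by auto
  qed
  qed
qed

lemma sqrt_right_smooth: "C_diff n {a..b} (\<lambda>t. sqrt (b - g t))"
proof -
  define r where "r = min \<delta> (b - a) / 2"
  have r: "0 < r" "r < b - a" "r < \<delta>" using \<delta> ab by (auto simp: r_def min_def)
  show ?thesis
  proof (rule C_diff_glue)
  show "a < b - r" "b - r < b - r / 2" "b - r / 2 < b" using r by auto
  have "C_diff n {b - r<..b} (\<lambda>t. sqrt (C * (h (b + (- 1) * t))\<^sup>2))"
    by (rule C_diff_affine[OF root_h_smooth]) (use r in auto)
  then show "C_diff n {b - r<..b} (\<lambda>t. sqrt (b - g t))"
    by (rule C_diff_cong) (use g_right r in auto)
  show "C_diff n {a..<b - r / 2} (\<lambda>t. sqrt (b - g t))"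
  proof (rule C_diff_sqrt)
    have "C_diff n {a..b} (\<lambda>t. b + (- 1) * g t)" by (intro C_diff_add C_diff_mult C_diff_g C_diff_const)
    then have "C_diff n {a..b} (\<lambda>t. b - g t)" by simp
    then show "C_diff n {a..<b - r / 2} (\<lambda>t. b - g t)"
      by (rule C_diff_subset) (use r in auto)
    show "0 < b - g t" if "t \<in> {a..<b - r / 2}" for t
      using g_increasing[of t b] that r gb ab by auto
  qed
  qed
qed

text \<open>
  From the order of \<open>h\<close> one reads off that \<open>g - a\<close> and \<open>b - g\<close> vanish to order \<open>2 * m + 2\<close> at the
  respective ends, and differentiation costs one order.
\<close>

lemma g'_vanishing_order:
  assumes "h \<in> O[at_right 0](\<lambda>t. t ^ (m + 1))"
  shows "\<exists>K. \<forall>t\<in>{a..b}. \<bar>g' t\<bar> \<le> K * (t - a) ^ (2 * m + 1) \<and> \<bar>g' t\<bar> \<le> K * (b - t) ^ (2 * m + 1)"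
proof -
  obtain c where "eventually (\<lambda>t. norm (h t) \<le> c * norm (t ^ (m + 1))) (at_right 0)"
    using landau_o.bigE[OF assms] by blast
  then obtain e' where e': "e' > 0" "\<And>t. 0 < t \<Longrightarrow> t < e' \<Longrightarrow> \<bar>h t\<bar> \<le> c * \<bar>t ^ (m + 1)\<bar>"
    unfolding eventually_at_right_field by auto
  define e where "e = min e' \<delta>"
  have e: "e > 0" and ed: "e \<le> \<delta>" using e' \<delta> by (simp_all add: e_def)
  have hb: "\<bar>C * (h t)\<^sup>2\<bar> \<le> (C * c\<^sup>2) * t ^ Suc (2 * m + 1)" if "0 < t" "t < e" for t
  proof -
    have "\<bar>h t\<bar>\<^sup>2 \<le> (c * \<bar>t ^ (m + 1)\<bar>)\<^sup>2"
      by (rule power_mono) (use e'(2)[of t] that in \<open>auto simp: e_def\<close>)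
    also have "\<dots> = c\<^sup>2 * t ^ Suc (2 * m + 1)"
      by (simp add: power_mult_distrib power_mult[symmetric] algebra_simps flip: power_Suc)
    finally show ?thesis using C by (simp add: abs_mult)
  qed
  obtain D where D0: "\<And>t. t \<in> {a..b} \<Longrightarrow> D 0 t = g t"
    and D: "\<And>j t. t \<in> {a..b} \<Longrightarrow> (D j has_real_derivative D (Suc j) t) (at t within {a..b})"
    and D1: "\<And>t. t \<in> {a..b} \<Longrightarrow> D 1 t = g' t"
    using g_chain by metis
  define Dr where "Dr r j = (if j = 0 then (\<lambda>t. D 0 t - r) else D j)" for r :: real and j :: nat
  have sh: "(Dr r j has_real_derivative Dr r (Suc j) t) (at t within {a..b})" if "t \<in> {a..b}" for j t r
    using D[OF that, of j] by (auto simp: Dr_def intro!: derivative_eq_intros)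
  have "\<exists>K. \<forall>t\<in>{a..b}. \<bar>Dr a 1 t\<bar> \<le> K * (t - a) ^ (2 * m + 1)"
  proof (rule derivative_vanishing_order[where D = "Dr a", OF ab sh e])
    fix t assume t: "t \<in> {a<..<a + e} \<inter> {a..b}"
    then have "Dr a 0 t = C * (h (t - a))\<^sup>2" using g_left[of t] D0[of t] ed by (simp add: Dr_def)
    then show "\<bar>Dr a 0 t\<bar> \<le> (C * c\<^sup>2) * (t - a) ^ Suc (2 * m + 1)"
      using hb[of "t - a"] t by simp
  qed
  then obtain K1 where K1': "\<forall>t\<in>{a..b}. \<bar>Dr a 1 t\<bar> \<le> K1 * (t - a) ^ (2 * m + 1)" ..
  have K1: "\<bar>g' t\<bar> \<le> K1 * (t - a) ^ (2 * m + 1)" if "t \<in> {a..b}" for t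
    using bspec[OF K1' that] D1[OF that] by (simp add: Dr_def)
  have "\<exists>K. \<forall>t\<in>{a..b}. \<bar>Dr b 1 t\<bar> \<le> K * (b - t) ^ (2 * m + 1)"
  proof (rule derivative_vanishing_order_right[where D = "Dr b", OF ab sh e])
    fix t assume t: "t \<in> {b - e<..<b} \<inter> {a..b}"
    then have "Dr b 0 t = - (C * (h (b - t))\<^sup>2)" using g_right[of t] D0[of t] ed by (simp add: Dr_def)
    then show "\<bar>Dr b 0 t\<bar> \<le> (C * c\<^sup>2) * (b - t) ^ Suc (2 * m + 1)"
      using hb[of "b - t"] t by simp
  qed
  then obtain K2 where K2': "\<forall>t\<in>{a..b}. \<bar>Dr b 1 t\<bar> \<le> K2 * (b - t) ^ (2 * m + 1)" ..
  have K2: "\<bar>g' t\<bar> \<le> K2 * (b - t) ^ (2 * m + 1)" if "t \<in> {a..b}" for t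
    using bspec[OF K2' that] D1[OF that] by (simp add: Dr_def)
  have "\<bar>g' t\<bar> \<le> max K1 K2 * (t - a) ^ (2 * m + 1) \<and> \<bar>g' t\<bar> \<le> max K1 K2 * (b - t) ^ (2 * m + 1)" if t: "t \<in> {a..b}" for t
  proof
    have "K1 * (t - a) ^ (2 * m + 1) \<le> max K1 K2 * (t - a) ^ (2 * m + 1)" using t by (intro mult_right_mono) auto
    then show "\<bar>g' t\<bar> \<le> max K1 K2 * (t - a) ^ (2 * m + 1)" using K1[OF t] by linarith
    have "K2 * (b - t) ^ (2 * m + 1) \<le> max K1 K2 * (b - t) ^ (2 * m + 1)" using t by (intro mult_right_mono) auto
    then show "\<bar>g' t\<bar> \<le> max K1 K2 * (b - t) ^ (2 * m + 1)" using K2[OF t] by linarith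
  qed
  then show ?thesis by blast
qed

lemma transformed_eq: "transformed g {a..b} w t = (\<lambda>x. of_real (g' t) * w (g t) x)"
  by (simp add: transformed_def g'_def mult.commute)

end

text \<open>
  The substitution turns the two square roots into smooth scalar functions; the factor \<open>\<i>\<close> is the
  value of \<open>csqrt\<close> on negative numbers.
\<close>

lemma (in seminormed_family) C_fam_transformed:
  assumes "singular_substitution a b g h \<delta> C"
    and w: "\<And>\<alpha>. \<alpha> \<in> {a..b} \<Longrightarrow> w \<alpha> \<in> V"
    and f: "C_fam n {a..b} w0" "C_fam n {a..b} w1" "C_fam n {a..b} w2"
    and null: "\<And>\<alpha>. \<alpha> \<in> {a..b} \<Longrightarrow> N (\<lambda>x. w \<alpha> x - (w2 \<alpha> x + csqrt (of_real (\<alpha> - a)) * w0 \<alpha> x + csqrt (of_real (\<alpha> - b)) * w1 \<alpha> x)) = 0"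
  shows "C_fam n {a..b} (transformed g {a..b} w)"
proof -
  interpret singular_substitution a b g h \<delta> C by fact
  have sub: "g ` {a..b} \<subseteq> {a..b}" using g_in by auto
  define F where "F t x = 1 * w2 (g t) x + 1 * (1 * (of_real (sqrt (g t - a)) * w0 (g t) x) + \<i> * (of_real (sqrt (b - g t)) * w1 (g t) x))" for t x
  have F: "C_fam n {a..b} F"
    unfolding F_def[abs_def]
    by (intro C_fam_lin C_fam_scale C_fam_compose[OF _ C_diff_g sub] f sqrt_left_smooth sqrt_right_smooth)
  have F_eq: "F t = (\<lambda>x. w2 (g t) x + csqrt (of_real (g t - a)) * w0 (g t) x + csqrt (of_real (g t - b)) * w1 (g t) x)" if "t \<in> {a..b}" for t
  proof -
    have "csqrt (of_real (g t - a)) = of_real (sqrt (g t - a))"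
      by (rule csqrt_of_real_nonneg[THEN trans]) (use g_in[OF that] in auto)
    moreover have "csqrt (of_real (g t - b)) = \<i> * of_real (sqrt (b - g t))"
      using csqrt_of_real_nonpos[of "of_real (g t - b)"] g_in[OF that] by auto
    ultimately show ?thesis by (simp add: F_def[abs_def] algebra_simps)
  qed
  show ?thesis
  proof (rule C_fam_cong[OF C_fam_scale[OF C_diff_g' F]])
    fix t assume t: "t \<in> {a..b}"
    have wt: "w (g t) \<in> V" using w g_in[OF t] by blast
    show "transformed g {a..b} w t \<in> V" unfolding transformed_eq by (rule scale_mem[OF wt])
    have d: "(\<lambda>x. w (g t) x - F t x) \<in> V" by (rule diff_mem[OF wt C_fam_mem[OF F t]])
    have "N (\<lambda>x. of_real (g' t) * (w (g t) x - F t x)) \<le> cmod (of_real (g' t)) * N (\<lambda>x. w (g t) x - F t x)"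
      by (rule norm_scale_le[OF d])
    also have "N (\<lambda>x. w (g t) x - F t x) = 0" unfolding F_eq[OF t] by (rule null[OF g_in[OF t]])
    finally have "N (\<lambda>x. of_real (g' t) * (w (g t) x - F t x)) = 0"
      using norm_nonneg[OF scale_mem[OF d]] by (simp add: order_antisym)
    then show "N (\<lambda>x. transformed g {a..b} w t x - of_real (g' t) * F t x) = 0"
      by (simp add: transformed_eq algebra_simps)
  qed
qed

section \<open>Singular points\<close>

text \<open>
  For the upper bound take the multiple of the dual period that is nearest to \<open>k\<close>.
\<close>

lemma k_under_bounds:
  assumes "\<Lambda> > 0"
  shows "0 \<le> k_under \<Lambda> k" "k_under \<Lambda> k \<le> dual_period \<Lambda> / 2"
proof -
  let ?d = "dual_period \<Lambda>"
  have d: "?d > 0" using assms by (simp add: dual_period_def)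
  show "0 \<le> k_under \<Lambda> k" unfolding k_under_def by (rule cINF_greatest) auto
  have "k_under \<Lambda> k \<le> \<bar>?d * of_int (round (k / ?d)) - k\<bar>"
    unfolding k_under_def by (rule cINF_lower) (auto intro: bdd_belowI[of _ 0])
  also have "\<dots> = ?d * \<bar>of_int (round (k / ?d)) - k / ?d\<bar>"
  proof -
    have "?d * of_int (round (k / ?d)) - k = ?d * (of_int (round (k / ?d)) - k / ?d)"
      using d by (simp add: field_simps)
    then show ?thesis using d by (simp add: abs_mult)
  qed
  also have "\<dots> \<le> ?d * (1 / 2)"
    using d of_int_round_abs_le[of "k / ?d"] by (intro mult_left_mono) auto
  finally show "k_under \<Lambda> k \<le> ?d / 2" by simp
qed

lemma pieces_pos: "0 < pieces \<Lambda> k"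
  by (simp add: pieces_def)

lemma sing_pt_less:
  assumes "\<Lambda> > 0" "i < pieces \<Lambda> k"
  shows "sing_pt \<Lambda> k i < sing_pt \<Lambda> k (Suc i)"
proof -
  have d: "dual_period \<Lambda> > 0" using assms by (simp add: dual_period_def)
  show ?thesis
  proof (cases "k_under \<Lambda> k \<in> {0, dual_period \<Lambda> / 2}")
    case True
    then have "pieces \<Lambda> k = 1" by (simp add: pieces_def)
    then show ?thesis using assms(2) d by (simp add: sing_pt_def)
  next
    case False
    then have "pieces \<Lambda> k = 2" "0 < k_under \<Lambda> k" "k_under \<Lambda> k < dual_period \<Lambda> / 2"
      using k_under_bounds[OF assms(1), of k] by (auto simp: pieces_def)
    then show ?thesis using assms(2) by (auto simp: sing_pt_def less_2_cases_iff)
  qed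
qed

lemma sing_pt_le:
  assumes "\<Lambda> > 0" "i \<le> j" "j \<le> pieces \<Lambda> k"
  shows "sing_pt \<Lambda> k i \<le> sing_pt \<Lambda> k j"
  using assms(2,3)
proof (induction j rule: dec_induct)
  case (step j)
  then show ?case using sing_pt_less[OF assms(1), of j k] by simp
qed simp

lemma bloch_cell_eq: "bloch_cell \<Lambda> k = {sing_pt \<Lambda> k 0 <.. sing_pt \<Lambda> k (pieces \<Lambda> k)}"
  using pieces_pos[of \<Lambda> k] by (simp add: bloch_cell_def sing_pt_def)

lemma change_of_variables_piece:
  assumes "\<Lambda> > 0" and cv: "change_of_variables \<Lambda> k g h" and i: "i < pieces \<Lambda> k"
  shows "\<exists>\<delta> C. singular_substitution (sing_pt \<Lambda> k i) (sing_pt \<Lambda> k (Suc i)) g h \<delta> C"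
proof -
  from cv obtain \<delta> where \<delta>: "\<delta> > 0" "real_smooth_on {0 ..< \<delta>} h"
    and C: "\<forall>i < pieces \<Lambda> k. \<exists>C > 0.
           (\<forall>t \<in> {sing_pt \<Lambda> k i ..< sing_pt \<Lambda> k i + \<delta>} \<inter> piece \<Lambda> k i.
              g t - sing_pt \<Lambda> k i = C * (h (t - sing_pt \<Lambda> k i))\<^sup>2) \<and>
           (\<forall>t \<in> {sing_pt \<Lambda> k (Suc i) - \<delta> <.. sing_pt \<Lambda> k (Suc i)} \<inter> piece \<Lambda> k i.
              sing_pt \<Lambda> k (Suc i) - g t = C * (h (sing_pt \<Lambda> k (Suc i) - t))\<^sup>2)"
    unfolding change_of_variables_def by (elim conjE exE)
  from C[rule_format, OF i] obtain c where c: "c > 0"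
    "\<forall>t \<in> {sing_pt \<Lambda> k i ..< sing_pt \<Lambda> k i + \<delta>} \<inter> piece \<Lambda> k i. g t - sing_pt \<Lambda> k i = c * (h (t - sing_pt \<Lambda> k i))\<^sup>2"
    "\<forall>t \<in> {sing_pt \<Lambda> k (Suc i) - \<delta> <.. sing_pt \<Lambda> k (Suc i)} \<inter> piece \<Lambda> k i.
              sing_pt \<Lambda> k (Suc i) - g t = c * (h (sing_pt \<Lambda> k (Suc i) - t))\<^sup>2"
    by blast
  have G: "real_smooth_on (piece \<Lambda> k i) g \<and> mono_on (piece \<Lambda> k i) g \<and>
        g (sing_pt \<Lambda> k i) = sing_pt \<Lambda> k i \<and> g (sing_pt \<Lambda> k (Suc i)) = sing_pt \<Lambda> k (Suc i) \<and>
        (\<forall>t \<in> {sing_pt \<Lambda> k i <..< sing_pt \<Lambda> k (Suc i)}. deriv g t > 0)"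
    using cv i unfolding change_of_variables_def by (elim conjE) (rule allE, assumption, erule mp)
  have "singular_substitution (sing_pt \<Lambda> k i) (sing_pt \<Lambda> k (Suc i)) g h \<delta> c"
  proof
    show "sing_pt \<Lambda> k i < sing_pt \<Lambda> k (Suc i)" by (rule sing_pt_less[OF assms(1) i])
  qed (use G \<delta> c in \<open>unfold piece_def, blast+\<close>)
  then show ?thesis by blast
qed

section \<open>Continuous families and their integrals\<close>

context seminormed_family
begin

lemma C_fam_0_union:
  assumes "C_fam 0 S f" "C_fam 0 T f" "closed S" "closed T"
  shows "C_fam 0 (S \<union> T) f"
proof -
  have triv: "vlim T f (f t) t" if "closed T" "t \<notin> T" for t T
  proof -
    have "\<not> t islimpt T" using that closed_limpt by blast
    then have "at t within T = bot" by (simp add: trivial_limit_within)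
    then show ?thesis by (simp add: vlim_def)
  qed
  have "vlim (S \<union> T) f (f t) t" if "t \<in> S \<union> T" for t
  proof -
    have "vlim S f (f t) t" using assms triv[of S t] by (cases "t \<in> S") auto
    moreover have "vlim T f (f t) t" using assms triv[of T t] by (cases "t \<in> T") auto
    ultimately show ?thesis unfolding vlim_def by (rule Lim_Un)
  qed
  then show ?thesis using assms by auto
qed

text \<open>
  The Heine--Cantor theorem for a seminorm, by a Lebesgue number of the cover by balls on which the
  family varies by less than \<open>e / 2\<close>.
\<close>

lemma C_fam_uniformly_continuous:
  assumes I: "compact I" and f: "C_fam 0 I f" and e: "e > 0"
  shows "\<exists>\<delta>>0. \<forall>s\<in>I. \<forall>t\<in>I. \<bar>s - t\<bar> < \<delta> \<longrightarrow> N (\<lambda>x. f s x - f t x) \<le> e"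
proof -
  have "\<forall>t\<in>I. \<exists>d>0. \<forall>s\<in>I. \<bar>s - t\<bar> < d \<longrightarrow> N (\<lambda>x. f s x - f t x) < e / 2"
  proof
    fix t assume t: "t \<in> I"
    have "((\<lambda>s. N (\<lambda>x. f s x - f t x)) \<longlongrightarrow> 0) (at t within I)"
      using C_fam_vlim[OF f t] by (simp add: vlim_def)
    then have "eventually (\<lambda>s. N (\<lambda>x. f s x - f t x) < e / 2) (at t within I)"
      by (rule order_tendstoD(2)) (use e in simp)
    then obtain d where d: "d > 0" "\<And>s. s \<in> I \<Longrightarrow> s \<noteq> t \<Longrightarrow> dist s t < d \<Longrightarrow> N (\<lambda>x. f s x - f t x) < e / 2"
      unfolding eventually_at by blast
    have "N (\<lambda>x. f s x - f t x) < e / 2" if "s \<in> I" "\<bar>s - t\<bar> < d" for s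
      using d(2)[of s] that norm_zero[OF C_fam_mem[OF f t]] e by (cases "s = t") (auto simp: dist_real_def)
    then show "\<exists>d>0. \<forall>s\<in>I. \<bar>s - t\<bar> < d \<longrightarrow> N (\<lambda>x. f s x - f t x) < e / 2" using d(1) by blast
  qed
  from bchoice[OF this] obtain d where
    d: "\<And>t. t \<in> I \<Longrightarrow> d t > 0" "\<And>s t. t \<in> I \<Longrightarrow> s \<in> I \<Longrightarrow> \<bar>s - t\<bar> < d t \<Longrightarrow> N (\<lambda>x. f s x - f t x) < e / 2" by blast
  have "I \<subseteq> \<Union>((\<lambda>t. ball t (d t)) ` I)" using d(1) by force
  from Heine_Borel_lemma[OF I this] obtain \<delta> where
    \<delta>: "\<delta> > 0" "\<And>s. s \<in> I \<Longrightarrow> \<exists>G \<in> (\<lambda>t. ball t (d t)) ` I. ball s \<delta> \<subseteq> G" by auto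
  have "N (\<lambda>x. f s x - f t x) \<le> e" if st: "s \<in> I" "t \<in> I" "\<bar>s - t\<bar> < \<delta>" for s t
  proof -
    obtain r where r: "r \<in> I" "ball s \<delta> \<subseteq> ball r (d r)" using \<delta>(2)[OF st(1)] by blast
    have "s \<in> ball s \<delta>" "t \<in> ball s \<delta>" using \<delta>(1) st by (auto simp: dist_real_def)
    then have "s \<in> ball r (d r)" "t \<in> ball r (d r)" using r(2) by blast+
    then have "N (\<lambda>x. f s x - f r x) < e / 2" "N (\<lambda>x. f t x - f r x) < e / 2"
      using d(2)[OF r(1) st(1)] d(2)[OF r(1) st(2)] by (auto simp: dist_real_def abs_minus_commute)
    moreover have "N (\<lambda>x. (f s x - f r x) - (f t x - f r x)) \<le> N (\<lambda>x. f s x - f r x) + N (\<lambda>x. f t x - f r x)"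
      by (intro norm_diff diff_mem C_fam_mem[OF f] st r)
    ultimately show ?thesis by simp
  qed
  then show ?thesis using \<delta>(1) by blast
qed

end

lemma set_integral_half_open:
  fixes f :: "real \<Rightarrow> complex"
  assumes "continuous_on {a..b} f"
  shows "(LINT x:{a<..b}|lborel. f x) = integral {a..b} f"
proof -
  have "set_integrable lborel {a..b} f" by (rule borel_integrable_atLeastAtMost'[OF assms])
  then have "set_integrable lborel {a<..b} f" by (rule set_integrable_subset) auto
  then have "(LINT x:{a<..b}|lborel. f x) = integral {a<..b} f" by (rule set_borel_integral_eq_integral(2))
  also have "\<dots> = integral {a..b} f"
  proof (rule integral_spike_set)
    have n: "negligible {a}" by simp
    show "negligible {x \<in> {a<..b} - {a..b}. f x \<noteq> 0}" by (rule negligible_subset[OF n]) auto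
    show "negligible {x \<in> {a..b} - {a<..b}. f x \<noteq> 0}" by (rule negligible_subset[OF n]) auto
  qed
  finally show ?thesis .
qed

lemma (in semi_inner_family) ip_sum:
  assumes "finite A" "A \<noteq> {}" "\<And>i. i \<in> A \<Longrightarrow> u i \<in> V" "z \<in> V"
  shows "ip (\<lambda>x. \<Sum>i\<in>A. c i * u i x) z = (\<Sum>i\<in>A. c i * ip (u i) z)"
  using assms(1-3)
proof (induction A rule: finite_ne_induct)
  case (singleton i)
  then show ?case using ip_lin[of "u i" "u i" z "c i" 0] assms(4) by simp
next
  case (insert i A)
  have "(\<lambda>x. \<Sum>j\<in>A. c j * u j x) \<in> V" using insert by (intro sum_mem scale_mem) auto
  then show ?case using ip_lin[of "u i" "\<lambda>x. \<Sum>j\<in>A. c j * u j x" z "c i" 1] insert assms(4) by simp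
qed

section \<open>The quadrature error\<close>

context semi_inner_family
begin

abbreviation "N u \<equiv> sqrt (Re (ip u u))"

lemma ip_limit:
  assumes lim: "((\<lambda>s. N (\<lambda>x. f s x - l x)) \<longlongrightarrow> 0) (at t within I)"
    and mem: "\<And>s. s \<in> I \<Longrightarrow> f s \<in> V" "l \<in> V" "e \<in> V"
  shows "((\<lambda>s. ip (f s) e) \<longlongrightarrow> ip l e) (at t within I)"
proof (rule LIM_zero_cancel, rule tendsto_0_le[THEN tendsto_norm_zero_cancel])
  show "((\<lambda>s. N (\<lambda>x. f s x - l x) * N e) \<longlongrightarrow> 0) (at t within I)"
    by (rule tendsto_mult_left_zero[OF lim])
  show "\<forall>\<^sub>F s in at t within I. 0 \<le> norm (ip (f s) e - ip l e) \<and> norm (ip (f s) e - ip l e) \<le> N (\<lambda>x. f s x - l x) * N e"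
    using eventually_at_within_mem
  proof eventually_elim
    case (elim s)
    then have s: "s \<in> I" by simp
    have "ip (f s) e - ip l e = ip (\<lambda>x. f s x - l x) e"
      using ip_lin[OF mem(1)[OF s] mem(2,3), of 1 "-1"] by simp
    then show ?case using Cauchy_Schwarz[OF diff_mem[OF mem(1)[OF s] mem(2)] mem(3)] by simp
  qed
qed

lemma ip_derivative:
  assumes lim: "((\<lambda>s. N (\<lambda>x. (f s x - f t x) / of_real (s - t) - l x)) \<longlongrightarrow> 0) (at t within I)"
    and mem: "\<And>s. s \<in> I \<Longrightarrow> f s \<in> V" "l \<in> V" "e \<in> V" "t \<in> I"
  shows "((\<lambda>s. ip (f s) e) has_vector_derivative ip l e) (at t within I)"
proof -
  have q: "(\<lambda>x. (f s x - f t x) / of_real (s - t)) \<in> V" if "s \<in> I" for s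
    using scale_mem[OF diff_mem[OF mem(1)[OF that] mem(1)[OF mem(4)]], of "1 / of_real (s - t)"] by simp
  have eq: "ip (\<lambda>x. (f s x - f t x) / of_real (s - t)) e = (ip (f s) e - ip (f t) e) / of_real (s - t)" if "s \<in> I" for s
    using ip_lin[OF mem(1)[OF that] mem(1)[OF mem(4)] mem(3), of "1 / of_real (s - t)" "- 1 / of_real (s - t)"]
    by (simp add: diff_divide_distrib)
  have "((\<lambda>s. ip (\<lambda>x. (f s x - f t x) / of_real (s - t)) e) \<longlongrightarrow> ip l e) (at t within I)"
    by (rule ip_limit[OF lim q mem(2,3)])
  then have "((\<lambda>s. (ip (f s) e - ip (f t) e) / of_real (s - t)) \<longlongrightarrow> ip l e) (at t within I)"
    by (rule Lim_transform_eventually) (use eq in \<open>auto simp: eventually_at_filter\<close>)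
  then have "((\<lambda>s. norm ((ip (f s) e - ip (f t) e) / of_real (s - t) - ip l e)) \<longlongrightarrow> 0) (at t within I)"
    by (intro tendsto_norm_zero LIM_zero)
  then have "((\<lambda>s. norm (ip (f s) e - ip (f t) e - (s - t) *\<^sub>R ip l e) / norm (s - t)) \<longlongrightarrow> 0) (at t within I)"
  proof (rule Lim_transform_eventually)
    show "\<forall>\<^sub>F s in at t within I. norm ((ip (f s) e - ip (f t) e) / of_real (s - t) - ip l e) =
        norm (ip (f s) e - ip (f t) e - (s - t) *\<^sub>R ip l e) / norm (s - t)"
      using eventually_at_within_mem
    proof eventually_elim
      case (elim s)
      then have "(ip (f s) e - ip (f t) e) / of_real (s - t) - ip l e = (ip (f s) e - ip (f t) e - (s - t) *\<^sub>R ip l e) / of_real (s - t)"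
        by (simp add: scaleR_conv_of_real diff_divide_distrib)
      then show ?case by (simp only: norm_divide norm_of_real real_norm_def)
    qed
  qed
  then show ?thesis
    unfolding has_vector_derivative_def has_derivative_iff_norm by (simp add: bounded_linear_scaleR_left)
qed

text \<open>
  Here \<open>\<phi> j t = ip (F j t) e\<close> is a scalar function of class \<open>C\<^sup>p\<close>. It is small of order \<open>p\<close> at both ends because
  \<open>\<phi> 0 t\<close> has the factor \<open>g' t\<close>, so the trapezoidal bound applies. Substitution
  identifies the integral of \<open>\<phi> 0\<close> with the one in the original variable.
\<close>

lemma piece_quadrature:
  assumes sub: "singular_substitution a b g h \<delta> c0"
    and ord: "\<And>t. t \<in> {a..b} \<Longrightarrow> \<bar>singular_substitution.g' a b g t\<bar> \<le> K * (t - a) ^ p"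
      "\<And>t. t \<in> {a..b} \<Longrightarrow> \<bar>singular_substitution.g' a b g t\<bar> \<le> K * (b - t) ^ p"
    and p: "p > 0" and c: "trapezoid_bound p c"
    and wm: "\<And>\<alpha>. \<alpha> \<in> {a..b} \<Longrightarrow> w \<alpha> \<in> V"
    and wc: "continuous_on {a..b} (\<lambda>\<alpha>. ip (w \<alpha>) e)"
    and wb: "\<And>\<alpha>. \<alpha> \<in> {a..b} \<Longrightarrow> N (w \<alpha>) \<le> B"
    and Fm: "\<And>j t. j \<le> p \<Longrightarrow> t \<in> {a..b} \<Longrightarrow> F j t \<in> V"
    and F0: "\<And>t. t \<in> {a..b} \<Longrightarrow> F 0 t = transformed g {a..b} w t"
    and Fd: "\<And>j t. j < p \<Longrightarrow> t \<in> {a..b} \<Longrightarrow>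
        ((\<lambda>s. N (\<lambda>x. (F j s x - F j t x) / of_real (s - t) - F (Suc j) t x)) \<longlongrightarrow> 0) (at t within {a..b})"
    and FM: "\<And>t. t \<in> {a..b} \<Longrightarrow> N (F p t) \<le> M"
    and e: "e \<in> V" and n: "n > 0"
  shows "cmod (of_real ((b - a) / real n) * (\<Sum>j = 1..n. ip (transformed g {a..b} w (a + real j * (b - a) / real n)) e)
      - integral {a..b} (\<lambda>\<alpha>. ip (w \<alpha>) e)) \<le> c * ((b - a) / real n) ^ p * (b - a) * M * N e"
proof -
  interpret g: singular_substitution a b g h \<delta> c0 by fact
  define \<phi> where "\<phi> j t = ip (F j t) e" for j t
  have d: "(\<phi> j has_vector_derivative \<phi> (Suc j) t) (at t within {a..b})" if "j < p" "t \<in> {a..b}" for j t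
    unfolding \<phi>_def[abs_def]
    by (rule ip_derivative[OF Fd[OF that] Fm Fm e that(2)]) (use that in auto)
  have Ne: "0 \<le> N e" by (rule norm_nonneg[OF e])
  have \<phi>0: "\<phi> 0 t = of_real (g.g' t) * ip (w (g t)) e" if t: "t \<in> {a..b}" for t
    using ip_lin[OF wm[OF g.g_in[OF t]] wm[OF g.g_in[OF t]] e, of "of_real (g.g' t)" 0]
    by (simp add: \<phi>_def F0[OF t] g.transformed_eq)
  have \<phi>p: "norm (\<phi> p t) \<le> M * N e" if t: "t \<in> {a..b}" for t
    unfolding \<phi>_def
    by (rule order_trans[OF Cauchy_Schwarz[OF Fm[OF order_refl t] e] mult_right_mono[OF FM[OF t] Ne]])
  have B0: "0 \<le> B" using order_trans[OF norm_nonneg[OF wm] wb, of a] g.ab by simp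
  have small: "norm (\<phi> 0 t) \<le> r * (B * N e)" if t: "t \<in> {a..b}" and r: "\<bar>g.g' t\<bar> \<le> r" for t r
  proof -
    have "cmod (ip (w (g t)) e) \<le> N (w (g t)) * N e" by (rule Cauchy_Schwarz[OF wm[OF g.g_in[OF t]] e])
    also have "\<dots> \<le> B * N e" by (rule mult_right_mono[OF wb[OF g.g_in[OF t]] Ne])
    finally show ?thesis unfolding \<phi>0[OF t] norm_mult norm_of_real using r by (intro mult_mono) auto
  qed
  have left: "\<phi> j a = 0" if "j < p" for j
  proof (rule vanishing_order[OF g.ab d \<phi>p _ _ that, where e = 1 and K = "K * (B * N e)"])
    fix t assume t: "t \<in> {a<..<a + 1} \<inter> {a..b}"
    then show "norm (\<phi> 0 t) \<le> K * (B * N e) * (t - a) ^ p"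
      using small[OF _ ord(1), of t] by (simp add: algebra_simps)
  qed auto
  have right: "\<phi> j b = 0" if "j < p" for j
  proof (rule vanishing_order_right[OF g.ab d \<phi>p _ _ that, where e = 1 and K = "K * (B * N e)"])
    fix t assume t: "t \<in> {b - 1<..<b} \<inter> {a..b}"
    then show "norm (\<phi> 0 t) \<le> K * (B * N e) * (b - t) ^ p"
      using small[OF _ ord(2), of t] by (simp add: algebra_simps)
  qed auto
  have trap: "norm (((b - a) / real n) *\<^sub>R (\<Sum>j<n. \<phi> 0 (a + real j * ((b - a) / real n))) - integral {a..b} (\<phi> 0))
       \<le> c * ((b - a) / real n) ^ p * (b - a) * (M * N e)"
    using c[unfolded trapezoid_bound_def, THEN conjunct2, rule_format, of a b n \<phi> "M * N e"]
      g.ab n d left right \<phi>p by simp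
  \<comment> \<open>The two ends of the interval carry the value \<open>0\<close>, so left and right endpoint sums agree.\<close>
  have tb: "a + real n * ((b - a) / real n) = b" using n by simp
  have tin: "a + real j * ((b - a) / real n) \<in> {a..b}" if "j \<le> n" for j
  proof -
    have "real j * ((b - a) / real n) \<le> real n * ((b - a) / real n)"
      using that g.ab by (intro mult_right_mono) auto
    then show ?thesis using tb g.ab by simp
  qed
  have "(\<Sum>j<n. \<phi> 0 (a + real j * ((b - a) / real n))) = (\<Sum>j\<le>n. \<phi> 0 (a + real j * ((b - a) / real n)))"
    using right[OF p] tb by (simp add: lessThan_Suc_atMost[symmetric])
  also have "\<dots> = (\<Sum>j = 1..n. \<phi> 0 (a + real j * ((b - a) / real n)))"
    using left[OF p] by (simp add: atMost_atLeast0 sum.atLeast_Suc_atMost)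
  also have "\<dots> = (\<Sum>j = 1..n. ip (transformed g {a..b} w (a + real j * (b - a) / real n)) e)"
    by (rule sum.cong[OF refl]) (use tin in \<open>auto simp: \<phi>_def F0\<close>)
  finally have sum: "(\<Sum>j<n. \<phi> 0 (a + real j * ((b - a) / real n))) =
      (\<Sum>j = 1..n. ip (transformed g {a..b} w (a + real j * (b - a) / real n)) e)" .
  have "((\<lambda>t. g.g' t *\<^sub>R ip (w (g t)) e) has_integral integral {g a..g b} (\<lambda>\<alpha>. ip (w \<alpha>) e)) {a..b}"
    by (rule has_integral_substitution[where c = a and d = b])
      (use g.ab g.ga g.gb g.g_in wc g.g_deriv in auto)
  then have "((\<lambda>t. \<phi> 0 t) has_integral integral {a..b} (\<lambda>\<alpha>. ip (w \<alpha>) e)) {a..b}"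
    unfolding g.ga g.gb by (rule has_integral_eq[rotated]) (simp add: \<phi>0 scaleR_conv_of_real)
  then have int: "integral {a..b} (\<phi> 0) = integral {a..b} (\<lambda>\<alpha>. ip (w \<alpha>) e)" by (rule integral_unique)
  show ?thesis using trap unfolding sum int by (simp add: scaleR_conv_of_real mult.assoc)
qed

end

text \<open>
  The bound refers to the chain of derivatives that \<open>Cn_norm\<close> itself chooses.
\<close>

lemma derivative_chain_Cn_norm:
  assumes f: "f \<in> Cn V N I n"
  obtains F where "derivative_chain V N I n f F"
    "\<And>j t. j \<le> n \<Longrightarrow> t \<in> I \<Longrightarrow> N (F j t) \<le> Cn_norm V N I n f"
proof -
  let ?F = "SOME F. derivative_chain V N I n f F"
  have F: "derivative_chain V N I n f ?F"
    using f[unfolded Cn_def mem_Collect_eq] by (rule someI_ex[of "derivative_chain V N I n f"])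
  have b: "N (?F j t) \<le> Cn_norm V N I n f" if j: "j \<le> n" and t: "t \<in> I" for j t
  proof -
  have "N (?F j t) \<le> (SUP t\<in>I. N (?F j t))"
    by (rule cSUP_upper[OF t]) (use F j in \<open>auto simp: derivative_chain_def\<close>)
  also have "\<dots> \<le> (MAX j\<in>{..n}. SUP t\<in>I. N (?F j t))"
    using j by (intro Max_ge) auto
  finally show ?thesis by (simp add: Cn_norm_def Let_def)
  qed
  show ?thesis by (rule that[OF F b])
qed

lemma integral_pieces:
  fixes f :: "real \<Rightarrow> complex"
  assumes "\<Lambda> > 0" and f: "continuous_on {sing_pt \<Lambda> k 0..sing_pt \<Lambda> k (pieces \<Lambda> k)} f"
  shows "integral {sing_pt \<Lambda> k 0..sing_pt \<Lambda> k (pieces \<Lambda> k)} f = (\<Sum>i<pieces \<Lambda> k. integral {sing_pt \<Lambda> k i..sing_pt \<Lambda> k (Suc i)} f)"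
proof -
  have "integral {sing_pt \<Lambda> k 0..sing_pt \<Lambda> k j} f = (\<Sum>i<j. integral {sing_pt \<Lambda> k i..sing_pt \<Lambda> k (Suc i)} f)"
    if "j \<le> pieces \<Lambda> k" for j
    using that
  proof (induction j)
    case (Suc j)
    have "integral {sing_pt \<Lambda> k 0..sing_pt \<Lambda> k j} f + integral {sing_pt \<Lambda> k j..sing_pt \<Lambda> k (Suc j)} f
        = integral {sing_pt \<Lambda> k 0..sing_pt \<Lambda> k (Suc j)} f"
    proof (rule Henstock_Kurzweil_Integration.integral_combine)
      show "sing_pt \<Lambda> k 0 \<le> sing_pt \<Lambda> k j" "sing_pt \<Lambda> k j \<le> sing_pt \<Lambda> k (Suc j)"
        using sing_pt_le[OF assms(1)] Suc.prems by simp_all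
      have "sing_pt \<Lambda> k (Suc j) \<le> sing_pt \<Lambda> k (pieces \<Lambda> k)" using sing_pt_le[OF assms(1)] Suc.prems by simp
      then show "f integrable_on {sing_pt \<Lambda> k 0..sing_pt \<Lambda> k (Suc j)}"
        by (intro integrable_continuous_interval continuous_on_subset[OF f]) auto
    qed
    then show ?case using Suc by simp
  qed simp
  then show ?thesis by simp
qed

text \<open>
  The quantities of the theorem under short names; \<open>v w i\<close> is the transformed integrand on the
  \<open>i\<close>-th interval.
\<close>

locale bloch_quadrature = periodicity_cell +
  fixes k :: real and n :: nat and zt :: bool and g h :: "real \<Rightarrow> real"
  assumes cv: "change_of_variables \<Lambda> k g h"
begin

abbreviation "V \<equiv> S_space \<Lambda> \<zeta> H n zt"
abbreviation "NV \<equiv> S_norm \<Lambda> \<zeta> H n"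
abbreviation "\<Omega> \<equiv> cell \<Lambda> \<zeta> H"
abbreviation "P \<equiv> pieces \<Lambda> k"
abbreviation "S \<equiv> sing_pt \<Lambda> k"
abbreviation "len i \<equiv> S (Suc i) - S i"
abbreviation "families \<equiv> singular_families \<Lambda> k \<zeta> H n zt"
abbreviation "v w i \<equiv> transformed g (piece \<Lambda> k i) w"
abbreviation "Ck_norm p w i \<equiv> Cn_norm V NV (piece \<Lambda> k i) p (v w i)"

sublocale V: seminormed_family V NV by (rule seminormed_S_space)
sublocale W: semi_inner_family "sobolev n \<Omega>" "sob_ip n" by (rule semi_inner_sobolev)

lemma V_sobolev: "u \<in> V \<Longrightarrow> u \<in> sobolev n \<Omega>"
  using S_space_sobolev by blast

lemma NV_eq: "u \<in> sobolev n \<Omega> \<Longrightarrow> NV u = W.N u"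
  unfolding S_norm_def by (rule sobolev_norm_eq)

lemma len_pos: "i < P \<Longrightarrow> 0 < len i"
  using sing_pt_less[OF period_pos] by simp

lemma substitution:
  assumes "i < P"
  obtains \<delta> C where "singular_substitution (S i) (S (Suc i)) g h \<delta> C"
  using change_of_variables_piece[OF period_pos cv assms] by blast

lemma families_piece:
  assumes "w \<in> families" "i < P"
  shows "V.C_fam 0 {S i..S (Suc i)} w"
    and "\<exists>w0 w1 w2. {w0, w1, w2} \<subseteq> Cinf V NV (piece \<Lambda> k i) \<and>
      (\<forall>\<alpha> \<in> piece \<Lambda> k i. AE x in M. w \<alpha> x = w2 \<alpha> x +
         csqrt (of_real (\<alpha> - S i)) * w0 \<alpha> x + csqrt (of_real (\<alpha> - S (Suc i))) * w1 \<alpha> x)"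
  using assms V.Cn_imp_C_fam[of w "piece \<Lambda> k i" 0] unfolding singular_families_def piece_def by blast+

text \<open>
  The decomposition of \<open>w\<close> holds only almost everywhere, which is enough because the seminorm does
  not see null sets.
\<close>

lemma transformed_Cn:
  assumes w: "w \<in> families" and i: "i < P"
  shows "v w i \<in> Cn V NV (piece \<Lambda> k i) p"
proof -
  obtain \<delta> C where sb: "singular_substitution (S i) (S (Suc i)) g h \<delta> C" using substitution[OF i] by blast
  from families_piece(2)[OF w i] obtain w0 w1 w2 where
    w012: "{w0, w1, w2} \<subseteq> Cinf V NV (piece \<Lambda> k i)"
    and ae: "\<forall>\<alpha> \<in> piece \<Lambda> k i. AE x in M.
       w \<alpha> x = w2 \<alpha> x + csqrt (of_real (\<alpha> - S i)) * w0 \<alpha> x + csqrt (of_real (\<alpha> - S (Suc i))) * w1 \<alpha> x"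
    by (elim exE conjE)
  have f: "w0 \<in> Cinf V NV (piece \<Lambda> k i)" "w1 \<in> Cinf V NV (piece \<Lambda> k i)" "w2 \<in> Cinf V NV (piece \<Lambda> k i)"
    using w012 by blast+
  have fam: "V.C_fam j {S i..S (Suc i)} u" if "u \<in> Cinf V NV (piece \<Lambda> k i)" for j u
    by (rule V.Cn_imp_C_fam) (use that in \<open>simp add: Cinf_def piece_def\<close>)
  have "V.C_fam p {S i..S (Suc i)} (transformed g {S i..S (Suc i)} w)"
  proof (rule V.C_fam_transformed[OF sb V.C_fam_mem[OF families_piece(1)[OF w i]] fam[OF f(1)] fam[OF f(2)] fam[OF f(3)]])
    fix \<alpha> assume al: "\<alpha> \<in> {S i..S (Suc i)}"
    have "(\<lambda>x. w \<alpha> x - (w2 \<alpha> x + csqrt (of_real (\<alpha> - S i)) * w0 \<alpha> x + csqrt (of_real (\<alpha> - S (Suc i))) * w1 \<alpha> x)) \<in> sobolev n \<Omega>"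
      by (intro V_sobolev V.diff_mem V.add_mem V.scale_mem V.C_fam_mem[OF families_piece(1)[OF w i] al]
          V.C_fam_mem[OF fam[OF f(1)] al] V.C_fam_mem[OF fam[OF f(2)] al] V.C_fam_mem[OF fam[OF f(3)] al])
    then show "NV (\<lambda>x. w \<alpha> x - (w2 \<alpha> x + csqrt (of_real (\<alpha> - S i)) * w0 \<alpha> x + csqrt (of_real (\<alpha> - S (Suc i))) * w1 \<alpha> x)) = 0"
      unfolding S_norm_def
    proof (rule sobolev_norm_AE_0)
      have "\<alpha> \<in> piece \<Lambda> k i" using al by (simp add: piece_def)
      from bspec[OF ae this] show "AE x in M. w \<alpha> x - (w2 \<alpha> x + csqrt (of_real (\<alpha> - S i)) * w0 \<alpha> x + csqrt (of_real (\<alpha> - S (Suc i))) * w1 \<alpha> x) = 0"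
        by eventually_elim simp
    qed
  qed
  then show ?thesis unfolding piece_def by (intro V.C_fam_imp_Cn) auto
qed

text \<open>
  The hypothesis gives continuity on each closed interval; at a common end point the one-sided
  limits combine to a two-sided one.
\<close>

lemma families_initial_continuous:
  assumes w: "w \<in> families" and "1 \<le> j" "j \<le> P"
  shows "V.C_fam 0 {S 0..S j} w"
  using assms(2,3)
proof (induction j rule: dec_induct)
  case base
  then have "0 < P" by simp
  from families_piece(1)[OF w this] show ?case by (simp only: One_nat_def)
next
  case (step j)
  have "{S 0..S (Suc j)} = {S 0..S j} \<union> {S j..S (Suc j)}"
    using sing_pt_le[OF period_pos, of 0 j k] sing_pt_le[OF period_pos, of j "Suc j" k] step by (simp add: ivl_disj_un_two_touch)
  moreover have "V.C_fam 0 {S 0..S j} w" by (rule step.IH) (use step in simp)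
  moreover have "V.C_fam 0 {S j..S (Suc j)} w" by (rule families_piece(1)[OF w]) (use step in simp)
  ultimately show ?case by (simp only:) (intro V.C_fam_0_union closed_atLeastAtMost)
qed

abbreviation "A \<equiv> S 0"
abbreviation "B \<equiv> S P"

lemma families_continuous:
  assumes w: "w \<in> families"
  shows "V.C_fam 0 {A..B} w"
  by (rule families_initial_continuous[OF w]) (use pieces_pos[of \<Lambda> k] in auto)

lemma piece_subset:
  assumes "i < P"
  shows "{S i..S (Suc i)} \<subseteq> {A..B}"
  using sing_pt_le[OF period_pos, of 0 i k] sing_pt_le[OF period_pos, of "Suc i" P k] assms by auto

lemma families_bounded:
  assumes "w \<in> families"
  obtains R where "\<And>\<alpha>. \<alpha> \<in> {A..B} \<Longrightarrow> NV (w \<alpha>) \<le> R"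
proof -
  from V.C_fam_bounded[OF compact_Icc families_continuous[OF assms]]
  obtain R where R: "\<forall>r \<in> (\<lambda>\<alpha>. NV (w \<alpha>)) ` {A..B}. r \<le> R"
    unfolding bdd_above_def ..
  show ?thesis by (rule that) (rule bspec[OF R imageI])
qed

lemma families_ip_continuous:
  assumes w: "w \<in> families" and e: "e \<in> sobolev n \<Omega>"
  shows "continuous_on {A..B} (\<lambda>\<alpha>. sob_ip n (w \<alpha>) e)"
  unfolding continuous_on_def
proof
  fix \<alpha> assume al: "\<alpha> \<in> {A..B}"
  show "((\<lambda>\<alpha>. sob_ip n (w \<alpha>) e) \<longlongrightarrow> sob_ip n (w \<alpha>) e) (at \<alpha> within {A..B})"
  proof (rule W.ip_limit[OF _ V_sobolev[OF V.C_fam_mem[OF families_continuous[OF w]]] V_sobolev[OF V.C_fam_mem[OF families_continuous[OF w] al]] e])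
    have "((\<lambda>s. NV (\<lambda>x. w s x - w \<alpha> x)) \<longlongrightarrow> 0) (at \<alpha> within {A..B})"
      using V.C_fam_vlim[OF families_continuous[OF w] al] by (simp add: V.vlim_def)
    then show "((\<lambda>s. sqrt (Re (sob_ip n (\<lambda>x. w s x - w \<alpha> x) (\<lambda>x. w s x - w \<alpha> x)))) \<longlongrightarrow> 0) (at \<alpha> within {A..B})"
      by (rule Lim_transform_eventually)
        (use NV_eq[OF W.diff_mem[OF V_sobolev[OF V.C_fam_mem[OF families_continuous[OF w]]] V_sobolev[OF V.C_fam_mem[OF families_continuous[OF w] al]]]] in \<open>auto simp: eventually_at_filter\<close>)
  qed
qed

text \<open>
  The exact transform as a weak integral. The version of \<open>w\<close> chosen inside \<open>inverse_bloch\<close> is a jointly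
  measurable one because such a version exists.
\<close>

lemma inverse_bloch_ip:
  assumes w: "w \<in> families"
  shows "inverse_bloch \<Lambda> k \<zeta> H w \<in> sobolev n \<Omega>"
    and "e \<in> sobolev n \<Omega> \<Longrightarrow> sob_ip n (inverse_bloch \<Lambda> k \<zeta> H w) e =
      (\<Sum>i<P. integral {S i..S (Suc i)} (\<lambda>\<alpha>. sob_ip n (w \<alpha>) e))"
proof -
  note wAB = families_continuous[OF w]
  have AB: "A \<le> B" by (rule sing_pt_le[OF period_pos]) auto
  have ws: "w \<alpha> \<in> sobolev n \<Omega>" if "\<alpha> \<in> {A..B}" for \<alpha> by (rule V_sobolev[OF V.C_fam_mem[OF wAB that]])
  obtain R where R: "\<And>\<alpha>. \<alpha> \<in> {A..B} \<Longrightarrow> NV (w \<alpha>) \<le> R" using families_bounded[OF w] by blast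
  have uc: "\<exists>\<delta>>0. \<forall>s\<in>{A..B}. \<forall>t\<in>{A..B}. \<bar>s - t\<bar> < \<delta> \<longrightarrow> sobolev_norm n \<Omega> (\<lambda>x. w s x - w t x) \<le> e" if "e > 0" for e
    using V.C_fam_uniformly_continuous[OF compact_Icc wAB that] unfolding S_norm_def .
  have "\<exists>w'. joint_version {A<..B} \<Omega> w w'"
  proof (rule joint_version_exists)
    show "w \<alpha> \<in> L2 M" if "\<alpha> \<in> {A..B}" for \<alpha> by (rule sobolev_L2[OF ws[OF that]])
    fix e :: real assume e: "e > 0"
    obtain \<delta> where \<delta>: "\<delta> > 0" "\<And>s t. s \<in> {A..B} \<Longrightarrow> t \<in> {A..B} \<Longrightarrow> \<bar>s - t\<bar> < \<delta> \<Longrightarrow> sobolev_norm n \<Omega> (\<lambda>x. w s x - w t x) \<le> sqrt e"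
      using uc[of "sqrt e"] e by auto
    have "(LINT x|M. (cmod (w s x - w t x))\<^sup>2) \<le> e" if st: "s \<in> {A..B}" "t \<in> {A..B}" "\<bar>s - t\<bar> < \<delta>" for s t
    proof -
      have d: "(\<lambda>x. w s x - w t x) \<in> V" by (intro V.diff_mem V.C_fam_mem[OF wAB] st)
      have "(LINT x|M. (cmod (w s x - w t x))\<^sup>2) \<le> (sobolev_norm n \<Omega> (\<lambda>x. w s x - w t x))\<^sup>2"
        by (rule L2_le_sobolev_norm[OF V_sobolev[OF d]])
      also have "\<dots> \<le> (sqrt e)\<^sup>2"
        by (rule power_mono[OF \<delta>(2)[OF st] V.norm_nonneg[OF d, unfolded S_norm_def]])
      finally show ?thesis using e by simp
    qed
    then show "\<exists>\<delta>>0. \<forall>s\<in>{A..B}. \<forall>t\<in>{A..B}. \<bar>s - t\<bar> < \<delta> \<longrightarrow> (LINT x|M. (cmod (w s x - w t x))\<^sup>2) \<le> e"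
      using \<delta>(1) by blast
  qed
  then have jv: "joint_version {A<..B} \<Omega> w (SOME w'. joint_version {A<..B} \<Omega> w w')" by (rule someI_ex)
  have U_eq: "inverse_bloch \<Lambda> k \<zeta> H w = (\<lambda>x. LINT \<alpha>:{A<..B}|lborel. (SOME w'. joint_version {A<..B} \<Omega> w w') \<alpha> x)"
    by (simp add: inverse_bloch_def bloch_cell_eq Let_def)
  show "inverse_bloch \<Lambda> k \<zeta> H w \<in> sobolev n \<Omega>"
    unfolding U_eq by (rule sobolev_integral(1)[OF AB ws R[unfolded S_norm_def] uc jv])
  assume e: "e \<in> sobolev n \<Omega>"
  note c = families_ip_continuous[OF w e]
  have "sob_ip n (inverse_bloch \<Lambda> k \<zeta> H w) e = (LINT \<alpha>:{A<..B}|lborel. sob_ip n (w \<alpha>) e)"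
    unfolding U_eq by (rule sobolev_integral(2)[OF AB ws R[unfolded S_norm_def] uc jv e])
  also have "\<dots> = integral {A..B} (\<lambda>\<alpha>. sob_ip n (w \<alpha>) e)" by (rule set_integral_half_open[OF c])
  also have "\<dots> = (\<Sum>i<P. integral {S i..S (Suc i)} (\<lambda>\<alpha>. sob_ip n (w \<alpha>) e))"
    by (rule integral_pieces[OF period_pos c])
  finally show "sob_ip n (inverse_bloch \<Lambda> k \<zeta> H w) e = (\<Sum>i<P. integral {S i..S (Suc i)} (\<lambda>\<alpha>. sob_ip n (w \<alpha>) e))" .
qed

lemma piece_error:
  assumes w: "w \<in> families" and i: "i < P" and p: "p > 0" and c: "trapezoid_bound p c"
    and ord: "\<And>t. t \<in> {S i..S (Suc i)} \<Longrightarrow> \<bar>singular_substitution.g' (S i) (S (Suc i)) g t\<bar> \<le> K * (t - S i) ^ p \<and>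
      \<bar>singular_substitution.g' (S i) (S (Suc i)) g t\<bar> \<le> K * (S (Suc i) - t) ^ p"
    and Q: "Q > 0" and e: "e \<in> sobolev n \<Omega>"
  shows "cmod (of_real (len i / real Q) * (\<Sum>j = 1..Q. sob_ip n (v w i (node \<Lambda> k Q i j)) e)
      - integral {S i..S (Suc i)} (\<lambda>\<alpha>. sob_ip n (w \<alpha>) e)) \<le> c * (len i / real Q) ^ p * len i * Ck_norm p w i * NV e"
proof -
  obtain \<delta> C where sb: "singular_substitution (S i) (S (Suc i)) g h \<delta> C" using substitution[OF i] by blast
  obtain R where R: "\<And>\<alpha>. \<alpha> \<in> {A..B} \<Longrightarrow> NV (w \<alpha>) \<le> R" using families_bounded[OF w] by blast
  have ws: "w t \<in> sobolev n \<Omega>" if "t \<in> {S i..S (Suc i)}" for t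
    by (rule V_sobolev[OF V.C_fam_mem[OF families_piece(1)[OF w i] that]])
  obtain F where F: "derivative_chain V NV (piece \<Lambda> k i) p (v w i) F"
    and FM: "\<And>j t. j \<le> p \<Longrightarrow> t \<in> piece \<Lambda> k i \<Longrightarrow> NV (F j t) \<le> Ck_norm p w i"
    using derivative_chain_Cn_norm[OF transformed_Cn[OF w i]] by blast
  have Fm: "F j t \<in> sobolev n \<Omega>" if "j \<le> p" "t \<in> {S i..S (Suc i)}" for j t
    using F that V_sobolev unfolding derivative_chain_def piece_def by blast
  show ?thesis
    unfolding NV_eq[OF e] node_def piece_def
  proof (rule W.piece_quadrature[OF sb _ _ _ c])
    fix t assume t: "t \<in> {S i..S (Suc i)}"
    show "\<bar>singular_substitution.g' (S i) (S (Suc i)) g t\<bar> \<le> K * (t - S i) ^ p"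
      "\<bar>singular_substitution.g' (S i) (S (Suc i)) g t\<bar> \<le> K * (S (Suc i) - t) ^ p"
      using ord t by blast+
    show "w t \<in> sobolev n \<Omega>" by (rule ws[OF t])
    show "sqrt (Re (sob_ip n (w t) (w t))) \<le> R"
      using R[OF subsetD[OF piece_subset[OF i] t]] unfolding NV_eq[OF ws[OF t]] .
    show "F 0 t = transformed g {S i..S (Suc i)} w t"
      using F t unfolding derivative_chain_def piece_def by blast
    show "sqrt (Re (sob_ip n (F p t) (F p t))) \<le>
        Cn_norm V NV {S i..S (Suc i)} p (transformed g {S i..S (Suc i)} w)"
      using FM[unfolded piece_def, OF order_refl t] unfolding NV_eq[OF Fm[OF order_refl t]] .
  next
    fix j t assume j: "j < p" and t: "t \<in> {S i..S (Suc i)}"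
    have "((\<lambda>s. NV (\<lambda>x. (F j s x - F j t x) / of_real (s - t) - F (Suc j) t x)) \<longlongrightarrow> 0) (at t within {S i..S (Suc i)})"
      using F j t unfolding derivative_chain_def piece_def by blast
    then show "((\<lambda>s. sqrt (Re (sob_ip n (\<lambda>x. (F j s x - F j t x) / of_real (s - t) - F (Suc j) t x)
        (\<lambda>x. (F j s x - F j t x) / of_real (s - t) - F (Suc j) t x)))) \<longlongrightarrow> 0) (at t within {S i..S (Suc i)})"
    proof (rule Lim_transform_eventually)
      show "\<forall>\<^sub>F s in at t within {S i..S (Suc i)}. NV (\<lambda>x. (F j s x - F j t x) / of_real (s - t) - F (Suc j) t x) =
          sqrt (Re (sob_ip n (\<lambda>x. (F j s x - F j t x) / of_real (s - t) - F (Suc j) t x)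
            (\<lambda>x. (F j s x - F j t x) / of_real (s - t) - F (Suc j) t x)))"
        using W.eventually_at_within_mem
      proof eventually_elim
        case (elim s)
        show ?case by (rule NV_eq[OF W.quotient_mem[OF Fm Fm Fm]]) (use j t elim in auto)
      qed
    qed
  next
    show "continuous_on {S i..S (Suc i)} (\<lambda>\<alpha>. sob_ip n (w \<alpha>) e)"
      by (rule continuous_on_subset[OF families_ip_continuous[OF w e] piece_subset[OF i]])
  qed (use Q e p Fm in \<open>auto simp: piece_def\<close>)
qed

lemma transformed_node_mem:
  assumes w: "w \<in> families" and i: "i < P" and j: "j \<le> Q" "Q > 0"
  shows "v w i (node \<Lambda> k Q i j) \<in> V"
proof -
  have "real j * len i \<le> real Q * len i" using j len_pos[OF i] by (intro mult_right_mono) auto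
  then have "real j * len i / real Q \<le> len i" using j by (simp add: divide_le_eq mult.commute)
  then have "node \<Lambda> k Q i j \<in> piece \<Lambda> k i"
    using len_pos[OF i] j by (simp add: node_def piece_def)
  with V.C_fam_mem[OF V.Cn_imp_C_fam[OF transformed_Cn[OF w i]]] show ?thesis .
qed

lemma inverse_bloch_num_mem:
  assumes "w \<in> families" "Q > 0"
  shows "inverse_bloch_num \<Lambda> k g Q w \<in> V"
  unfolding inverse_bloch_num_def
  by (intro V.sum_mem V.scale_mem) (use assms pieces_pos[of \<Lambda> k] transformed_node_mem in auto)

lemma Ck_norm_nonneg:
  assumes w: "w \<in> families" and i: "i < P"
  shows "0 \<le> Ck_norm p w i"
proof -
  obtain F where F: "derivative_chain V NV (piece \<Lambda> k i) p (v w i) F"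
    and FM: "\<And>j t. j \<le> p \<Longrightarrow> t \<in> piece \<Lambda> k i \<Longrightarrow> NV (F j t) \<le> Ck_norm p w i"
    using derivative_chain_Cn_norm[OF transformed_Cn[OF w i]] by blast
  have Si: "S i \<in> piece \<Lambda> k i" using len_pos[OF i] by (simp add: piece_def)
  have "F 0 (S i) \<in> V" using F Si unfolding derivative_chain_def by blast
  from order_trans[OF V.norm_nonneg[OF this] FM[OF _ Si]] show ?thesis by simp
qed

text \<open>
  Duality: the square of the norm of the error \<open>E\<close> is its inner product with \<open>E\<close>, which is a sum of scalar
  quadrature errors, each bounded by a multiple of the norm of \<open>E\<close>.
\<close>

lemma error_by_pieces:
  assumes w: "w \<in> families" and p: "p > 0" and c: "trapezoid_bound p c"
    and ord: "\<And>i t. i < P \<Longrightarrow> t \<in> {S i..S (Suc i)} \<Longrightarrow> \<bar>singular_substitution.g' (S i) (S (Suc i)) g t\<bar> \<le> K i * (t - S i) ^ p \<and>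
      \<bar>singular_substitution.g' (S i) (S (Suc i)) g t\<bar> \<le> K i * (S (Suc i) - t) ^ p"
    and Q: "Q > 0"
  shows "NV (\<lambda>x. inverse_bloch_num \<Lambda> k g Q w x - inverse_bloch \<Lambda> k \<zeta> H w x)
    \<le> (\<Sum>i<P. c * (len i / real Q) ^ p * len i * Ck_norm p w i)"
proof -
  define U where "U = inverse_bloch \<Lambda> k \<zeta> H w"
  have U: "U \<in> sobolev n \<Omega>" unfolding U_def by (rule inverse_bloch_ip(1)[OF w])
  define E where "E = (\<lambda>x. inverse_bloch_num \<Lambda> k g Q w x - U x)"
  have E: "E \<in> sobolev n \<Omega>" unfolding E_def by (intro W.diff_mem V_sobolev inverse_bloch_num_mem w Q U)
  have "sob_ip n (inverse_bloch_num \<Lambda> k g Q w) E =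
      (\<Sum>i<P. of_real (len i / real Q) * sob_ip n (\<lambda>x. \<Sum>j = 1..Q. 1 * v w i (node \<Lambda> k Q i j) x) E)"
    unfolding inverse_bloch_num_def mult_1
    by (rule W.ip_sum) (use pieces_pos[of \<Lambda> k] Q E in \<open>auto intro!: V_sobolev V.sum_mem transformed_node_mem[OF w]\<close>)
  also have "\<dots> = (\<Sum>i<P. of_real (len i / real Q) * (\<Sum>j = 1..Q. 1 * sob_ip n (v w i (node \<Lambda> k Q i j)) E))"
    by (intro sum.cong refl arg_cong[where f = "(*) _"] W.ip_sum) (use Q E in \<open>auto intro!: V_sobolev transformed_node_mem[OF w]\<close>)
  finally have ipn: "sob_ip n (inverse_bloch_num \<Lambda> k g Q w) E =
      (\<Sum>i<P. of_real (len i / real Q) * (\<Sum>j = 1..Q. sob_ip n (v w i (node \<Lambda> k Q i j)) E))" by simp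
  have dual: "cmod ((\<Sum>i<P. of_real (len i / real Q) * (\<Sum>j = 1..Q. sob_ip n (v w i (node \<Lambda> k Q i j)) E)) - sob_ip n U E)
      \<le> (\<Sum>i<P. c * (len i / real Q) ^ p * len i * Ck_norm p w i) * NV E"
    unfolding U_def inverse_bloch_ip(2)[OF w E] sum_subtractf[symmetric] sum_distrib_right
    by (rule sum_norm_le) (rule piece_error[OF w _ p c ord Q E], auto)
  have "sob_ip n E E = sob_ip n (inverse_bloch_num \<Lambda> k g Q w) E - sob_ip n U E"
    using W.ip_lin[OF V_sobolev[OF inverse_bloch_num_mem[OF w Q]] U E, of 1 "-1"] by (simp add: E_def)
  then have "(NV E)\<^sup>2 \<le> (\<Sum>i<P. c * (len i / real Q) ^ p * len i * Ck_norm p w i) * NV E"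
    using dual sobolev_norm_sq[OF E] by (simp add: ipn S_norm_def)
  moreover have "0 \<le> (\<Sum>i<P. c * (len i / real Q) ^ p * len i * Ck_norm p w i)"
    using c len_pos Ck_norm_nonneg[OF w]
    by (intro sum_nonneg mult_nonneg_nonneg zero_le_power divide_nonneg_nonneg) (auto simp: trapezoid_bound_def less_imp_le)
  ultimately have "NV E \<le> (\<Sum>i<P. c * (len i / real Q) ^ p * len i * Ck_norm p w i)"
    by (cases "NV E > 0") (auto simp: power2_eq_square)
  then show ?thesis by (simp add: E_def U_def)
qed

lemma derivative_vanishing:
  assumes "h \<in> O[at_right 0](\<lambda>t. t ^ (m + 1))"
  obtains K where "\<And>i t. i < P \<Longrightarrow> t \<in> {S i..S (Suc i)} \<Longrightarrow>
    \<bar>singular_substitution.g' (S i) (S (Suc i)) g t\<bar> \<le> K i * (t - S i) ^ (2 * m + 1) \<and>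
    \<bar>singular_substitution.g' (S i) (S (Suc i)) g t\<bar> \<le> K i * (S (Suc i) - t) ^ (2 * m + 1)"
proof -
  have "\<forall>i\<in>{..<P}. \<exists>K. \<forall>t\<in>{S i..S (Suc i)}.
    \<bar>singular_substitution.g' (S i) (S (Suc i)) g t\<bar> \<le> K * (t - S i) ^ (2 * m + 1) \<and>
    \<bar>singular_substitution.g' (S i) (S (Suc i)) g t\<bar> \<le> K * (S (Suc i) - t) ^ (2 * m + 1)"
  proof
    fix i assume "i \<in> {..<P}"
    then obtain \<delta> C where "singular_substitution (S i) (S (Suc i)) g h \<delta> C" using substitution[of i] by blast
    then show "\<exists>K. \<forall>t\<in>{S i..S (Suc i)}.
      \<bar>singular_substitution.g' (S i) (S (Suc i)) g t\<bar> \<le> K * (t - S i) ^ (2 * m + 1) \<and>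
      \<bar>singular_substitution.g' (S i) (S (Suc i)) g t\<bar> \<le> K * (S (Suc i) - t) ^ (2 * m + 1)"
      by (rule singular_substitution.g'_vanishing_order[OF _ assms])
  qed
  from bchoice[OF this] obtain K where "\<forall>i\<in>{..<P}. \<forall>t\<in>{S i..S (Suc i)}.
    \<bar>singular_substitution.g' (S i) (S (Suc i)) g t\<bar> \<le> K i * (t - S i) ^ (2 * m + 1) \<and>
    \<bar>singular_substitution.g' (S i) (S (Suc i)) g t\<bar> \<le> K i * (S (Suc i) - t) ^ (2 * m + 1)" ..
  then show ?thesis by (intro that[of K]) blast
qed

text \<open>
  The trapezoidal rule gives the power \<open>- 2 * m - 1\<close> of \<open>N\<close>, which is then weakened.
\<close>

lemma quadrature_error:
  assumes "h \<in> O[at_right 0](\<lambda>t. t ^ (m + 1))"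
  shows "\<exists>C::real. \<exists>N0::nat. \<forall>w \<in> families. (\<forall>i < P. v w i \<in> Cn V NV (piece \<Lambda> k i) (2 * m + 1)) \<and>
    (\<forall>N::nat. even N \<and> N > 0 \<and> N \<ge> N0 \<longrightarrow>
      (\<lambda>x. inverse_bloch_num \<Lambda> k g N w x - inverse_bloch \<Lambda> k \<zeta> H w x) \<in> V \<and>
      NV (\<lambda>x. inverse_bloch_num \<Lambda> k g N w x - inverse_bloch \<Lambda> k \<zeta> H w x)
        \<le> C * real N powr (- 2 * real m - 1 / 2) * (MAX i\<in>{..<P}. Ck_norm (2 * m + 1) w i))"
proof -
  let ?p = "2 * m + 1"
  obtain K where K: "\<And>i t. i < P \<Longrightarrow> t \<in> {S i..S (Suc i)} \<Longrightarrow>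
    \<bar>singular_substitution.g' (S i) (S (Suc i)) g t\<bar> \<le> K i * (t - S i) ^ ?p \<and>
    \<bar>singular_substitution.g' (S i) (S (Suc i)) g t\<bar> \<le> K i * (S (Suc i) - t) ^ ?p"
    using derivative_vanishing[OF assms] by blast
  obtain c where c: "trapezoid_bound ?p c" using trapezoid_error[of ?p] by auto
  then have c0: "c \<ge> 0" by (simp add: trapezoid_bound_def)
  define C where "C = (\<Sum>i<P. c * len i ^ ?p * len i)"
  have C0: "C \<ge> 0"
    unfolding C_def using c0 len_pos by (intro sum_nonneg mult_nonneg_nonneg zero_le_power) (auto simp: less_imp_le)
  show ?thesis
  proof (intro exI[of _ C] exI[of _ 0] ballI)
    fix w assume w: "w \<in> families"
    define U where "U = inverse_bloch \<Lambda> k \<zeta> H w"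
    have U: "U \<in> sobolev n \<Omega>" unfolding U_def by (rule inverse_bloch_ip(1)[OF w])
    define X where "X = (MAX i\<in>{..<P}. Ck_norm ?p w i)"
    have CX: "Ck_norm ?p w i \<le> X" if "i < P" for i unfolding X_def using that by (intro Max_ge) auto
    have X0: "0 \<le> X" using CX[OF pieces_pos] Ck_norm_nonneg[OF w pieces_pos, of ?p] by linarith
    have rate: "NV (\<lambda>x. inverse_bloch_num \<Lambda> k g Q w x - U x) \<le> C * real Q powr (- 2 * real m - 1 / 2) * X"
      if Q: "Q > 0" for Q
    proof -
      have "NV (\<lambda>x. inverse_bloch_num \<Lambda> k g Q w x - U x) \<le> (\<Sum>i<P. c * (len i / real Q) ^ ?p * len i * Ck_norm ?p w i)"
        unfolding U_def by (rule error_by_pieces[OF w _ c K Q]) auto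
      also have "\<dots> \<le> (\<Sum>i<P. c * (len i / real Q) ^ ?p * len i * X)"
      proof (rule sum_mono)
        fix i assume i: "i \<in> {..<P}"
        show "c * (len i / real Q) ^ ?p * len i * Ck_norm ?p w i \<le> c * (len i / real Q) ^ ?p * len i * X"
          using c0 len_pos[of i] i CX[of i] by (intro mult_left_mono mult_nonneg_nonneg zero_le_power divide_nonneg_nonneg) auto
      qed
      also have "\<dots> = C * (1 / real Q ^ ?p) * X"
        by (simp only: C_def sum_distrib_right power_divide) (rule sum.cong[OF refl], simp)
      also have "1 / real Q ^ ?p = real Q powr (- real ?p)"
        using Q by (simp only: powr_minus_divide powr_realpow of_nat_0_less_iff)
      also have "C * real Q powr (- real ?p) * X \<le> C * real Q powr (- 2 * real m - 1 / 2) * X"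
        using Q C0 X0 by (intro mult_right_mono mult_left_mono powr_mono) auto
      finally show ?thesis .
    qed
    \<comment> \<open>The exact integral is a limit of the quadrature sums, so it inherits a zero trace.\<close>
    have UV: "U \<in> V"
    proof (rule S_space_limit[OF U inverse_bloch_num_mem[OF w]])
      show "(\<lambda>l. NV (\<lambda>x. inverse_bloch_num \<Lambda> k g (Suc l) w x - U x)) \<longlonglongrightarrow> 0"
      proof (rule tendsto_sandwich[OF _ _ tendsto_const])
        have "(\<lambda>l. real (Suc l) powr (- 2 * real m - 1 / 2)) \<longlonglongrightarrow> 0"
          by (rule LIMSEQ_Suc[OF tendsto_neg_powr]) (auto intro: filterlim_real_sequentially)
        from tendsto_mult_left_zero[OF tendsto_mult_right_zero[OF this, of C], of X]
        show "(\<lambda>l. C * real (Suc l) powr (- 2 * real m - 1 / 2) * X) \<longlonglongrightarrow> 0" .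
        have m: "(\<lambda>x. inverse_bloch_num \<Lambda> k g (Suc l) w x - U x) \<in> sobolev n \<Omega>" for l
          by (intro W.diff_mem U V_sobolev inverse_bloch_num_mem w) simp
        show "\<forall>\<^sub>F l in sequentially. 0 \<le> NV (\<lambda>x. inverse_bloch_num \<Lambda> k g (Suc l) w x - U x)"
          unfolding NV_eq[OF m] by (intro always_eventually allI W.norm_nonneg m)
        show "\<forall>\<^sub>F l in sequentially. NV (\<lambda>x. inverse_bloch_num \<Lambda> k g (Suc l) w x - U x) \<le> C * real (Suc l) powr (- 2 * real m - 1 / 2) * X"
          by (intro always_eventually allI rate) simp
      qed
    qed simp
    show "(\<forall>i < P. v w i \<in> Cn V NV (piece \<Lambda> k i) ?p) \<and> (\<forall>N::nat. even N \<and> N > 0 \<and> N \<ge> 0 \<longrightarrow>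
        (\<lambda>x. inverse_bloch_num \<Lambda> k g N w x - inverse_bloch \<Lambda> k \<zeta> H w x) \<in> V \<and>
        NV (\<lambda>x. inverse_bloch_num \<Lambda> k g N w x - inverse_bloch \<Lambda> k \<zeta> H w x)
          \<le> C * real N powr (- 2 * real m - 1 / 2) * (MAX i\<in>{..<P}. Ck_norm ?p w i))"
      unfolding U_def[symmetric] X_def[symmetric]
    proof (intro conjI allI impI transformed_Cn[OF w])
      fix N :: nat assume "even N \<and> N > 0 \<and> N \<ge> 0"
      then have N: "N > 0" by simp
      show "(\<lambda>x. inverse_bloch_num \<Lambda> k g N w x - U x) \<in> V"
        by (intro V.diff_mem inverse_bloch_num_mem[OF w N] UV)
      show "NV (\<lambda>x. inverse_bloch_num \<Lambda> k g N w x - U x) \<le> C * real N powr (- 2 * real m - 1 / 2) * X"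
        by (rule rate[OF N])
    qed
  qed
qed

end

section \<open>Convergence of the numerical inverse Bloch transform\<close>

theorem theorem29:
  fixes \<Lambda> k H :: real and \<zeta> g h :: "real \<Rightarrow> real" and n :: nat and zt :: bool
  assumes "\<Lambda> > 0" and "k > 0"
    and "\<exists>L. L-lipschitz_on UNIV \<zeta>"
    and "\<forall>s. \<zeta> (s + \<Lambda>) = \<zeta> s"
    and "H > (SUP s. \<zeta> s)"
    and "n \<le> 2"
    and "change_of_variables \<Lambda> k g h"
  shows "(\<forall>m::nat. m \<ge> 1 \<and> h \<in> O[at_right 0](\<lambda>t. t ^ (m + 1)) \<longrightarrow>
      (\<exists>C::real. \<exists>N0::nat. \<forall>w \<in> singular_families \<Lambda> k \<zeta> H n zt.
        (\<forall>i < pieces \<Lambda> k. transformed g (piece \<Lambda> k i) w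
           \<in> Cn (S_space \<Lambda> \<zeta> H n zt) (S_norm \<Lambda> \<zeta> H n) (piece \<Lambda> k i) (2 * m + 1)) \<and>
        (\<forall>N::nat. even N \<and> N > 0 \<and> N \<ge> N0 \<longrightarrow>
           (\<lambda>x. inverse_bloch_num \<Lambda> k g N w x - inverse_bloch \<Lambda> k \<zeta> H w x) \<in> S_space \<Lambda> \<zeta> H n zt \<and>
           S_norm \<Lambda> \<zeta> H n (\<lambda>x. inverse_bloch_num \<Lambda> k g N w x - inverse_bloch \<Lambda> k \<zeta> H w x)
             \<le> C * real N powr (- 2 * real m - 1 / 2) *
               (MAX i\<in>{..<pieces \<Lambda> k}. Cn_norm (S_space \<Lambda> \<zeta> H n zt) (S_norm \<Lambda> \<zeta> H n)
                  (piece \<Lambda> k i) (2 * m + 1) (transformed g (piece \<Lambda> k i) w))))) \<and>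
    ((\<forall>r::nat. r \<ge> 1 \<longrightarrow> h \<in> o[at_right 0](\<lambda>t. t ^ (r + 1))) \<longrightarrow>
     (\<forall>r::nat. r \<ge> 1 \<longrightarrow>
      (\<exists>C::real. \<exists>N0::nat. \<forall>w \<in> singular_families \<Lambda> k \<zeta> H n zt.
        (\<forall>i < pieces \<Lambda> k. transformed g (piece \<Lambda> k i) w
           \<in> Cn (S_space \<Lambda> \<zeta> H n zt) (S_norm \<Lambda> \<zeta> H n) (piece \<Lambda> k i) (2 * r + 1)) \<and>
        (\<forall>N::nat. even N \<and> N > 0 \<and> N \<ge> N0 \<longrightarrow>
           (\<lambda>x. inverse_bloch_num \<Lambda> k g N w x - inverse_bloch \<Lambda> k \<zeta> H w x) \<in> S_space \<Lambda> \<zeta> H n zt \<and>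
           S_norm \<Lambda> \<zeta> H n (\<lambda>x. inverse_bloch_num \<Lambda> k g N w x - inverse_bloch \<Lambda> k \<zeta> H w x)
             \<le> C * real N powr (- 2 * real r - 1 / 2) *
               (MAX i\<in>{..<pieces \<Lambda> k}. Cn_norm (S_space \<Lambda> \<zeta> H n zt) (S_norm \<Lambda> \<zeta> H n)
                  (piece \<Lambda> k i) (2 * r + 1) (transformed g (piece \<Lambda> k i) w))))))"
proof -
  obtain L where "L-lipschitz_on UNIV \<zeta>" using assms(3) ..
  then interpret bloch_quadrature \<Lambda> H \<zeta> k n zt g h
    by unfold_locales (use assms(1,7) lipschitz_on_continuous_on in blast)+
  \<comment> \<open>In the second part \<open>o\<close> is weakened to \<open>O\<close> for the exponent in question.\<close>
  show ?thesis
    by (intro conjI allI impI; rule quadrature_error; (elim conjE, assumption | blast intro: landau_o.small_imp_big))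
qed

end
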